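(* Let $n\ge 2$. For every convex $(n+3)$-gon $Q\subset\mathbb{R}^2$, every polytope $\mathrm{Ass}_n^{\rm II}(A_n)$ whose normal fan is the fan with maximal cones $\mathbb{R}_{\ge0}C$ generated by all clusters $C$ of type $A_n$, and every vector $\mathbf{a}=\{a_{ij}>0:1\le i\le j\le n+1\}$ of positive parameters, the polytope $\mathrm{Ass}_n^{\rm I}(Q)$ is affinely equivalent to neither $\mathrm{Ass}_n^{\rm II}(A_n)$ nor $\mathrm{Ass}_n^{\rm III}(\mathbf{a})$.
   Context: Construction I. Let $Q\subset\mathbb{R}^2$ be a convex $(n+3)$-gon with vertices labeled $1,\dots,n+3$. The GKZ vector of a triangulation $t$ of $Q$ (without new vertices) is $v(t)=\sum_{i=1}^{n+3}\sum_{\sigma\in t:\,i\in\sigma}\mathrm{vol}(\sigma)e_i\in\mathbb{R}^{n+3}$, where $\sigma$ ranges over the triangles of $t$ having $i$ as a vertex and $\mathrm{vol}$ is the area. $\mathrm{Ass}_n^{\rm I}(Q):=\Sigma(Q)=\mathrm{conv}\{v(t): t\text{ a triangulation of }Q\}$ is the secondary polytope of $Q$, an $n$-dimensional polytope. Construction II. Let $\alpha_i=e_i-e_{i+1}$, $1\le i\le n$, be the simple roots of type $A_n$ in $\mathbb{R}^{n+1}$; the positive roots are $\alpha_{ij}=\alpha_i+\cdots+\alpha_j$, $1\le i\le j\le n$; the almost positive roots are the positive roots together with $-\alpha_1,\dots,-\alpha_n$. Label the vertices of a convex $(n+3)$-gon $1,\dots,n+3$ in cyclic order. Identify the almost positive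 roots with diagonals of the polygon: $-\alpha_{2i-1}$ with $\{i,n+3-i\}$ for $1\le i\le(n+1)/2$ and $-\alpha_{2i}$ with $\{i+1,n+3-i\}$ for $1\le i\le n/2$ (the zigzag "snake"), and $\alpha_{ij}$ with the unique diagonal crossing, among the snake diagonals, exactly $-\alpha_i,\dots,-\alpha_j$. Two almost positive roots are compatible if their diagonals do not cross; clusters are the maximal sets of pairwise compatible almost positive roots. The cones $\mathbb{R}_{\ge0}C$ over clusters $C$ form a complete simplicial fan in $V=\{x\in\mathbb{R}^{n+1}:x_1+\cdots+x_{n+1}=0\}$ (identified with its dual via the standard inner product), which is the normal fan of some $n$-dimensional simple polytope; $\mathrm{Ass}_n^{\rm II}(A_n)$ denotes any polytope with this normal fan. Construction III. For $\mathbf{a}=\{a_{ij}>0:1\le i\le j\le n+1\}$, $\mathrm{Ass}_n^{\rm III}(\mathbf{a})=\sum_{1\le i\le j\le n+1}a_{ij}\Delta_{[i,\dots,j]}\subset\mathbb{R}^{n+1}$ (Minkowski sum), where $\Delta_{[i,\dots,j]}=\mathrm{conv}\{e_i,e_{i+1},\dots,e_j\}$. Two polytopes are affinely equivalent if some affine isomorphism between their affine hulls maps one onto the other. *)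

theory Defs
  imports "HOL-Analysis.Analysis"
begin

section \<open>Affine equivalence and coordinates\<close>

definition affinely_equivalent ::
  "'a::real_vector set \<Rightarrow> 'b::real_vector set \<Rightarrow> bool" where
  "affinely_equivalent P R \<longleftrightarrow>
     (\<exists>f. (\<forall>x \<in> affine hull P. \<forall>y \<in> affine hull P. \<forall>u v. u + v = 1 \<longrightarrow>
              f (u *\<^sub>R x + v *\<^sub>R y) = u *\<^sub>R f x + v *\<^sub>R f y) \<and>
          bij_betw f (affine hull P) (affine hull R) \<and>
          f ` P = R)"

text \<open>
  The space \<open>\<real>\<^sup>N\<close> is modelled by a Euclidean space together with an enumeration
  \<open>e 1, \<dots>, e N\<close> of its basis; this forces the dimension to be \<open>N\<close>.
\<close>

definition standard_basis :: "nat \<Rightarrow> (nat \<Rightarrow> 'a::euclidean_space) \<Rightarrow> bool" where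
  "standard_basis N e \<longleftrightarrow> bij_betw e {1..N} Basis"


section \<open>Secondary polytopes of convex polygons\<close>

text \<open>For \<open>N \<ge> 3\<close> the polytope \<open>Q\<close> is automatically two-dimensional.\<close>

definition convex_polygon :: "nat \<Rightarrow> (nat \<Rightarrow> real^2) \<Rightarrow> (real^2) set \<Rightarrow> bool" where
  "convex_polygon N q Q \<longleftrightarrow>
     polytope Q \<and> bij_betw q {1..N} {v. v extreme_point_of Q}"

definition polygon_triangulation :: "(real^2) set \<Rightarrow> (real^2) set set \<Rightarrow> bool" where
  "polygon_triangulation Q t \<longleftrightarrow>
     triangulation t \<and> \<Union>t = Q \<and>
     (\<forall>\<sigma>\<in>t. 2 simplex \<sigma> \<and> {v. v extreme_point_of \<sigma>} \<subseteq> {v. v extreme_point_of Q})"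

definition GKZ_vector ::
  "nat \<Rightarrow> (nat \<Rightarrow> real^2) \<Rightarrow> (nat \<Rightarrow> 'b::euclidean_space) \<Rightarrow> (real^2) set set \<Rightarrow> 'b" where
  "GKZ_vector N q e t =
     (\<Sum>i = 1..N. \<Sum>\<sigma> | \<sigma> \<in> t \<and> q i extreme_point_of \<sigma>. measure lborel \<sigma> *\<^sub>R e i)"

definition Ass_I ::
  "nat \<Rightarrow> (nat \<Rightarrow> real^2) \<Rightarrow> (real^2) set \<Rightarrow> (nat \<Rightarrow> 'b::euclidean_space) \<Rightarrow> 'b set" where
  "Ass_I n q Q e = convex hull {GKZ_vector (n + 3) q e t | t. polygon_triangulation Q t}"


section \<open>The cluster fan of type A\<close>

definition simple_root :: "(nat \<Rightarrow> 'a::euclidean_space) \<Rightarrow> nat \<Rightarrow> 'a" where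
  "simple_root e i = e i - e (Suc i)"

definition positive_root :: "(nat \<Rightarrow> 'a::euclidean_space) \<Rightarrow> nat \<Rightarrow> nat \<Rightarrow> 'a" where
  "positive_root e i j = (\<Sum>k = i..j. simple_root e k)"

definition almost_positive_roots :: "nat \<Rightarrow> (nat \<Rightarrow> 'a::euclidean_space) \<Rightarrow> 'a set" where
  "almost_positive_roots n e =
     {positive_root e i j | i j. 1 \<le> i \<and> i \<le> j \<and> j \<le> n} \<union>
     {- simple_root e i | i. 1 \<le> i \<and> i \<le> n}"

text \<open>
  Diagonals of a convex \<open>N\<close>-gon with vertices labelled \<open>1, \<dots>, N\<close> in cyclic order are
  encoded as two-element sets of non-adjacent labels.
\<close>

definition diagonals :: "nat \<Rightarrow> nat set set" where
  "diagonals N = {{a, b} | a b. 1 \<le> a \<and> a + 2 \<le> b \<and> b \<le> N \<and> \<not> (a = 1 \<and> b = N)}"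

text \<open>
  Diagonals cross iff their endpoints interleave in the cyclic order. The lemma
  \<open>crossing_iff_segments_meet\<close> below shows that this is the geometric notion, for every
  convex polygon labelled in cyclic order.
\<close>

definition crossing :: "nat set \<Rightarrow> nat set \<Rightarrow> bool" where
  "crossing D D' \<longleftrightarrow>
     (\<exists>a b c d. a < b \<and> b < c \<and> c < d \<and>
        (D = {a, c} \<and> D' = {b, d} \<or> D = {b, d} \<and> D' = {a, c}))"

definition orientation :: "real^2 \<Rightarrow> real^2 \<Rightarrow> real^2 \<Rightarrow> real" where
  "orientation x y z = (y$1 - x$1) * (z$2 - x$2) - (y$2 - x$2) * (z$1 - x$1)"

lemma orientation_convex_comb:
  "orientation x y ((1 - u) *\<^sub>R z + u *\<^sub>R w)
     = (1 - u) * orientation x y z + u * orientation x y w"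
  by (simp add: orientation_def algebra_simps)

lemma orientation_open_segment:
  assumes "x \<in> open_segment a c"
  shows "orientation a c x = 0"
  using assms by (auto simp: in_segment orientation_convex_comb) (simp add: orientation_def)

lemma open_segments_disjoint:
  assumes "orientation a c b \<ge> 0 \<and> orientation a c d \<ge> 0 \<or>
           orientation a c b \<le> 0 \<and> orientation a c d \<le> 0"
    and "orientation a c b \<noteq> 0 \<or> orientation a c d \<noteq> 0"
  shows "open_segment a c \<inter> open_segment b d = {}"
proof (rule ccontr)
  assume "\<not> ?thesis"
  then obtain x where x: "x \<in> open_segment a c" "x \<in> open_segment b d" by blast
  then obtain u where u: "0 < u" "u < 1" "x = (1 - u) *\<^sub>R b + u *\<^sub>R d"
    by (auto simp: in_segment)
  have eq: "(1 - u) * orientation a c b + u * orientation a c d = 0"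
    using orientation_open_segment[OF x(1)] u(3) by (simp add: orientation_convex_comb)
  from assms(1) show False
  proof
    assume h: "orientation a c b \<ge> 0 \<and> orientation a c d \<ge> 0"
    then have "(1 - u) * orientation a c b \<ge> 0" "u * orientation a c d \<ge> 0" using u by auto
    with eq have "(1 - u) * orientation a c b = 0" "u * orientation a c d = 0" by linarith+
    with u assms(2) show False by auto
  next
    assume h: "orientation a c b \<le> 0 \<and> orientation a c d \<le> 0"
    then have "(1 - u) * orientation a c b \<le> 0" "u * orientation a c d \<le> 0"
      using u by (auto simp: mult_le_0_iff)
    with eq have "(1 - u) * orientation a c b = 0" "u * orientation a c d = 0" by linarith+
    with u assms(2) show False by auto
  qed
qed

lemma open_segments_meet:
  assumes "orientation a b c > 0" "orientation a c d > 0"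
    and "orientation a b d > 0" "orientation b c d > 0"
  shows "open_segment a c \<inter> open_segment b d \<noteq> {}"
proof -
  define wb wd va vc where w: "wb = orientation a b c" "wd = orientation a c d"
    "va = orientation a b d" "vc = orientation b c d"
  define s where "s = wb + wd"
  have pos: "wb > 0" "wd > 0" "va > 0" "vc > 0" "s > 0" using assms w by (auto simp: s_def)
  have s: "s = va + vc" by (simp add: s_def w orientation_def algebra_simps)
  have eq: "wd *\<^sub>R b + wb *\<^sub>R d = vc *\<^sub>R a + va *\<^sub>R c"
    by (simp add: vec_eq_iff forall_2 w orientation_def) (simp add: algebra_simps)
  define x where "x = (1 / s) *\<^sub>R (wd *\<^sub>R b + wb *\<^sub>R d)"
  have "x = (1 - wb / s) *\<^sub>R b + (wb / s) *\<^sub>R d"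
    using pos by (simp add: x_def s_def scaleR_add_right field_simps)
  moreover have "x = (1 - va / s) *\<^sub>R a + (va / s) *\<^sub>R c"
  proof -
    have "1 - va / s = vc / s" using pos s by (simp add: field_simps)
    then show ?thesis unfolding x_def eq by (simp add: scaleR_add_right)
  qed
  moreover have "b \<noteq> d" "a \<noteq> c" using assms by (auto simp: orientation_def algebra_simps)
  moreover have "0 < wb / s" "wb / s < 1" "0 < va / s" "va / s < 1"
    using pos s by (auto simp: s_def)
  ultimately have "x \<in> open_segment a c" "x \<in> open_segment b d"
    unfolding in_segment by blast+
  then show ?thesis by blast
qed

lemma crossing_iff_segments_meet:
  fixes p :: "nat \<Rightarrow> real^2"
  assumes cyclic: "\<And>i j k. 1 \<le> i \<Longrightarrow> i < j \<Longrightarrow> j < k \<Longrightarrow> k \<le> N \<Longrightarrow> orientation (p i) (p j) (p k) > 0"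
    and ac: "1 \<le> a" "a < c" "c \<le> N" and bd: "1 \<le> b" "b < d" "d \<le> N"
    and ne: "{a, c} \<noteq> {b, d}"
  shows "crossing {a, c} {b, d} \<longleftrightarrow>
           open_segment (p a) (p c) \<inter> open_segment (p b) (p d) \<noteq> {}"
proof -
  have cr: "crossing {a, c} {b, d} \<longleftrightarrow> a < b \<and> b < c \<and> c < d \<or> b < a \<and> a < d \<and> d < c"
  proof
    assume "crossing {a, c} {b, d}"
    then show "a < b \<and> b < c \<and> c < d \<or> b < a \<and> a < d \<and> d < c"
      using ac bd unfolding crossing_def doubleton_eq_iff by auto
  next
    assume "a < b \<and> b < c \<and> c < d \<or> b < a \<and> a < d \<and> d < c"
    then show "crossing {a, c} {b, d}"
      unfolding crossing_def by blast
  qed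
  have inside: "orientation (p a) (p c) (p k) < 0" if "a < k" "k < c" for k
    using cyclic[of a k c] that ac by (simp add: orientation_def algebra_simps)
  have below: "orientation (p a) (p c) (p k) > 0" if "1 \<le> k" "k < a" for k
    using cyclic[of k a c] that ac by (simp add: orientation_def algebra_simps)
  have above: "orientation (p a) (p c) (p k) > 0" if "c < k" "k \<le> N" for k
    using cyclic[of a c k] that ac by simp
  have ends: "orientation (p a) (p c) (p a) = 0" "orientation (p a) (p c) (p c) = 0"
    by (simp_all add: orientation_def)
  show ?thesis
  proof (cases "crossing {a, c} {b, d}")
    case True
    then consider "a < b" "b < c" "c < d" | "b < a" "a < d" "d < c" using cr by blast
    then have "open_segment (p a) (p c) \<inter> open_segment (p b) (p d) \<noteq> {}"
    proof cases
      case 1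
      then show ?thesis using ac bd by (intro open_segments_meet cyclic) auto
    next
      case 2
      then have "open_segment (p b) (p d) \<inter> open_segment (p a) (p c) \<noteq> {}"
        using ac bd by (intro open_segments_meet cyclic) auto
      then show ?thesis by blast
    qed
    with True show ?thesis by simp
  next
    case False
    let ?o = "orientation (p a) (p c)"
    have out: "?o (p k) > 0" if "k < a \<or> c < k" "1 \<le> k" "k \<le> N" for k
      using that above below by blast
    have "a \<le> b \<and> d \<le> c \<or> (b \<le> a \<or> c \<le> b) \<and> (d \<le> a \<or> c \<le> d)"
      using False cr by linarith
    then have "open_segment (p a) (p c) \<inter> open_segment (p b) (p d) = {}"
    proof
      assume h: "a \<le> b \<and> d \<le> c"
      have "?o (p b) \<le> 0" "?o (p d) \<le> 0"
        using h bd inside[of b] inside[of d] ends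
        by (metis le_neq_implies_less less_eq_real_def less_trans not_less)+
      moreover have "?o (p b) < 0 \<or> ?o (p d) < 0"
        using h bd ne inside[of b] inside[of d] by (metis le_neq_implies_less less_le_trans le_less_trans)
      ultimately show ?thesis by (intro open_segments_disjoint) auto
    next
      assume h: "(b \<le> a \<or> c \<le> b) \<and> (d \<le> a \<or> c \<le> d)"
      have "?o (p k) \<ge> 0" if "k \<le> a \<or> c \<le> k" "1 \<le> k" "k \<le> N" for k
        using that out[of k] ends by (metis le_neq_implies_less less_eq_real_def)
      then have "?o (p b) \<ge> 0" "?o (p d) \<ge> 0" using h bd by auto
      moreover have "?o (p b) > 0 \<or> ?o (p d) > 0"
      proof -
        have "b < a \<or> c < b \<or> d < a \<or> c < d"
          using h ne ac bd by (metis le_neq_implies_less nat_less_le)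
        then show ?thesis using out bd by auto
      qed
      ultimately show ?thesis by (intro open_segments_disjoint) auto
    qed
    with False show ?thesis by simp
  qed
qed

definition snake_diagonal :: "nat \<Rightarrow> nat \<Rightarrow> nat set" where
  "snake_diagonal n k =
     (if odd k then {(k + 1) div 2, n + 3 - (k + 1) div 2}
      else {k div 2 + 1, n + 3 - k div 2})"

definition root_diagonal :: "nat \<Rightarrow> (nat \<Rightarrow> 'a::euclidean_space) \<Rightarrow> 'a \<Rightarrow> nat set" where
  "root_diagonal n e \<beta> = (THE D. D \<in> diagonals (n + 3) \<and>
     ((\<exists>i \<in> {1..n}. \<beta> = - simple_root e i \<and> D = snake_diagonal n i) \<or>
      (\<exists>i j. 1 \<le> i \<and> i \<le> j \<and> j \<le> n \<and> \<beta> = positive_root e i j \<and>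
         {k \<in> {1..n}. crossing D (snake_diagonal n k)} = {i..j})))"

definition compatible :: "nat \<Rightarrow> (nat \<Rightarrow> 'a::euclidean_space) \<Rightarrow> 'a \<Rightarrow> 'a \<Rightarrow> bool" where
  "compatible n e \<beta> \<gamma> \<longleftrightarrow> \<not> crossing (root_diagonal n e \<beta>) (root_diagonal n e \<gamma>)"

definition clusters :: "nat \<Rightarrow> (nat \<Rightarrow> 'a::euclidean_space) \<Rightarrow> 'a set set" where
  "clusters n e =
     {C. C \<subseteq> almost_positive_roots n e \<and> pairwise (compatible n e) C \<and>
         (\<forall>C'. C \<subseteq> C' \<and> C' \<subseteq> almost_positive_roots n e \<and> pairwise (compatible n e) C'
               \<longrightarrow> C' = C)}"

text \<open>
  The fan whose maximal cones are generated by the clusters consists of these cones and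
  all their faces. The library relation \<open>face_of\<close> also admits the empty face, which is
  not a cone of a fan.
\<close>

definition cluster_fan :: "nat \<Rightarrow> (nat \<Rightarrow> 'a::euclidean_space) \<Rightarrow> 'a set set" where
  "cluster_fan n e =
     {K. K \<noteq> {} \<and> (\<exists>C \<in> clusters n e. K face_of (convex_cone hull C))}"

definition sum_zero_space :: "nat \<Rightarrow> (nat \<Rightarrow> 'a::euclidean_space) \<Rightarrow> 'a set" where
  "sum_zero_space n e = {x. (\<Sum>i = 1..n + 1. x \<bullet> e i) = 0}"

text \<open>
  Outer normals; using inner normals instead amounts to replacing \<open>P\<close> by the affinely
  equivalent \<open>- P\<close>. The linear functionals on \<open>V\<close> are represented by vectors of \<open>V\<close>.
\<close>

definition normal_cone :: "'a::euclidean_space set \<Rightarrow> 'a set \<Rightarrow> 'a set \<Rightarrow> 'a set" where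
  "normal_cone V P F = {c \<in> V. \<forall>x\<in>F. \<forall>y\<in>P. c \<bullet> y \<le> c \<bullet> x}"

definition normal_fan :: "'a::euclidean_space set \<Rightarrow> 'a set \<Rightarrow> 'a set set" where
  "normal_fan V P = {normal_cone V P F | F. F face_of P \<and> F \<noteq> {}}"

text \<open>
  \<open>P\<close> may lie in any translate of \<open>V\<close>, since neither normal fans nor affine equivalence
  see translations.
\<close>

definition is_Ass_II :: "nat \<Rightarrow> (nat \<Rightarrow> 'a::euclidean_space) \<Rightarrow> 'a set \<Rightarrow> bool" where
  "is_Ass_II n e P \<longleftrightarrow>
     polytope P \<and>
     (\<forall>x\<in>P. \<forall>y\<in>P. x - y \<in> sum_zero_space n e) \<and>
     normal_fan (sum_zero_space n e) P = cluster_fan n e"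


section \<open>Minkowski sums of simplices\<close>

text \<open>Sums of sets are Minkowski sums, as in \<^theory>\<open>HOL-Library.Set_Algebras\<close>.\<close>

definition Ass_III ::
  "nat \<Rightarrow> (nat \<Rightarrow> 'a::euclidean_space) \<Rightarrow> (nat \<Rightarrow> nat \<Rightarrow> real) \<Rightarrow> 'a set" where
  "Ass_III n e a =
     (\<Sum>(i, j) \<in> {(i, j). 1 \<le> i \<and> i \<le> j \<and> j \<le> n + 1}.
        (\<lambda>x. a i j *\<^sub>R x) ` (convex hull (e ` {i..j})))"

end

theory Submission
  imports Defs
begin

text \<open>
  The invariant that separates the constructions is the existence of two parallel facets: a
  linear functional whose maximal and whose minimal face are both facets. An affine
  equivalence preserves it.

  The polytopes of constructions II and III have parallel facets. For a polytope whose normal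
  fan is the cluster fan, a ray of the fan is the normal of a facet, and both
  \<open>\<alpha>\<^sub>1\<close> and \<open>- \<alpha>\<^sub>1\<close> span rays: each of them completes
  \<open>- \<alpha>\<^sub>2, \<dots>, - \<alpha>\<^sub>n\<close> to a cluster
  (\<open>Ass_II_has_opposite_facets\<close>). For the Minkowski sum of the simplices
  \<open>\<Delta>\<^bsub>[i,\<dots>,j]\<^esub>\<close>, the faces on which the first coordinate
  is maximal and minimal both contain a translate of a dilation of
  \<open>\<Delta>\<^bsub>[2,\<dots>,n+1]\<^esub>\<close>, which has codimension one
  (\<open>Ass_III_has_opposite_facets\<close>).

  The secondary polytope has none (\<open>Ass_I_no_opposite_facets\<close>). A functional on it is a height
  function \<open>\<omega>\<close> on the vertices of the polygon, and its value at the GKZ vector of a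
  triangulation is three times the integral of the piecewise linear interpolation of
  \<open>\<omega>\<close>. Hence it is maximal exactly at those triangulations whose interpolation is
  concave, that is, which refine the subdivision induced by the upper hull of the lifted
  vertices (\<open>regular_imp_maximal\<close>, \<open>maximal_imp_regular\<close>). In particular the heights on which
  all GKZ vectors agree are the affine ones. If \<open>\<omega>\<close> is not affine, the induced
  subdivision uses a diagonal \<open>D\<close> (\<open>coarse_diagonal_exists\<close>). The convex function
  \<open>max 0 l\<close>, where \<open>l\<close> is an affine function vanishing on \<open>D\<close>, has
  its minimum on all the maximal triangulations. So if the maximal face of \<open>\<omega>\<close> is a
  facet, then \<open>max 0 l\<close> is, up to affine functions, a negative multiple of
  \<open>\<omega>\<close>, for both signs of \<open>l\<close> (\<open>facet_functional_is_fold\<close>). If the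
  minimal face is a facet as well, there is a second diagonal with affine function
  \<open>l'\<close> such that \<open>max 0 l'\<close> is in the same sense a positive multiple of
  \<open>\<omega>\<close>, and a positive combination of \<open>max 0 l\<close> and \<open>max 0 l'\<close> is affine on the vertices.
  The lines through the two diagonals bound four, possibly degenerate, closed quadrants, and if
  there are at least five vertices then one of these contains three of them. With the signs chosen accordingly the combination
  vanishes at three vertices, hence at all of them, which is absurd.
\<close>

section \<open>Parallel facets as an affine invariant\<close>

text \<open>
  This says that the face of \<open>P\<close> on which \<open>c\<close> is maximal is a facet (if \<open>c\<close> is not constant on
  \<open>P\<close>), in a form without dimensions: the functionals that are constant on this face are on
  \<open>P\<close> nothing but affine functions of \<open>c\<close>.
\<close>

definition facet_functional :: "'a::euclidean_space set \<Rightarrow> 'a \<Rightarrow> bool" where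
  "facet_functional P c \<longleftrightarrow>
     (\<forall>d k. (\<forall>x\<in>P. (\<forall>y\<in>P. c \<bullet> y \<le> c \<bullet> x) \<longrightarrow> d \<bullet> x = k) \<longrightarrow>
        (\<exists>r b. \<forall>x\<in>P. d \<bullet> x = r * (c \<bullet> x) + b))"

definition has_opposite_facets :: "'a::euclidean_space set \<Rightarrow> bool" where
  "has_opposite_facets P \<longleftrightarrow>
     (\<exists>c. (\<exists>x\<in>P. \<exists>y\<in>P. c \<bullet> x \<noteq> c \<bullet> y) \<and> facet_functional P c \<and> facet_functional P (- c))"

text \<open>
  An affine equivalence is defined on affine hulls only. This lemma turns functionals that are
  pulled back along it into inner products with a vector.
\<close>

lemma affine_on_extends:
  fixes g :: "'a::euclidean_space \<Rightarrow> real"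
  assumes S: "affine S"
    and g: "\<And>x y u v. x \<in> S \<Longrightarrow> y \<in> S \<Longrightarrow> u + v = 1 \<Longrightarrow> g (u *\<^sub>R x + v *\<^sub>R y) = u * g x + v * g y"
  shows "\<exists>a b. \<forall>x\<in>S. g x = a \<bullet> x + b"
proof (cases "S = {}")
  case False
  then obtain x0 where x0: "x0 \<in> S" by blast
  define W where "W = (\<lambda>x. x - x0) ` S"
  have W: "subspace W" unfolding W_def by (rule affine_diffs_subspace_subtract[OF S x0])
  have WS: "x0 + w \<in> S" if "w \<in> W" for w using that by (auto simp: W_def)
  define g0 where "g0 w = g (x0 + w) - g x0" for w
  have scale: "g0 (u *\<^sub>R w) = u * g0 w" if w: "w \<in> W" for u w
  proof -
    have "x0 + u *\<^sub>R w = u *\<^sub>R (x0 + w) + (1 - u) *\<^sub>R x0" by (simp add: algebra_simps)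
    then have "g (x0 + u *\<^sub>R w) = u * g (x0 + w) + (1 - u) * g x0"
      using g[OF WS[OF w] x0, of u "1 - u"] by simp
    then show ?thesis by (simp add: g0_def algebra_simps)
  qed
  have add: "g0 (w + z) = g0 w + g0 z" if w: "w \<in> W" and z: "z \<in> W" for w z
  proof -
    define m where "m = (1/2) *\<^sub>R (x0 + w) + (1/2) *\<^sub>R (x0 + z)"
    have m: "m \<in> S" "g m = (1/2) * g (x0 + w) + (1/2) * g (x0 + z)"
      unfolding m_def using S WS[OF w] WS[OF z] g[OF WS[OF w] WS[OF z], of "1/2" "1/2"]
      by (auto simp: affine_def)
    \<comment> \<open>Additivity by way of the midpoint, since only affine combinations of two points are available.\<close>
    have "x0 + (w + z) = 2 *\<^sub>R m + (-1) *\<^sub>R x0"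
      by (simp add: m_def scaleR_add_right)
    then have "g (x0 + (w + z)) = 2 * g m + (-1) * g x0" using g[OF m(1) x0, of 2 "-1"] by simp
    then show ?thesis using m(2) by (simp add: g0_def)
  qed
  obtain B where B: "B \<subseteq> W" "independent B" "W \<subseteq> span B" by (rule basis_exists)
  obtain h where h: "linear h" "\<And>x. x \<in> B \<Longrightarrow> h x = g0 x"
    using linear_independent_extend[OF B(2), of g0] by blast
  have "subspace {w \<in> W. h w = g0 w}"
  proof (rule subspaceI)
    show "0 \<in> {w \<in> W. h w = g0 w}" using W h(1) by (simp add: subspace_0 linear_0 g0_def)
    show "x + y \<in> {w \<in> W. h w = g0 w}" if "x \<in> {w \<in> W. h w = g0 w}" "y \<in> {w \<in> W. h w = g0 w}" for x y
      using that W h(1) add by (simp add: subspace_add linear_add)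
    show "u *\<^sub>R x \<in> {w \<in> W. h w = g0 w}" if "x \<in> {w \<in> W. h w = g0 w}" for u x
      using that W h(1) scale by (simp add: subspace_mul linear_cmul)
  qed
  moreover have "B \<subseteq> {w \<in> W. h w = g0 w}" using B(1) h(2) by auto
  ultimately have "span B \<subseteq> {w \<in> W. h w = g0 w}" by (intro span_minimal)
  then have hW: "h w = g0 w" if "w \<in> W" for w using that B(3) by blast
  have "g x = adjoint h 1 \<bullet> x + (g x0 - adjoint h 1 \<bullet> x0)" if "x \<in> S" for x
  proof -
    have "x - x0 \<in> W" using that by (simp add: W_def)
    then have "h (x - x0) = g x - g x0" using hW by (simp add: g0_def)
    moreover have "(x - x0) \<bullet> adjoint h 1 = h (x - x0) \<bullet> 1" by (rule adjoint_works[OF h(1)])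
    ultimately show ?thesis by (simp add: inner_diff_right inner_commute inner_diff_left)
  qed
  then show ?thesis by blast
qed simp

text \<open>
  The maximal faces of \<open>c'\<close> and \<open>c\<close> correspond under \<open>f\<close>, and so do, by \<open>push\<close>, the functionals that are
  constant on them.
\<close>

lemma facet_functional_transfer:
  assumes img: "f ` A = P" and pull: "\<And>x. x \<in> A \<Longrightarrow> c \<bullet> f x = c' \<bullet> x + b0"
    and push: "\<And>d. \<exists>d' b. \<forall>x\<in>A. d \<bullet> x = d' \<bullet> f x + b"
    and facet: "facet_functional P c"
  shows "facet_functional A c'"
  unfolding facet_functional_def
proof (intro allI impI)
  fix d k assume d: "\<forall>x\<in>A. (\<forall>y\<in>A. c' \<bullet> y \<le> c' \<bullet> x) \<longrightarrow> d \<bullet> x = k"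
  obtain d' b where d': "\<And>x. x \<in> A \<Longrightarrow> d \<bullet> x = d' \<bullet> f x + b" using push by blast
  have "\<forall>x\<in>P. (\<forall>y\<in>P. c \<bullet> y \<le> c \<bullet> x) \<longrightarrow> d' \<bullet> x = k - b"
  proof (intro ballI impI)
    fix x assume x: "x \<in> P" "\<forall>y\<in>P. c \<bullet> y \<le> c \<bullet> x"
    then obtain x' where x': "x' \<in> A" "x = f x'" using img by blast
    have "c' \<bullet> y \<le> c' \<bullet> x'" if "y \<in> A" for y
      using x(2) pull[OF x'(1)] pull[OF that] img that x'(2) by fastforce
    then show "d' \<bullet> x = k - b" using d x'(1) d'[OF x'(1)] x'(2) by simp
  qed
  then obtain r s where "\<And>x. x \<in> P \<Longrightarrow> d' \<bullet> x = r * (c \<bullet> x) + s"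
    using facet unfolding facet_functional_def by meson
  then have "d \<bullet> x = r * (c' \<bullet> x) + (r * b0 + s + b)" if "x \<in> A" for x
    using d'[OF that] pull[OF that] img that by (auto simp: distrib_left)
  then show "\<exists>r b. \<forall>x\<in>A. d \<bullet> x = r * (c' \<bullet> x) + b" by blast
qed

lemma has_opposite_facets_affinely_equivalent:
  fixes A :: "'a::euclidean_space set" and P :: "'b::euclidean_space set"
  assumes eq: "affinely_equivalent A P" and P: "has_opposite_facets P"
  shows "has_opposite_facets A"
proof -
  obtain f where f: "\<And>x y u v. x \<in> affine hull A \<Longrightarrow> y \<in> affine hull A \<Longrightarrow> u + v = 1 \<Longrightarrow>
      f (u *\<^sub>R x + v *\<^sub>R y) = u *\<^sub>R f x + v *\<^sub>R f y"
    and bij: "bij_betw f (affine hull A) (affine hull P)" and img: "f ` A = P"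
    using eq unfolding affinely_equivalent_def by blast
  define g where "g = inv_into (affine hull A) f"
  have gf: "g (f x) = x" if "x \<in> affine hull A" for x
    using bij that by (simp add: g_def bij_betw_inv_into_left)
  have fg: "f (g y) = y" "g y \<in> affine hull A" if "y \<in> affine hull P" for y
    using bij that bij_betw_inv_into_right[OF bij that] bij_betw_apply[OF bij_betw_inv_into[OF bij] that]
    by (simp_all add: g_def)
  have pull: "\<exists>c' b. \<forall>x\<in>affine hull A. c \<bullet> f x = c' \<bullet> x + b" for c
    by (rule affine_on_extends) (simp_all add: f inner_add_right affine_affine_hull)
  have gaff: "g (u *\<^sub>R x + v *\<^sub>R y) = u *\<^sub>R g x + v *\<^sub>R g y"
    if xy: "x \<in> affine hull P" "y \<in> affine hull P" and uv: "u + v = 1" for x y u v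
  proof -
    have "u *\<^sub>R g x + v *\<^sub>R g y \<in> affine hull A"
      using affine_affine_hull[of A] fg(2)[OF xy(1)] fg(2)[OF xy(2)] uv unfolding affine_def by blast
    then show ?thesis
      using gf f[OF fg(2)[OF xy(1)] fg(2)[OF xy(2)] uv] fg(1)[OF xy(1)] fg(1)[OF xy(2)] by metis
  qed
  have "\<exists>d' b. \<forall>y\<in>affine hull P. d \<bullet> g y = d' \<bullet> y + b" for d
    by (rule affine_on_extends) (simp_all add: gaff inner_add_right affine_affine_hull)
  moreover have "f x \<in> affine hull P" if "x \<in> A" for x
    using img that hull_inc[of "f x" P] by blast
  ultimately have push: "\<exists>d' b. \<forall>x\<in>A. d \<bullet> x = d' \<bullet> f x + b" for d
    using gf hull_inc[of _ A affine] by metis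
  obtain c where c: "\<exists>x\<in>P. \<exists>y\<in>P. c \<bullet> x \<noteq> c \<bullet> y" "facet_functional P c" "facet_functional P (- c)"
    using P unfolding has_opposite_facets_def by blast
  obtain c' b where c': "\<And>x. x \<in> A \<Longrightarrow> c \<bullet> f x = c' \<bullet> x + b"
    using pull[of c] hull_inc[of _ A affine] by blast
  have "facet_functional A c'" by (rule facet_functional_transfer[OF img c' push c(2)])
  moreover have "facet_functional A (- c')"
    by (rule facet_functional_transfer[OF img _ push c(3), where ?b0.0 = "- b"]) (simp add: c')
  moreover have "\<exists>x\<in>A. \<exists>y\<in>A. c' \<bullet> x \<noteq> c' \<bullet> y"
  proof -
    obtain x y where "x \<in> A" "y \<in> A" "c \<bullet> f x \<noteq> c \<bullet> f y" using c(1) img by blast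
    then show ?thesis using c' by (metis)
  qed
  ultimately show ?thesis unfolding has_opposite_facets_def by blast
qed

section \<open>Affine functionals and orientations in the plane\<close>

definition affine_functional :: "('a::real_inner \<Rightarrow> real) \<Rightarrow> bool" where
  "affine_functional h \<longleftrightarrow> (\<exists>a b. \<forall>x. h x = a \<bullet> x + b)"

lemma affine_functional_add:
  "affine_functional g \<Longrightarrow> affine_functional h \<Longrightarrow> affine_functional (\<lambda>x. g x + h x)"
  unfolding affine_functional_def by (metis add.commute add.left_commute inner_add_left)

lemma affine_functional_cmul: "affine_functional h \<Longrightarrow> affine_functional (\<lambda>x. c * h x)"
  unfolding affine_functional_def by (metis distrib_left inner_scaleR_left)

lemma affine_functional_const: "affine_functional (\<lambda>x. c)"
  unfolding affine_functional_def by (metis add_0 inner_zero_left)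

lemma affine_functional_uminus: "affine_functional h \<Longrightarrow> affine_functional (\<lambda>x. - h x)"
  using affine_functional_cmul[of h "-1"] by simp

lemma affine_functional_diff:
  "affine_functional g \<Longrightarrow> affine_functional h \<Longrightarrow> affine_functional (\<lambda>x. g x - h x)"
  using affine_functional_add[OF _ affine_functional_uminus] by fastforce

lemma affine_functional_comb:
  assumes "affine_functional h" "u + v = 1"
  shows "h (u *\<^sub>R x + v *\<^sub>R y) = u * h x + v * h y"
proof -
  obtain a b where h: "\<And>x. h x = a \<bullet> x + b" using assms unfolding affine_functional_def by blast
  have "b = u * b + v * b" using assms(2) by (metis distrib_right mult_1)
  then show ?thesis by (simp add: h inner_add_right algebra_simps)
qed

lemma affine_functional_nonneg_hull:
  assumes "affine_functional h" "\<And>x. x \<in> A \<Longrightarrow> h x \<ge> 0" "x \<in> convex hull A"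
  shows "h x \<ge> 0"
proof -
  obtain a b where h: "\<And>x. h x = a \<bullet> x + b" using assms unfolding affine_functional_def by blast
  have "convex {x. h x \<ge> 0}"
    using affine_functional_comb[OF assms(1)] by (simp add: convex_def)
  then have "convex hull A \<subseteq> {x. h x \<ge> 0}" using assms by (intro hull_minimal) auto
  then show ?thesis using assms by auto
qed

lemma affine_functional_zero_hull:
  assumes "affine_functional h" "\<And>x. x \<in> A \<Longrightarrow> h x = 0" "x \<in> convex hull A"
  shows "h x = 0"
  using affine_functional_nonneg_hull[of h A x] affine_functional_uminus[of h]
    affine_functional_nonneg_hull[of "\<lambda>x. - h x" A x] assms by (simp add: order_antisym)

lemma continuous_on_affine_functional:
  assumes "affine_functional h"
  shows "continuous_on S h"
proof -
  obtain a b where "h = (\<lambda>x. a \<bullet> x + b)" using assms unfolding affine_functional_def by blast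
  then show ?thesis by (simp add: continuous_on_add continuous_on_inner)
qed

lemma affine_functional_orientation: "affine_functional (orientation x y)"
proof -
  have "orientation x y z = (\<chi> i. if i = 1 then - (y$2 - x$2) else y$1 - x$1) \<bullet> z +
     ((y$2 - x$2) * x$1 - (y$1 - x$1) * x$2)" for z
    by (simp add: orientation_def inner_vec_def UNIV_2 algebra_simps)
  then show ?thesis unfolding affine_functional_def by blast
qed

lemma orientation_rotate: "orientation x y z = orientation y z x"
  by (simp add: orientation_def algebra_simps)

lemma orientation_swap: "orientation y x z = - orientation x y z"
  by (simp add: orientation_def algebra_simps)

lemma orientation_degenerate [simp]:
  "orientation x x y = 0" "orientation x y x = 0" "orientation x y y = 0"
  by (simp_all add: orientation_def algebra_simps)

text \<open>
  The orientations of \<open>x\<close> with respect to the sides of the triangle \<open>u v w\<close> are its unnormalised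
  barycentric coordinates.
\<close>

lemma affine_functional_barycentric:
  assumes "affine_functional h"
  shows "orientation u v w * h x =
     orientation v w x * h u + orientation w u x * h v + orientation u v x * h w"
proof -
  obtain a b where h: "\<And>x. h x = a \<bullet> x + b" using assms unfolding affine_functional_def by blast
  show ?thesis by (simp add: h orientation_def inner_vec_def UNIV_2 algebra_simps)
qed

lemma affine_functional_eq:
  assumes "affine_functional g" "affine_functional h" "orientation u v w \<noteq> 0"
    "g u = h u" "g v = h v" "g w = h w"
  shows "g x = h x"
  using affine_functional_barycentric[OF assms(1), of u v w x]
    affine_functional_barycentric[OF assms(2), of u v w x] assms by (metis mult_cancel_left)

lemma affine_interpolation:
  assumes "orientation u v w \<noteq> 0"
  obtains h where "affine_functional h" "h u = a" "h v = b" "h w = c"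
proof
  let ?h = "\<lambda>x. (a / orientation u v w) * orientation v w x
     + (b / orientation u v w) * orientation w u x + (c / orientation u v w) * orientation u v x"
  show "affine_functional ?h"
    by (intro affine_functional_add affine_functional_cmul affine_functional_orientation)
  show "?h u = a" "?h v = b" "?h w = c"
    using assms orientation_rotate[of u v w] orientation_rotate[of v w u] by auto
qed

lemma barycentric_in_hull:
  assumes "orientation u v w > 0" "orientation v w x \<ge> 0" "orientation w u x \<ge> 0"
    "orientation u v x \<ge> 0"
  shows "x \<in> convex hull {u, v, w}"
proof -
  let ?o = "orientation u v w"
  let ?a = "orientation v w x / ?o" and ?b = "orientation w u x / ?o" and ?c = "orientation u v x / ?o"
  have s: "orientation v w x + orientation w u x + orientation u v x = ?o"
    by (simp add: orientation_def algebra_simps)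
  have 1: "?a \<ge> 0" "?b \<ge> 0" "?c \<ge> 0" "?a + ?b + ?c = 1"
    using assms s by (auto simp: add_divide_distrib[symmetric])
  have 2: "?o *\<^sub>R x = orientation v w x *\<^sub>R u + orientation w u x *\<^sub>R v + orientation u v x *\<^sub>R w"
    by (simp add: vec_eq_iff forall_2 orientation_def algebra_simps)
  have "x = (1/?o) *\<^sub>R (?o *\<^sub>R x)" using assms by simp
  also have "\<dots> = ?a *\<^sub>R u + ?b *\<^sub>R v + ?c *\<^sub>R w"
    unfolding 2 by (simp add: scaleR_add_right)
  finally show ?thesis unfolding convex_hull_3 using 1 by blast
qed

lemma collinear_iff_orientation: "collinear {x, y, z} \<longleftrightarrow> orientation x y z = 0"
proof
  assume "collinear {x, y, z}"
  then consider "x = z" | u where "y = u *\<^sub>R x + (1 - u) *\<^sub>R z" unfolding collinear_3_expand by blast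
  then show "orientation x y z = 0"
  proof cases
    case 2
    show ?thesis unfolding 2 by (simp add: orientation_def algebra_simps)
  qed simp
next
  assume o: "orientation x y z = 0"
  show "collinear {x, y, z}"
  proof (cases "x = z")
    case True
    then show ?thesis by (simp add: insert_commute)
  next
    case False
    have o': "(x$1 - z$1) * (y$2 - z$2) = (y$1 - z$1) * (x$2 - z$2)"
    proof -
      have "orientation x y z = (x$1 - z$1) * (y$2 - z$2) - (y$1 - z$1) * (x$2 - z$2)"
        by (simp add: orientation_def algebra_simps)
      with o show ?thesis by linarith
    qed
    from False consider "x $ 1 - z $ 1 \<noteq> 0" | "x $ 2 - z $ 2 \<noteq> 0"
      by (auto simp: vec_eq_iff forall_2)
    then have "\<exists>u. y = u *\<^sub>R x + (1 - u) *\<^sub>R z"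
    proof cases
      case 1
      define u where "u = (y$1 - z$1) / (x$1 - z$1)"
      have u: "u * (x$1 - z$1) = y$1 - z$1" using 1 by (simp add: u_def)
      have "(x$1 - z$1) * (y$2 - z$2) = (u * (x$1 - z$1)) * (x$2 - z$2)"
        unfolding u by (rule o')
      then have "(x$1 - z$1) * (y$2 - z$2) = (x$1 - z$1) * (u * (x$2 - z$2))" by (simp only: ac_simps)
      then have "y$2 - z$2 = u * (x$2 - z$2)" using 1 by (metis mult_cancel_left)
      then have "y$1 = u * x$1 + (1 - u) * z$1" "y$2 = u * x$2 + (1 - u) * z$2"
        using u unfolding right_diff_distrib left_diff_distrib by linarith+
      then have "y = u *\<^sub>R x + (1 - u) *\<^sub>R z"
        unfolding vec_eq_iff forall_2 by simp
      then show ?thesis by blast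
    next
      case 2
      define u where "u = (y$2 - z$2) / (x$2 - z$2)"
      have u: "u * (x$2 - z$2) = y$2 - z$2" using 2 by (simp add: u_def)
      have "(x$2 - z$2) * (y$1 - z$1) = (u * (x$2 - z$2)) * (x$1 - z$1)"
        unfolding u using o' by (simp only: mult.commute)
      then have "(x$2 - z$2) * (y$1 - z$1) = (x$2 - z$2) * (u * (x$1 - z$1))" by (simp only: ac_simps)
      then have "y$1 - z$1 = u * (x$1 - z$1)" using 2 by (metis mult_cancel_left)
      then have "y$1 = u * x$1 + (1 - u) * z$1" "y$2 = u * x$2 + (1 - u) * z$2"
        using u unfolding right_diff_distrib left_diff_distrib by linarith+
      then have "y = u *\<^sub>R x + (1 - u) *\<^sub>R z"
        unfolding vec_eq_iff forall_2 by simp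
      then show ?thesis by blast
    qed
    then show ?thesis unfolding collinear_3_expand by blast
  qed
qed

lemma affine_dependent_iff_orientation:
  assumes "distinct [u, v, w]"
  shows "affine_dependent {u, v, w} \<longleftrightarrow> orientation u v w = 0"
  using collinear_3_eq_affine_dependent[of u v w] assms
  by (auto simp: collinear_iff_orientation)

lemma orientation_nonzero_distinct:
  "orientation u v w \<noteq> 0 \<Longrightarrow> distinct [u, v, w]"
  by auto

lemma two_simplex_iff:
  "2 simplex \<sigma> \<longleftrightarrow> (\<exists>u v w. orientation u v w \<noteq> 0 \<and> \<sigma> = convex hull {u, v, w})"
proof
  assume "2 simplex \<sigma>"
  then obtain C where C: "\<not> affine_dependent C" "int (card C) = 3" "\<sigma> = convex hull C"
    unfolding simplex_def by auto
  then have "card C = 3" by simp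
  then obtain u v w where "C = {u, v, w}" "distinct [u, v, w]" by (auto simp: card_3_iff)
  then show "\<exists>u v w. orientation u v w \<noteq> 0 \<and> \<sigma> = convex hull {u, v, w}"
    using C affine_dependent_iff_orientation by blast
next
  assume "\<exists>u v w. orientation u v w \<noteq> 0 \<and> \<sigma> = convex hull {u, v, w}"
  then obtain u v w where o: "orientation u v w \<noteq> 0" "\<sigma> = convex hull {u, v, w}" by blast
  then have "distinct [u, v, w]" by auto
  then show "2 simplex \<sigma>" unfolding simplex_def
    using o affine_dependent_iff_orientation by (intro exI[of _ "{u, v, w}"]) auto
qed

lemma extreme_points_triangle:
  assumes "orientation u v w \<noteq> 0"
  shows "{x. x extreme_point_of (convex hull {u, v, w})} = {u, v, w}"
  using assms affine_dependent_iff_orientation[of u v w] orientation_nonzero_distinct[OF assms]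
    extreme_point_of_convex_hull_affine_independent[of "{u, v, w}"] by blast

lemma extreme_point_in_generators:
  assumes "v extreme_point_of Q" "convex hull A \<subseteq> Q" "v \<in> convex hull A"
  shows "v \<in> A"
proof -
  have "v extreme_point_of (convex hull A)"
    using assms unfolding extreme_point_of_def by blast
  then show ?thesis by (rule extreme_point_of_convex_hull)
qed

lemma extreme_points_not_collinear:
  assumes "x extreme_point_of Q" "y extreme_point_of Q" "z extreme_point_of Q"
    "distinct [x, y, z]"
  shows "orientation x y z \<noteq> 0"
proof
  assume "orientation x y z = 0"
  then have "between (y, z) x \<or> between (z, x) y \<or> between (x, y) z"
    using collinear_between_cases collinear_iff_orientation by blast
  then have "x \<in> open_segment y z \<or> y \<in> open_segment z x \<or> z \<in> open_segment x y"
    using assms(4) by (auto simp: between_mem_segment open_segment_def)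
  then show False using assms unfolding extreme_point_of_def by blast
qed

text \<open>
  If the point \<open>x\<close> on the line were outside the segment, one of \<open>u\<close>, \<open>w\<close> would lie strictly
  between \<open>x\<close> and the other one, and would not be extreme.
\<close>

lemma extreme_chord:
  assumes "u extreme_point_of Q" "w extreme_point_of Q" "u \<noteq> w" "x \<in> Q" "orientation u w x = 0"
  shows "x \<in> closed_segment u w"
proof (rule ccontr)
  assume n: "x \<notin> closed_segment u w"
  then have "x \<noteq> u" "x \<noteq> w" by auto
  have "between (w, x) u \<or> between (x, u) w \<or> between (u, w) x"
    using collinear_between_cases collinear_iff_orientation assms(5) by blast
  then have "u \<in> open_segment w x \<or> w \<in> open_segment x u"
    using n \<open>x \<noteq> u\<close> \<open>x \<noteq> w\<close> assms(3) by (auto simp: between_mem_segment open_segment_def)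
  then show False using assms unfolding extreme_point_of_def by blast
qed

section \<open>Cyclic labellings of the vertices of a convex polygon\<close>

definition cyclic_labelling :: "nat \<Rightarrow> (nat \<Rightarrow> real^2) \<Rightarrow> (real^2) set \<Rightarrow> bool" where
  "cyclic_labelling N p V \<longleftrightarrow> bij_betw p {1..N} V \<and>
     (\<forall>i j k. 1 \<le> i \<and> i < j \<and> j < k \<and> k \<le> N \<longrightarrow> orientation (p i) (p j) (p k) > 0)"

lemma increasing_enumeration:
  fixes s :: "'a \<Rightarrow> real"
  assumes "finite A" "inj_on s A"
  obtains r where "bij_betw r {..<card A} A" "\<And>i j. i < j \<Longrightarrow> j < card A \<Longrightarrow> s (r i) < s (r j)"
proof
  define xs where "xs = sorted_list_of_set (s ` A)"
  have len: "length xs = card A" using assms by (simp add: xs_def card_image)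
  have set: "set xs = s ` A" using assms by (simp add: xs_def)
  have dist: "distinct xs" by (simp add: xs_def)
  have "bij_betw (\<lambda>i. xs ! i) {..<card A} (s ` A)"
    using bij_betw_nth[OF dist, of "{..<card A}" "s ` A"] len set by simp
  moreover have "bij_betw (inv_into A s) (s ` A) A"
    using assms by (simp add: bij_betw_inv_into inj_on_imp_bij_betw)
  ultimately show "bij_betw (inv_into A s \<circ> (\<lambda>i. xs ! i)) {..<card A} A"
    by (rule bij_betw_trans)
  fix i j assume ij: "i < j" "j < card A"
  have "sorted_wrt (<) xs" by (simp add: xs_def)
  then have "xs ! i < xs ! j" using ij len by (simp add: sorted_wrt_nth_less)
  moreover have "s (inv_into A s (xs ! k)) = xs ! k" if "k < card A" for k
    using that len set by (metis f_inv_into_f nth_mem)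
  ultimately show "s ((inv_into A s \<circ> (\<lambda>i. xs ! i)) i) < s ((inv_into A s \<circ> (\<lambda>i. xs ! i)) j)"
    using ij by simp
qed

lemma extreme_point_separation:
  assumes "finite V" "v extreme_point_of (convex hull V)"
  obtains c :: "'a::euclidean_space" where "\<And>x. x \<in> V \<Longrightarrow> x \<noteq> v \<Longrightarrow> c \<bullet> (x - v) > 0"
proof -
  have "v \<notin> convex hull (V - {v})"
    using extreme_point_in_generators[OF assms(2), of "V - {v}"]
    by (metis Diff_iff Diff_subset hull_mono singletonI)
  moreover have "closed (convex hull (V - {v}))"
    using assms(1) by (simp add: compact_imp_closed finite_imp_compact_convex_hull)
  ultimately obtain c b where c: "c \<bullet> v < b" "\<And>x. x \<in> convex hull (V - {v}) \<Longrightarrow> c \<bullet> x > b"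
    using separating_hyperplane_closed_point[of "convex hull (V - {v})" v] by auto
  have "c \<bullet> (x - v) > 0" if "x \<in> V" "x \<noteq> v" for x
    using c(1) c(2)[of x] that by (simp add: hull_inc inner_diff_right)
  then show thesis by (rule that)
qed

text \<open>
  All other vertices lie in an open half-plane bounded by a line through \<open>v0\<close>, so that sorting them
  by the slope as seen from \<open>v0\<close> is sorting by angle. If then \<open>i < j < k\<close> were not oriented
  positively, vertex \<open>j\<close> would lie in the triangle of \<open>v0\<close> and the vertices \<open>i\<close> and \<open>k\<close>.
\<close>

lemma cyclic_labelling_exists:
  assumes V: "finite V" "\<And>v. v \<in> V \<Longrightarrow> v extreme_point_of (convex hull V)" and v0: "v0 \<in> V"
  obtains p where "cyclic_labelling (card V) p V" "p 1 = v0"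
proof -
  obtain c where c: "\<And>x. x \<in> V \<Longrightarrow> x \<noteq> v0 \<Longrightarrow> c \<bullet> (x - v0) > 0"
    using extreme_point_separation[OF V(1) V(2)[OF v0]] by blast
  define A where "A = V - {v0}"
  define Y where "Y x = c$1 * (x$2 - v0$2) - c$2 * (x$1 - v0$1)" for x :: "real^2"
  define s where "s x = Y x / (c \<bullet> (x - v0))" for x
  have pos: "c \<bullet> (x - v0) > 0" if "x \<in> A" for x using c that by (auto simp: A_def)
  have nc: "orientation x y z \<noteq> 0" if "x \<in> V" "y \<in> V" "z \<in> V" "distinct [x, y, z]" for x y z
    using extreme_points_not_collinear V(2) that by blast
  have o: "orientation v0 x y > 0" if "x \<in> A" "y \<in> A" "s x < s y" for x y
  proof -
    have "Y x * (c \<bullet> (y - v0)) < Y y * (c \<bullet> (x - v0))"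
      using that(3) pos[OF that(1)] pos[OF that(2)] by (simp add: s_def divide_less_eq less_divide_eq field_simps)
    moreover have "(c \<bullet> c) * orientation v0 x y = Y y * (c \<bullet> (x - v0)) - Y x * (c \<bullet> (y - v0))"
      by (simp add: Y_def orientation_def inner_vec_def UNIV_2 algebra_simps)
    ultimately have "(c \<bullet> c) * orientation v0 x y > 0" by simp
    then show ?thesis by (simp add: zero_less_mult_iff) (metis inner_ge_zero not_less)
  qed
  have inj: "inj_on s A"
  proof (rule inj_onI, rule ccontr)
    fix x y assume xy: "x \<in> A" "y \<in> A" "s x = s y" "x \<noteq> y"
    have "Y x * (c \<bullet> (y - v0)) = Y y * (c \<bullet> (x - v0))"
      using xy(3) pos[OF xy(1)] pos[OF xy(2)] by (simp add: s_def frac_eq_eq)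
    moreover have "(c \<bullet> c) * orientation v0 x y = Y y * (c \<bullet> (x - v0)) - Y x * (c \<bullet> (y - v0))"
      by (simp add: Y_def orientation_def inner_vec_def UNIV_2 algebra_simps)
    ultimately have "(c \<bullet> c) * orientation v0 x y = 0" by simp
    moreover have "c \<noteq> 0" using pos[OF xy(1)] by auto
    moreover have "orientation v0 x y \<noteq> 0" using xy v0 by (intro nc) (auto simp: A_def)
    ultimately show False by simp
  qed
  have finA: "finite A" using V(1) by (simp add: A_def)
  obtain r where r: "bij_betw r {..<card A} A" "\<And>i j. i < j \<Longrightarrow> j < card A \<Longrightarrow> s (r i) < s (r j)"
    by (rule increasing_enumeration[OF finA inj], rule that)
  define p where "p i = (if i = 1 then v0 else r (i - 2))" for i :: nat
  have cA: "card V = Suc (card A)" using card.remove[OF V(1) v0] by (simp add: A_def)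
  have bp: "bij_betw p {1..card V} V"
  proof -
    have "bij_betw (\<lambda>i. i - 2) {2..card V} {..<card A}"
      using cA by (intro bij_betwI[where g = "\<lambda>i. i + 2"]) auto
    from bij_betw_trans[OF this r(1)] have "bij_betw p {2..card V} A"
      by (rule bij_betw_cong[THEN iffD1, rotated]) (auto simp: p_def)
    then have "bij_betw p ({2..card V} \<union> {1}) (A \<union> {v0})"
      by (intro bij_betw_combine) (auto simp: A_def p_def)
    moreover have "{2..card V} \<union> {1} = {1..card V}" using cA by auto
    moreover have "A \<union> {v0} = V" using v0 by (auto simp: A_def)
    ultimately show ?thesis by simp
  qed
  have pA: "p i \<in> A" if "1 < i" "i \<le> card V" for i
    using that cA bij_betw_apply[OF r(1), of "i - 2"] by (simp add: p_def)
  have sp: "s (p i) < s (p j)" if "1 < i" "i < j" "j \<le> card V" for i j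
    using that cA r(2)[of "i - 2" "j - 2"] by (simp add: p_def)
  have o1: "orientation v0 (p i) (p j) > 0" if "1 < i" "i < j" "j \<le> card V" for i j
    using o[OF pA pA sp] that by simp
  have "orientation (p i) (p j) (p k) > 0" if "1 \<le> i" "i < j" "j < k" "k \<le> card V" for i j k
  proof (cases "i = 1")
    case True
    then show ?thesis using o1[of j k] that by (simp add: p_def)
  next
    case False
    show ?thesis
    proof (rule ccontr)
      assume n: "\<not> ?thesis"
      have "p j \<in> convex hull {v0, p i, p k}"
      proof (rule barycentric_in_hull)
        show "0 < orientation v0 (p i) (p k)" using o1 that False by simp
        show "0 \<le> orientation (p i) (p k) (p j)"
          using n orientation_swap[of "p k" "p i" "p j"] orientation_rotate[of "p i" "p j" "p k"]
            orientation_rotate[of "p j" "p k" "p i"] by simp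
        show "0 \<le> orientation (p k) v0 (p j)"
          using o1[of j k] orientation_rotate[of "p k" v0 "p j"] that by simp
        show "0 \<le> orientation v0 (p i) (p j)" using o1[of i j] that False by simp
      qed
      moreover have "{v0, p i, p k} \<subseteq> V" using pA[of i] pA[of k] that False v0 by (auto simp: A_def)
      moreover have "p j \<in> V" using pA[of j] that by (auto simp: A_def)
      ultimately have "p j \<in> {v0, p i, p k}"
        using extreme_point_in_generators[OF V(2)] hull_mono by blast
      moreover have "p j \<noteq> v0" using pA[of j] that by (auto simp: A_def)
      ultimately show False using sp[of i j] sp[of j k] that False by auto
    qed
  qed
  then have "cyclic_labelling (card V) p V"
    using bp unfolding cyclic_labelling_def by blast
  then show thesis using that by (simp add: p_def)
qed

section \<open>Integrals over triangles and GKZ vectors\<close>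

lemma continuous_compact_integrable:
  fixes k :: "'a::euclidean_space \<Rightarrow> real"
  assumes "compact S" "continuous_on S k"
  shows "k integrable_on S"
proof -
  have "set_integrable lborel S k"
    unfolding set_integrable_def by (rule borel_integrable_compact[OF assms])
  then show ?thesis by (rule set_borel_integral_eq_integral)
qed

lemma compact_triangle: "compact (convex hull {u, v, w :: 'a::euclidean_space})"
  by (simp add: finite_imp_compact_convex_hull)

text \<open>
  The affine involution that exchanges \<open>u\<close> and \<open>v\<close> and fixes \<open>w\<close> maps the triangle to itself, exchanges
  the two barycentric coordinates, and preserves area because the square of its determinant is 1.
\<close>

lemma integral_triangle_swap:
  assumes "orientation u v w \<noteq> 0"
  shows "integral (convex hull {u, v, w}) (orientation v w) =
         integral (convex hull {u, v, w}) (orientation w u)"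
proof -
  let ?o = "orientation u v w" and ?S = "convex hull {u, v, w}"
  define T where "T x = x + ((orientation v w x - orientation w u x) / ?o) *\<^sub>R (v - u)" for x
  define L where "L d = d + ((((w$1 - v$1) * d$2 - (w$2 - v$2) * d$1) -
      ((u$1 - w$1) * d$2 - (u$2 - w$2) * d$1)) / ?o) *\<^sub>R (v - u)" for d :: "real^2"
  have ov: "orientation v w (x + s *\<^sub>R (v - u)) = orientation v w x - s * ?o"
    "orientation w u (x + s *\<^sub>R (v - u)) = orientation w u x + s * ?o" for x s
    by (simp_all add: orientation_def algebra_simps)
  have T1: "orientation v w (T x) = orientation w u x" and T2: "orientation w u (T x) = orientation v w x" for x
    using assms by (simp_all add: T_def ov)
  have TT: "T (T x) = x" for x
    using T1[of x] T2[of x]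
    by (subst T_def) (simp add: T_def[of x] scaleR_left_distrib[symmetric] add_divide_distrib[symmetric] add.assoc)
  have linL: "linear L"
    by (rule linearI) (simp_all add: L_def algebra_simps add_divide_distrib diff_divide_distrib)
  have TL: "T x = L x + T 0" for x
  proof -
    have "(orientation v w x - orientation w u x) / ?o =
       (((w$1 - v$1) * x$2 - (w$2 - v$2) * x$1) - ((u$1 - w$1) * x$2 - (u$2 - w$2) * x$1)) / ?o
       + (orientation v w 0 - orientation w u 0) / ?o"
      unfolding add_divide_distrib[symmetric] by (rule arg_cong[where f = "\<lambda>z. z / _"])
        (simp add: orientation_def algebra_simps)
    then show ?thesis by (simp add: T_def L_def scaleR_left_distrib)
  qed
  have LL: "L (L x) = x" for x
  proof -
    have "T (T x) = L (L x) + L (T 0) + T 0"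
      using TL[of x] TL[of "T x"] linear_add[OF linL] by simp
    moreover have "0 = L (T 0) + T 0" using TT[of 0] TL[of "T 0"] by simp
    ultimately show ?thesis using TT[of x] by (simp add: add.assoc)
  qed
  have "det (matrix L) * det (matrix L) = 1"
  proof -
    have "matrix L ** matrix L = matrix (L \<circ> L)" by (simp add: matrix_compose linL)
    also have "L \<circ> L = id" using LL by auto
    finally show ?thesis by (simp add: det_mul[symmetric] matrix_id_mat_1[unfolded id_def] id_def)
  qed
  then have det: "\<bar>det (matrix L)\<bar> = 1" by (metis abs_square_eq_1 power2_eq_square)
  have der: "(T has_derivative L) (at x within ?S)" for x
  proof -
    have "((\<lambda>x. L x + T 0) has_derivative L) (at x within ?S)"
      using linear_imp_has_derivative[OF linL] by (auto intro!: derivative_eq_intros)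
    moreover have "(\<lambda>x. L x + T 0) = T" by (rule ext, rule TL[symmetric])
    ultimately show ?thesis by metis
  qed
  have Tconv: "T (a *\<^sub>R x + b *\<^sub>R y) = a *\<^sub>R T x + b *\<^sub>R T y" if "a + b = 1" for a b x y
    unfolding TL[of x] TL[of y] TL[of "_ + _"] linear_add[OF linL] linear_cmul[OF linL]
    using that by (simp add: scaleR_add_right) (metis scaleR_left_distrib scaleR_one add.commute add.left_commute)
  have Tsub: "T ` ?S \<subseteq> ?S"
  proof -
    have "convex {x. T x \<in> ?S}"
      by (rule convexI) (simp add: Tconv convexD[OF convex_convex_hull])
    moreover have "T u = v" "T v = u" "T w = w"
      using assms orientation_rotate[of u v w] orientation_rotate[of v w u] by (simp_all add: T_def)
    ultimately have "?S \<subseteq> {x. T x \<in> ?S}"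
      by (intro hull_minimal) (auto simp: hull_inc)
    then show ?thesis by auto
  qed
  then have Timg: "T ` ?S = ?S" using TT by (metis image_eqI subsetI subset_antisym image_subset_iff)
  have inj: "inj_on T ?S" by (rule inj_onI) (metis TT)
  have cont: "orientation w u absolutely_integrable_on ?S"
    using borel_integrable_compact[OF compact_triangle continuous_on_affine_functional[OF affine_functional_orientation]]
    by (simp add: set_integrable_def integrable_completion)
  have lebS: "?S \<in> sets lebesgue"
    by (rule fmeasurableD[OF lmeasurable_compact[OF compact_triangle]])
  have "linear (vec :: real \<Rightarrow> real^1)" by (rule linearI) (simp_all add: vec_eq_iff)
  then have blv: "bounded_linear (vec :: real \<Rightarrow> real^1)" by (simp add: linear_conv_bounded_linear)
  \<comment> \<open>The change of variables formula speaks of vector-valued functions.\<close>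
  let ?f = "\<lambda>x. vec (orientation w u x) :: real^1"
  have cont1: "?f absolutely_integrable_on ?S"
    using absolutely_integrable_linear[OF cont blv] by (simp add: o_def)
  have "(\<lambda>x. \<bar>det (matrix L)\<bar> *\<^sub>R ?f (T x)) absolutely_integrable_on ?S \<and>
      integral ?S (\<lambda>x. \<bar>det (matrix L)\<bar> *\<^sub>R ?f (T x)) = integral ?S ?f"
    using has_absolute_integral_change_of_variables[OF lebS der inj, where f = "?f" and b = "integral ?S ?f"]
      cont1 unfolding Timg by blast
  then have "integral ?S (\<lambda>x. vec (orientation v w x) :: real^1) = integral ?S ?f"
    by (simp add: det T2)
  moreover have "integral ?S (\<lambda>x. vec (g x) :: real^1) $ 1 = integral ?S g" if "affine_functional g" for g
  proof -
    have "g integrable_on ?S"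
      by (intro continuous_compact_integrable compact_triangle continuous_on_affine_functional that)
    from integral_linear[OF this blv] show ?thesis by (simp add: o_def)
  qed
  ultimately show ?thesis using affine_functional_orientation by metis
qed

lemma integral_one_compact:
  fixes S :: "'a::euclidean_space set"
  assumes "compact S"
  shows "integral S (\<lambda>x. 1 :: real) = measure lborel S"
  using has_integral_measure_lborel[of S] emeasure_compact_finite[OF assms] assms
  by (simp add: borel_compact integral_unique less_top)

text \<open>
  By symmetry the three barycentric coordinates have the same integral, one third of the area.
\<close>

lemma integral_affine_triangle:
  assumes o: "orientation u v w \<noteq> 0" and h: "affine_functional h"
  shows "integral (convex hull {u, v, w}) h =
         measure lborel (convex hull {u, v, w}) * (h u + h v + h w) / 3"
proof -
  let ?o = "orientation u v w" and ?S = "convex hull {u, v, w}"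
  have i: "orientation a b integrable_on ?S" for a b
    by (intro continuous_compact_integrable compact_triangle continuous_on_affine_functional
        affine_functional_orientation)
  have e1: "integral ?S (orientation v w) = integral ?S (orientation w u)"
    by (rule integral_triangle_swap[OF o])
  have "orientation v w u \<noteq> 0" using o orientation_rotate[of u v w] by simp
  from integral_triangle_swap[OF this]
  have e2: "integral ?S (orientation w u) = integral ?S (orientation u v)"
    by (simp add: insert_commute)
  have "integral ?S (\<lambda>x. orientation v w x + orientation w u x + orientation u v x)
      = integral ?S (orientation v w) + integral ?S (orientation w u) + integral ?S (orientation u v)"
    by (simp add: integral_add integrable_add i)
  moreover have "orientation v w x + orientation w u x + orientation u v x = ?o * 1" for x
    by (simp add: orientation_def algebra_simps)
  ultimately have e3: "3 * integral ?S (orientation v w) = ?o * measure lborel ?S"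
    using e1 e2 integral_one_compact[OF compact_triangle[of u v w]] by (simp only: integral_mult_right)
  have "?o * integral ?S h = integral ?S (\<lambda>x. ?o * h x)" by simp
  also have "\<dots> = integral ?S (\<lambda>x. orientation v w x * h u + orientation w u x * h v + orientation u v x * h w)"
    by (simp only: affine_functional_barycentric[OF h, of u v w])
  also have "\<dots> = integral ?S (orientation v w) * h u + integral ?S (orientation w u) * h v
      + integral ?S (orientation u v) * h w"
    by (simp add: integral_add integrable_add i integrable_on_mult_left)
  also have "\<dots> = ?o * (measure lborel ?S * (h u + h v + h w) / 3)"
    using e1 e2 e3 by (simp add: field_simps)
  finally show ?thesis using o by simp
qed

lemma nonneg_integral_zero_interior:
  fixes f :: "'a::euclidean_space \<Rightarrow> real"
  assumes "compact S" "continuous_on S f" "\<And>x. x \<in> S \<Longrightarrow> 0 \<le> f x" "integral S f = 0"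
    and x: "x \<in> interior S"
  shows "f x = 0"
proof -
  obtain a b where ab: "x \<in> box a b" "cbox a b \<subseteq> S"
    using open_contains_cbox[of "interior S" x] x interior_subset by (metis open_interior subset_trans)
  have c: "continuous_on (cbox a b) f" using assms(2) ab(2) by (rule continuous_on_subset)
  have i: "f integrable_on cbox a b" using c by (rule integrable_continuous)
  have "integral (cbox a b) f \<le> integral S f"
    using integral_subset_le[OF ab(2) i continuous_compact_integrable[OF assms(1,2)]] assms(3) by blast
  moreover have "integral (cbox a b) f \<ge> 0"
    using i ab(2) assms(3) by (intro integral_nonneg) auto
  ultimately have "(f has_integral 0) (cbox a b)" using i assms(4) by (metis has_integral_integral order_antisym)
  then show ?thesis
    using has_integral_0_cbox_imp_0[OF c] ab assms(3) box_subset_cbox by (metis empty_iff subset_iff)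
qed

lemma two_simplex_compact: "2 simplex (\<sigma> :: (real^2) set) \<Longrightarrow> compact \<sigma>"
  using two_simplex_iff compact_triangle by metis

lemma two_simplex_interior:
  assumes "2 simplex (\<sigma> :: (real^2) set)"
  shows "interior \<sigma> \<noteq> {}"
proof -
  have "aff_dim \<sigma> = 2" using assms aff_dim_simplex by fastforce
  moreover have "convex \<sigma>" using assms convex_simplex by blast
  moreover have "\<sigma> \<noteq> {}" using \<open>aff_dim \<sigma> = 2\<close> by auto
  ultimately show ?thesis by (simp add: interior_rel_interior_gen rel_interior_eq_empty)
qed

lemma negligible_simplex_Int:
  fixes \<sigma> \<tau> :: "(real^2) set"
  assumes "2 simplex \<sigma>" "2 simplex \<tau>" "\<sigma> \<inter> \<tau> face_of \<sigma>" "\<sigma> \<inter> \<tau> face_of \<tau>" "\<sigma> \<noteq> \<tau>"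
  shows "negligible (\<sigma> \<inter> \<tau>)"
proof -
  have c: "convex \<sigma>" "convex \<tau>" and d: "aff_dim \<sigma> = 2" "aff_dim \<tau> = 2"
    using assms convex_simplex aff_dim_simplex by fastforce+
  have "aff_dim (\<sigma> \<inter> \<tau>) < 2"
    using assms(3-5) face_of_aff_dim_lt[OF c(1) assms(3)] face_of_aff_dim_lt[OF c(2) assms(4)] d by auto
  then have "interior (\<sigma> \<inter> \<tau>) = {}"
    using aff_dim_nonempty_interior[of "\<sigma> \<inter> \<tau>"] by auto
  then show ?thesis using c by (metis negligible_convex_interior convex_Int)
qed

lemma integral_triangulation:
  fixes k :: "real^2 \<Rightarrow> real"
  assumes t: "polygon_triangulation Q t" and k: "continuous_on Q k"
  shows "integral Q k = (\<Sum>\<sigma>\<in>t. integral \<sigma> k)"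
proof -
  have tr: "triangulation t" "\<Union>t = Q" "\<And>\<sigma>. \<sigma> \<in> t \<Longrightarrow> 2 simplex \<sigma>"
    using t unfolding polygon_triangulation_def by auto
  have "(k has_integral (\<Sum>\<sigma>\<in>t. integral \<sigma> k)) (\<Union>t)"
  proof (rule has_integral_Union)
    show "finite t" using tr(1) unfolding triangulation_def by blast
    show "(k has_integral integral \<sigma> k) \<sigma>" if "\<sigma> \<in> t" for \<sigma>
    proof -
      have "continuous_on \<sigma> k" using k that tr(2) by (meson Sup_upper continuous_on_subset equalityD1 subset_trans)
      then show ?thesis
        using continuous_compact_integrable two_simplex_compact tr(3)[OF that] integrable_integral by blast
    qed
    show "pairwise (\<lambda>S S'. negligible (S \<inter> S')) t"
      unfolding pairwise_def using negligible_simplex_Int tr unfolding triangulation_def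
      by (metis inf_commute)
  qed
  then show ?thesis using tr(2) by (simp add: integral_unique)
qed

text \<open>
  The inner product of the GKZ vector of \<open>t\<close> with the vector of heights \<open>\<omega>\<close>, without reference to a
  labelling of the vertices.
\<close>

definition gkz_pairing :: "(real^2 \<Rightarrow> real) \<Rightarrow> (real^2) set set \<Rightarrow> real" where
  "gkz_pairing \<omega> t =
     (\<Sum>\<sigma>\<in>t. measure lborel \<sigma> * (\<Sum>v | v extreme_point_of \<sigma>. \<omega> v))"

lemma gkz_pairing_integral:
  assumes t: "polygon_triangulation Q t"
    and h: "\<And>\<sigma>. \<sigma> \<in> t \<Longrightarrow> affine_functional (h \<sigma>)"
      "\<And>\<sigma> v. \<sigma> \<in> t \<Longrightarrow> v extreme_point_of \<sigma> \<Longrightarrow> h \<sigma> v = \<omega> v"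
  shows "gkz_pairing \<omega> t = 3 * (\<Sum>\<sigma>\<in>t. integral \<sigma> (h \<sigma>))"
proof -
  have "measure lborel \<sigma> * (\<Sum>v | v extreme_point_of \<sigma>. \<omega> v) = 3 * integral \<sigma> (h \<sigma>)" if s: "\<sigma> \<in> t" for \<sigma>
  proof -
    have "2 simplex \<sigma>" using t s unfolding polygon_triangulation_def by blast
    then obtain u v w where o: "orientation u v w \<noteq> 0" "\<sigma> = convex hull {u, v, w}"
      using two_simplex_iff by blast
    have ext: "{x. x extreme_point_of \<sigma>} = {u, v, w}" using extreme_points_triangle o by blast
    have "u \<noteq> v" "v \<noteq> w" "u \<noteq> w" using orientation_nonzero_distinct[OF o(1)] by auto
    then have "(\<Sum>v | v extreme_point_of \<sigma>. \<omega> v) = \<omega> u + (\<omega> v + \<omega> w)" unfolding ext by simp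
    also have "\<dots> = h \<sigma> u + (h \<sigma> v + h \<sigma> w)" using h(2)[OF s] ext by (metis insertCI mem_Collect_eq)
    finally show ?thesis using integral_affine_triangle[OF o(1) h(1)[OF s]] o(2) by (simp add: add.assoc)
  qed
  then show ?thesis unfolding gkz_pairing_def by (simp add: sum_distrib_left)
qed

section \<open>Cutting convex hulls along a chord\<close>

text \<open>
  A point of the hull lies on a segment from \<open>a\<close> in the hull of \<open>A\<close> to \<open>b\<close> in the hull of \<open>B\<close>. Up to the
  point where the segment meets the zero set of \<open>l\<close>, which belongs to the hull of \<open>A\<close> by assumption,
  it stays in the hull of \<open>A\<close>.
\<close>

lemma convex_hull_cut_half:
  fixes A B :: "'a::euclidean_space set"
  assumes l: "affine_functional l" and B: "\<And>b. b \<in> B \<Longrightarrow> l b \<le> 0"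
    and chord: "\<And>x. x \<in> convex hull (A \<union> B) \<Longrightarrow> l x = 0 \<Longrightarrow> x \<in> convex hull A"
    and ne: "A \<noteq> {}" "B \<noteq> {}"
    and x: "x \<in> convex hull (A \<union> B)" "l x \<ge> 0"
  shows "x \<in> convex hull A"
proof -
  have "A \<union> B \<subseteq> (convex hull A) \<union> (convex hull B)" using hull_subset by fast
  then have "x \<in> convex hull ((convex hull A) \<union> (convex hull B))" using x(1) hull_mono by blast
  then obtain u v a b where ab: "u \<ge> 0" "v \<ge> 0" "u + v = 1" "a \<in> convex hull A" "b \<in> convex hull B"
    "x = u *\<^sub>R a + v *\<^sub>R b"
    using convex_hull_union_two[of "convex hull A" "convex hull B"] ne by auto
  have inU: "a \<in> convex hull (A \<union> B)" "b \<in> convex hull (A \<union> B)"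
    using ab hull_mono[of A "A \<union> B"] hull_mono[of B "A \<union> B"] by auto
  have lb: "l b \<le> 0"
    using affine_functional_nonneg_hull[OF affine_functional_uminus[OF l], of B b] B ab by auto
  have lx: "l x = u * l a + v * l b" using affine_functional_comb[OF l ab(3)] ab(6) by simp
  show ?thesis
  proof (cases "v = 0 \<or> l b = 0")
    case True
    then show ?thesis
    proof
      assume "v = 0"
      then show ?thesis using ab by simp
    next
      assume "l b = 0"
      then have "b \<in> convex hull A" using chord inU by blast
      then show ?thesis using ab convexD[OF convex_convex_hull] by blast
    qed
  next
    case False
    then have v: "v > 0" and lbn: "l b < 0" using ab lb by auto
    have ula: "u * l a \<ge> v * (- l b)" using lx x(2) by simp
    moreover have "v * (- l b) > 0" using v lbn by (simp add: mult_pos_neg)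
    ultimately have "u * l a > 0" by linarith
    then have la: "l a > 0" using ab(1) by (simp add: zero_less_mult_iff)
    define d where "d = l a - l b"
    have d: "d > 0" using la lbn by (simp add: d_def)
    define z where "z = (- l b / d) *\<^sub>R a + (l a / d) *\<^sub>R b"
    have sum1: "- l b / d + l a / d = 1"
    proof -
      have "- l b / d + l a / d = (- l b + l a) / d" by (simp only: add_divide_distrib)
      also have "- l b + l a = d" by (simp add: d_def)
      finally show ?thesis using d by simp
    qed
    have "l z = 0" unfolding z_def affine_functional_comb[OF l sum1] times_divide_eq_left by (simp add: mult.commute)
    moreover have "z \<in> convex hull (A \<union> B)"
      unfolding z_def using inU sum1 d la lbn
      by (intro convexD[OF convex_convex_hull]) (auto simp: divide_nonpos_pos)
    ultimately have zA: "z \<in> convex hull A" using chord by blast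
    define s where "s = v * d / l a"
    have "x = (1 - s) *\<^sub>R a + s *\<^sub>R z"
    proof -
      have "s * (l a / d) = v" using la d by (simp add: s_def)
      moreover have "(1 - s) + s * (- l b / d) = u"
      proof -
        have "s * (- l b / d) = s * (1 - l a / d)" using sum1 by (simp add: algebra_simps)
        also have "\<dots> = s - v" using \<open>s * (l a / d) = v\<close> by (simp add: right_diff_distrib)
        finally show ?thesis using ab(3) by simp
      qed
      ultimately show ?thesis
        unfolding ab(6) z_def scaleR_add_right scaleR_scaleR add.assoc[symmetric] scaleR_left_distrib[symmetric]
        by simp
    qed
    moreover have "s \<ge> 0" using v d la by (simp add: s_def)
    moreover have "s \<le> 1"
    proof -
      have "v * d \<le> (u + v) * l a" using ula by (simp add: d_def algebra_simps)
      then show ?thesis using la ab(3) by (simp add: s_def)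
    qed
    ultimately show ?thesis using convexD[OF convex_convex_hull ab(4) zA, of "1 - s" s] by simp
  qed
qed

lemma convex_hull_cut:
  fixes A B :: "'a::euclidean_space set"
  assumes l: "affine_functional l" and A: "\<And>a. a \<in> A \<Longrightarrow> l a \<le> 0" and B: "\<And>b. b \<in> B \<Longrightarrow> l b \<ge> 0"
    and u: "u \<in> A \<inter> B" "w \<in> A \<inter> B"
    and chord: "\<And>x. x \<in> convex hull (A \<union> B) \<Longrightarrow> l x = 0 \<Longrightarrow> x \<in> closed_segment u w"
  shows "convex hull (A \<union> B) = (convex hull A) \<union> (convex hull B)"
proof
  have "closed_segment u w \<subseteq> convex hull A" "closed_segment u w \<subseteq> convex hull B"
    unfolding segment_convex_hull using u by (auto intro!: hull_mono)
  then have c: "\<And>x. x \<in> convex hull (A \<union> B) \<Longrightarrow> l x = 0 \<Longrightarrow> x \<in> convex hull A"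
      "\<And>x. x \<in> convex hull (A \<union> B) \<Longrightarrow> l x = 0 \<Longrightarrow> x \<in> convex hull B"
    using chord by blast+
  show "convex hull (A \<union> B) \<subseteq> (convex hull A) \<union> (convex hull B)"
  proof
    fix x assume x: "x \<in> convex hull (A \<union> B)"
    show "x \<in> (convex hull A) \<union> (convex hull B)"
    proof (cases "l x \<ge> 0")
      case True
      have "x \<in> convex hull B"
        using convex_hull_cut_half[OF l, of A B x] A c(2) u x True by (auto simp: Un_commute)
      then show ?thesis by blast
    next
      case False
      have "x \<in> convex hull A"
        using convex_hull_cut_half[OF affine_functional_uminus[OF l], of B A x] B c(1) u x False by auto
      then show ?thesis by blast
    qed
  qed
qed (simp add: hull_mono)

lemma convex_hull_zero_set:
  fixes A :: "'a::euclidean_space set"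
  assumes "finite A" "affine_functional l" "\<And>a. a \<in> A \<Longrightarrow> l a \<le> 0"
    and "x \<in> convex hull A" "l x = 0"
  shows "x \<in> convex hull {a \<in> A. l a = 0}"
proof -
  obtain c b where h: "\<And>x. l x = c \<bullet> x + b" using assms(2) unfolding affine_functional_def by blast
  have nn: "l y \<le> 0" if "y \<in> convex hull A" for y
    using affine_functional_nonneg_hull[OF affine_functional_uminus[OF assms(2)], of A y] assms(3) that by auto
  have "(convex hull A) \<inter> {x. c \<bullet> x = - b} face_of (convex hull A)"
  proof (rule face_of_Int_supporting_hyperplane_le)
    show "c \<bullet> y \<le> - b" if "y \<in> convex hull A" for y using nn[OF that] h[of y] by linarith
  qed simp
  then obtain A' where A': "A' \<subseteq> A" "(convex hull A) \<inter> {x. c \<bullet> x = - b} = convex hull A'"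
    using face_of_convex_hull_subset assms(1) finite_imp_compact by metis
  have "A' \<subseteq> {a \<in> A. l a = 0}"
  proof
    fix a assume "a \<in> A'"
    then have "c \<bullet> a = - b" using A'(2) hull_inc[of a A'] by blast
    then show "a \<in> {a \<in> A. l a = 0}" using h A'(1) \<open>a \<in> A'\<close> by auto
  qed
  moreover have "x \<in> (convex hull A) \<inter> {x. c \<bullet> x = - b}" using assms(4,5) h[of x] by simp
  then have "x \<in> convex hull A'" by (simp only: A'(2))
  ultimately show ?thesis using hull_mono by blast
qed

text \<open>
  The intersection lies in the zero set of \<open>l\<close>, where both simplices are spanned by those of the two
  points \<open>u\<close> and \<open>w\<close> that are vertices of theirs; so it is spanned by their common vertices.
\<close>

lemma separated_simplices_meet_in_face:
  fixes A B :: "'a::euclidean_space set"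
  assumes ind: "\<not> affine_dependent A" and fin: "finite A" "finite B"
    and l: "affine_functional l" "\<And>a. a \<in> A \<Longrightarrow> l a \<le> 0" "\<And>b. b \<in> B \<Longrightarrow> l b \<ge> 0"
    and uw: "\<And>x. x \<in> A \<union> B \<Longrightarrow> l x = 0 \<Longrightarrow> x \<in> {u, w}"
  shows "(convex hull A) \<inter> (convex hull B) face_of (convex hull A)"
proof -
  define A0 B0 where "A0 = {a \<in> A. l a = 0}" and "B0 = {b \<in> B. l b = 0}"
  have sub: "A0 \<subseteq> {u, w}" "B0 \<subseteq> {u, w}" using uw by (auto simp: A0_def B0_def)
  have "convex hull (A \<inter> B) = (convex hull A) \<inter> (convex hull B)"
  proof
    show "convex hull (A \<inter> B) \<subseteq> (convex hull A) \<inter> (convex hull B)"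
      by (simp add: hull_mono)
    show "(convex hull A) \<inter> (convex hull B) \<subseteq> convex hull (A \<inter> B)"
    proof
      fix x assume x: "x \<in> (convex hull A) \<inter> (convex hull B)"
      have "l x \<le> 0" "l x \<ge> 0"
        using affine_functional_nonneg_hull[OF affine_functional_uminus[OF l(1)], of A x]
          affine_functional_nonneg_hull[OF l(1), of B x] l x by auto
      then have "l x = 0" by simp
      then have "x \<in> convex hull A0" "x \<in> convex hull B0"
        using convex_hull_zero_set[OF fin(1) l(1,2), of x]
          convex_hull_zero_set[OF fin(2) affine_functional_uminus[OF l(1)], of x] l x
        by (auto simp: A0_def B0_def)
      moreover have "A0 \<subseteq> B0 \<or> B0 \<subseteq> A0 \<or> (A0 = {u} \<and> B0 = {w}) \<or> (A0 = {w} \<and> B0 = {u})"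
        using sub by blast
      ultimately have "x \<in> convex hull (A0 \<inter> B0)"
        by (elim disjE) (auto simp: Int_absorb1 Int_absorb2)
      then show "x \<in> convex hull (A \<inter> B)"
        using hull_mono[of "A0 \<inter> B0" "A \<inter> B"] by (auto simp: A0_def B0_def)
    qed
  qed
  moreover have "convex hull (A \<inter> B) face_of (convex hull A)"
    using face_of_convex_hull_affine_independent[OF ind] by blast
  ultimately show ?thesis by simp
qed

section \<open>Existence of regular triangulations\<close>

text \<open>
  The graph of the interpolation of \<open>\<omega>\<close> over \<open>t\<close> is the upper hull of the lifted vertices: the affine
  interpolation over each triangle stays above \<open>\<omega>\<close> at all vertices.
\<close>

definition regular_triangulation ::
  "(real^2) set \<Rightarrow> (real^2 \<Rightarrow> real) \<Rightarrow> (real^2) set set \<Rightarrow> bool" where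
  "regular_triangulation V \<omega> t \<longleftrightarrow> (\<forall>\<sigma>\<in>t. \<exists>h. affine_functional h \<and>
     (\<forall>v. v extreme_point_of \<sigma> \<longrightarrow> h v = \<omega> v) \<and> (\<forall>v\<in>V. \<omega> v \<le> h v))"

locale cyclic_polygon =
  fixes N :: nat and p :: "nat \<Rightarrow> real^2" and V :: "(real^2) set"
  assumes cyclic: "cyclic_labelling N p V"
    and extreme: "\<And>v. v \<in> V \<Longrightarrow> v extreme_point_of (convex hull V)"
begin

lemma orient_pos: "1 \<le> i \<Longrightarrow> i < j \<Longrightarrow> j < k \<Longrightarrow> k \<le> N \<Longrightarrow> orientation (p i) (p j) (p k) > 0"
  using cyclic unfolding cyclic_labelling_def by blast

lemma V_eq: "V = p ` {1..N}"
  using cyclic unfolding cyclic_labelling_def bij_betw_def by blast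

lemma p_in_V: "1 \<le> i \<Longrightarrow> i \<le> N \<Longrightarrow> p i \<in> V"
  using V_eq by auto

lemma p_inj: "1 \<le> i \<Longrightarrow> i \<le> N \<Longrightarrow> 1 \<le> j \<Longrightarrow> j \<le> N \<Longrightarrow> p i = p j \<longleftrightarrow> i = j"
  using inj_on_eq_iff[OF bij_betw_imp_inj_on, of p "{1..N}" V i j] cyclic
  unfolding cyclic_labelling_def by simp

lemma orient_inside:
  assumes "1 \<le> i" "i < m" "m < j" "j \<le> N"
  shows "orientation (p i) (p j) (p m) < 0"
  using orient_pos[of i m j] assms orientation_swap[of "p i" "p j" "p m"]
    orientation_rotate[of "p j" "p i" "p m"] orientation_rotate[of "p i" "p m" "p j"] by simp

lemma orient_outside:
  assumes "1 \<le> i" "i < j" "j \<le> N" "1 \<le> m" "m \<le> N" "m < i \<or> j < m"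
  shows "orientation (p i) (p j) (p m) > 0"
  using orient_pos[of m i j] orient_pos[of i j m] assms
    orientation_rotate[of "p m" "p i" "p j"] by auto

lemma orient_zero:
  assumes "1 \<le> i" "i < j" "j \<le> N" "1 \<le> m" "m \<le> N" "orientation (p i) (p j) (p m) = 0"
  shows "m = i \<or> m = j"
  using orient_inside[of i m j] orient_outside[of i j m] assms by force

lemma chord_segment:
  assumes "1 \<le> i" "i < j" "j \<le> N" "x \<in> convex hull V" "orientation (p i) (p j) x = 0"
  shows "x \<in> closed_segment (p i) (p j)"
  using extreme_chord[OF extreme extreme, of "p i" "p j" x] assms p_in_V p_inj by auto

text \<open>
  Apart from its ends, the chord from \<open>i\<close> to \<open>j\<close> strictly separates the vertices in \<open>I\<close> from those in \<open>J\<close>.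
\<close>

lemma hull_split:
  assumes "1 \<le> i" "i < j" "j \<le> N" "I \<subseteq> {i..j}" "{i, j} \<subseteq> I"
    "J \<subseteq> {1..N} - {i<..<j}" "{i, j} \<subseteq> J"
  shows "convex hull (p ` (I \<union> J)) = convex hull (p ` I) \<union> convex hull (p ` J)"
  unfolding image_Un
proof (rule convex_hull_cut[where l = "orientation (p i) (p j)" and u = "p i" and w = "p j"])
  show "affine_functional (orientation (p i) (p j))" by (rule affine_functional_orientation)
  show "orientation (p i) (p j) a \<le> 0" if "a \<in> p ` I" for a
  proof -
    from that obtain m where m: "m \<in> I" "a = p m" by blast
    then have "m = i \<or> m = j \<or> (i < m \<and> m < j)" using assms(4) by force
    then show ?thesis using m orient_inside[of i m j] assms by auto
  qed
  show "orientation (p i) (p j) b \<ge> 0" if "b \<in> p ` J" for b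
  proof -
    from that obtain m where m: "m \<in> J" "b = p m" by blast
    then have "m = i \<or> m = j \<or> m < i \<or> j < m" "1 \<le> m" "m \<le> N" using assms(6) by force+
    then show ?thesis using m orient_outside[of i j m] assms by auto
  qed
  show "p i \<in> p ` I \<inter> p ` J" "p j \<in> p ` I \<inter> p ` J" using assms by auto
  fix x assume x: "x \<in> convex hull (p ` I \<union> p ` J)" "orientation (p i) (p j) x = 0"
  have "I \<union> J \<subseteq> {1..N}" using assms by auto
  then have "p ` I \<union> p ` J \<subseteq> V" using V_eq by blast
  then have "x \<in> convex hull V" using x(1) hull_mono by blast
  then show "x \<in> closed_segment (p i) (p j)" using chord_segment assms x by blast
qed

lemma triangle_independent:
  assumes "1 \<le> a" "a < b" "b < c" "c \<le> N"
  shows "\<not> affine_dependent {p a, p b, p c}"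
  using affine_dependent_iff_orientation[of "p a" "p b" "p c"] orient_pos[OF assms]
    orientation_nonzero_distinct[of "p a" "p b" "p c"] by auto

lemma triangles_meet_in_face:
  assumes ij: "1 \<le> i" "i < j" "j \<le> N"
    and abc: "i \<le> a" "a < b" "b < c" "c \<le> j"
    and abc': "1 \<le> a'" "a' < b'" "b' < c'" "c' \<le> N" "{a', b', c'} \<inter> {i<..<j} = {}"
  defines "\<sigma> \<equiv> convex hull {p a, p b, p c}" and "\<tau> \<equiv> convex hull {p a', p b', p c'}"
  shows "\<sigma> \<inter> \<tau> face_of \<sigma>" "\<sigma> \<inter> \<tau> face_of \<tau>"
proof -
  let ?l = "orientation (p i) (p j)"
  have A: "?l x \<le> 0" if "x \<in> {p a, p b, p c}" for x
  proof -
    have "?l (p m) \<le> 0" if "i \<le> m" "m \<le> j" for m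
      using orient_inside[of i m j] that ij by (cases "m = i \<or> m = j") auto
    then show ?thesis using that abc by auto
  qed
  have B: "?l x \<ge> 0" if "x \<in> {p a', p b', p c'}" for x
  proof -
    have "?l (p m) \<ge> 0" if "m \<in> {a', b', c'}" for m
    proof -
      have "m = i \<or> m = j \<or> m < i \<or> j < m" "1 \<le> m" "m \<le> N" using abc' that by auto
      then show ?thesis using orient_outside[of i j m] ij by auto
    qed
    then show ?thesis using that by auto
  qed
  have Z: "x \<in> {p i, p j}" if "x \<in> {p a, p b, p c} \<union> {p a', p b', p c'}" "?l x = 0" for x
  proof -
    have "x \<in> p ` {a, b, c, a', b', c'}" using that by blast
    then obtain m where m: "m \<in> {a, b, c, a', b', c'}" "x = p m" by blast
    then have "1 \<le> m" "m \<le> N" using abc abc' ij by auto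
    then show ?thesis using orient_zero[OF ij] m that by auto
  qed
  have ind: "\<not> affine_dependent {p a, p b, p c}" "\<not> affine_dependent {p a', p b', p c'}"
    using triangle_independent abc abc' ij by auto
  show "\<sigma> \<inter> \<tau> face_of \<sigma>" unfolding \<sigma>_def \<tau>_def
    by (rule separated_simplices_meet_in_face[OF ind(1), where l = ?l and u = "p i" and w = "p j"])
      (use A B Z affine_functional_orientation in auto)
  have "\<tau> \<inter> \<sigma> face_of \<tau>" unfolding \<sigma>_def \<tau>_def
    by (rule separated_simplices_meet_in_face[OF ind(2), where l = "\<lambda>x. - ?l x" and u = "p i" and w = "p j"])
      (use A B Z affine_functional_uminus[OF affine_functional_orientation, of "p i" "p j"] in auto)
  then show "\<sigma> \<inter> \<tau> face_of \<tau>" by (simp add: Int_commute)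
qed

text \<open>
  A triangulation of the polygon with vertices \<open>p i, \<dots>, p j\<close>. This polygon degenerates to the edge
  itself if \<open>j = i + 1\<close>, and then the empty set of triangles is admitted; this is why the edge
  appears separately in the union.
\<close>

definition interval_triangulation :: "nat \<Rightarrow> nat \<Rightarrow> (real^2) set set \<Rightarrow> bool" where
  "interval_triangulation i j t \<longleftrightarrow> finite t \<and>
     (\<forall>\<sigma>\<in>t. \<exists>a b c. i \<le> a \<and> a < b \<and> b < c \<and> c \<le> j \<and> \<sigma> = convex hull {p a, p b, p c}) \<and>
     (\<forall>\<sigma>\<in>t. \<forall>\<tau>\<in>t. \<sigma> \<inter> \<tau> face_of \<sigma>) \<and>
     \<Union>t \<union> closed_segment (p i) (p j) = convex hull (p ` {i..j}) \<and>
     (Suc i < j \<longrightarrow> closed_segment (p i) (p j) \<subseteq> \<Union>t)"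

lemma interval_triangulation_edge: "interval_triangulation i (Suc i) {}"
proof -
  have "{i..Suc i} = {i, Suc i}" by auto
  then show ?thesis unfolding interval_triangulation_def by (simp add: segment_convex_hull)
qed

lemma interval_triangulation_glue:
  assumes ikj: "1 \<le> i" "i < k" "k < j" "j \<le> N"
    and t1: "interval_triangulation i k t1" and t2: "interval_triangulation k j t2"
  shows "interval_triangulation i j ({convex hull {p i, p k, p j}} \<union> t1 \<union> t2)"
proof -
  let ?\<Delta> = "convex hull {p i, p k, p j}"
  have T1: "\<exists>a b c. i \<le> a \<and> a < b \<and> b < c \<and> c \<le> k \<and> \<sigma> = convex hull {p a, p b, p c}" if "\<sigma> \<in> t1" for \<sigma>
    using t1 that unfolding interval_triangulation_def by blast
  have T2: "\<exists>a b c. k \<le> a \<and> a < b \<and> b < c \<and> c \<le> j \<and> \<sigma> = convex hull {p a, p b, p c}" if "\<sigma> \<in> t2" for \<sigma>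
    using t2 that unfolding interval_triangulation_def by blast
  have f1: "\<sigma> \<inter> ?\<Delta> face_of \<sigma> \<and> \<sigma> \<inter> ?\<Delta> face_of ?\<Delta>" if s: "\<sigma> \<in> t1" for \<sigma>
  proof -
    obtain a b c where "i \<le> a" "a < b" "b < c" "c \<le> k" "\<sigma> = convex hull {p a, p b, p c}" using T1[OF s] by blast
    then show ?thesis using triangles_meet_in_face[of i k a b c i k j] ikj by auto
  qed
  have f2: "\<sigma> \<inter> ?\<Delta> face_of \<sigma> \<and> \<sigma> \<inter> ?\<Delta> face_of ?\<Delta>" if s: "\<sigma> \<in> t2" for \<sigma>
  proof -
    obtain a b c where "k \<le> a" "a < b" "b < c" "c \<le> j" "\<sigma> = convex hull {p a, p b, p c}" using T2[OF s] by blast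
    then show ?thesis using triangles_meet_in_face[of k j a b c i k j] ikj by auto
  qed
  have f12: "\<sigma> \<inter> \<tau> face_of \<sigma> \<and> \<sigma> \<inter> \<tau> face_of \<tau>" if s: "\<sigma> \<in> t1" "\<tau> \<in> t2" for \<sigma> \<tau>
  proof -
    obtain a b c where 1: "i \<le> a" "a < b" "b < c" "c \<le> k" "\<sigma> = convex hull {p a, p b, p c}"
      using T1[OF s(1)] by blast
    obtain a' b' c' where 2: "k \<le> a'" "a' < b'" "b' < c'" "c' \<le> j" "\<tau> = convex hull {p a', p b', p c'}"
      using T2[OF s(2)] by blast
    show ?thesis using triangles_meet_in_face[of i k a b c a' b' c'] ikj 1 2 by auto
  qed
  have faces: "\<sigma> \<inter> \<tau> face_of \<sigma>" if "\<sigma> \<in> {?\<Delta>} \<union> t1 \<union> t2" "\<tau> \<in> {?\<Delta>} \<union> t1 \<union> t2" for \<sigma> \<tau>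
  proof -
    have "\<sigma> \<inter> \<tau> face_of \<sigma>" if "\<sigma> \<in> t1 \<and> \<tau> \<in> t1 \<or> \<sigma> \<in> t2 \<and> \<tau> \<in> t2"
      using that t1 t2 unfolding interval_triangulation_def by blast
    moreover have "?\<Delta> \<inter> ?\<Delta> face_of ?\<Delta>" by (simp add: face_of_refl)
    moreover have "\<sigma> \<inter> \<tau> face_of \<sigma>" if "\<tau> \<in> t1" "\<sigma> \<in> t2"
      using f12[OF that] by (simp add: Int_commute)
    moreover have "?\<Delta> \<inter> \<tau> face_of ?\<Delta>" if "\<tau> \<in> t1 \<union> t2"
      using f1[of \<tau>] f2[of \<tau>] that by (auto simp: Int_commute)
    ultimately show ?thesis using that f1 f2 f12 by blast
  qed
  have seg: "closed_segment (p i) (p k) \<subseteq> ?\<Delta>" "closed_segment (p k) (p j) \<subseteq> ?\<Delta>"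
    "closed_segment (p i) (p j) \<subseteq> ?\<Delta>"
    unfolding segment_convex_hull by (auto intro!: hull_mono)
  have "convex hull (p ` {i..j}) = convex hull (p ` ({i..k} \<union> insert i {k..j}))"
    using ikj by (intro arg_cong[where f = "\<lambda>X. convex hull (p ` X)"]) auto
  also have "\<dots> = convex hull (p ` {i..k}) \<union> convex hull (p ` insert i {k..j})"
    using ikj by (intro hull_split[of i k]) auto
  also have "convex hull (p ` insert i {k..j}) = convex hull (p ` ({k..j} \<union> {i, k, j}))"
    using ikj by (intro arg_cong[where f = "\<lambda>X. convex hull (p ` X)"]) auto
  also have "\<dots> = convex hull (p ` {k..j}) \<union> convex hull (p ` {i, k, j})"
    using ikj by (intro hull_split[of k j]) auto
  also have "p ` {i, k, j} = {p i, p k, p j}" by auto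
  finally have hull: "convex hull (p ` {i..j}) =
    (\<Union>t1 \<union> closed_segment (p i) (p k)) \<union> ((\<Union>t2 \<union> closed_segment (p k) (p j)) \<union> ?\<Delta>)"
    using t1 t2 unfolding interval_triangulation_def by simp
  have "\<Union>({?\<Delta>} \<union> t1 \<union> t2) \<union> closed_segment (p i) (p j) = convex hull (p ` {i..j})"
    unfolding hull using seg by blast
  moreover have "\<exists>a b c. i \<le> a \<and> a < b \<and> b < c \<and> c \<le> j \<and> \<sigma> = convex hull {p a, p b, p c}"
    if \<sigma>: "\<sigma> \<in> {?\<Delta>} \<union> t1 \<union> t2" for \<sigma>
  proof -
    consider "\<sigma> = ?\<Delta>" | "\<sigma> \<in> t1" | "\<sigma> \<in> t2" using \<sigma> by blast
    then show ?thesis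
    proof cases
      case 1
      then show ?thesis using ikj by (intro exI[of _ i] exI[of _ k] exI[of _ j]) auto
    next
      case 2
      from T1[OF this] obtain a b c where "i \<le> a" "a < b" "b < c" "c \<le> k" "\<sigma> = convex hull {p a, p b, p c}" by blast
      then show ?thesis using ikj by (intro exI[of _ a] exI[of _ b] exI[of _ c]) auto
    next
      case 3
      from T2[OF this] obtain a b c where "k \<le> a" "a < b" "b < c" "c \<le> j" "\<sigma> = convex hull {p a, p b, p c}" by blast
      then show ?thesis using ikj by (intro exI[of _ a] exI[of _ b] exI[of _ c]) auto
    qed
  qed
  moreover have "finite ({?\<Delta>} \<union> t1 \<union> t2)" using t1 t2 unfolding interval_triangulation_def by simp
  moreover have "closed_segment (p i) (p j) \<subseteq> \<Union>({?\<Delta>} \<union> t1 \<union> t2)" using seg by blast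
  ultimately show ?thesis using faces unfolding interval_triangulation_def by blast
qed

text \<open>
  The plane of \<open>h0\<close> contains the lifted base edge and lies above all lifted vertices. It is turned
  around this edge downwards on the side of the interval until it touches a lifted vertex, \<open>k\<close>. On
  the other side it only rises, so that it still lies above everything, and it supplies the
  starting planes for the two smaller intervals. Carrying the bound at all vertices, and not
  only at those in the interval, makes the triangulations of the parts fit together to a regular one.
\<close>

lemma regular_interval_triangulation:
  assumes "1 \<le> i" "i < j" "j \<le> N" "affine_functional h0" "h0 (p i) = \<omega> (p i)" "h0 (p j) = \<omega> (p j)"
    "\<And>m. 1 \<le> m \<Longrightarrow> m \<le> N \<Longrightarrow> \<omega> (p m) \<le> h0 (p m)"
  shows "\<exists>t. interval_triangulation i j t \<and> regular_triangulation V \<omega> t"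
  using assms
proof (induction "j - i" arbitrary: i j h0 rule: less_induct)
  case less
  note ij = less.prems(1-3)
  show ?case
  proof (cases "j = Suc i")
    case True
    then show ?thesis using interval_triangulation_edge by (auto simp: regular_triangulation_def)
  next
    case False
    define d where "d x = - orientation (p i) (p j) x" for x
    define slope where "slope m = (\<omega> (p m) - h0 (p m)) / d (p m)" for m
    have dpos: "d (p m) > 0" if "i < m" "m < j" for m
      using orient_inside[of i m j] that ij by (simp add: d_def)
    have dneg: "d (p m) < 0" if "m < i \<or> j < m" "1 \<le> m" "m \<le> N" for m
      using orient_outside[of i j m] that ij by (simp add: d_def)
    have "Suc i \<in> {i<..<j}" using False ij by auto
    then have "finite (slope ` {i<..<j})" "slope ` {i<..<j} \<noteq> {}" by blast+
    from Max_in[OF this] obtain k where k: "i < k" "k < j" "slope k = Max (slope ` {i<..<j})" by auto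
    have kmax: "slope m \<le> slope k" if "i < m" "m < j" for m
      unfolding k(3) using that by (intro Max_ge) auto
    have "slope k \<le> 0"
      unfolding slope_def using less.prems(7)[of k] dpos[OF k(1,2)] k(1,2) ij
      by (intro divide_nonpos_pos) auto
    define h where "h x = h0 x + slope k * d x" for x
    have hk: "h (p k) = \<omega> (p k)" using dpos[OF k(1,2)] by (simp add: h_def slope_def)
    have hi: "h (p i) = \<omega> (p i)" "h (p j) = \<omega> (p j)"
      using less.prems(5,6) by (simp_all add: h_def d_def)
    have haff: "affine_functional h"
      unfolding h_def d_def
      by (intro affine_functional_add affine_functional_cmul affine_functional_uminus
          affine_functional_orientation less.prems(4))
    have hge: "\<omega> (p m) \<le> h (p m)" if m: "1 \<le> m" "m \<le> N" for m
    proof -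
      consider "m = i" | "m = j" | "i < m" "m < j" | "m < i \<or> j < m" by linarith
      then show ?thesis
      proof cases
        case 3
        have "slope m * d (p m) \<le> slope k * d (p m)"
          using kmax[OF 3] dpos[OF 3] by (simp add: mult_right_mono)
        moreover have "slope m * d (p m) = \<omega> (p m) - h0 (p m)" using dpos[OF 3] by (simp add: slope_def)
        ultimately show ?thesis by (simp add: h_def)
      next
        case 4
        have "slope k * d (p m) \<ge> 0"
          using \<open>slope k \<le> 0\<close> dneg[OF 4 m] by (simp add: mult_nonpos_nonpos)
        then show ?thesis using less.prems(7)[OF m] by (simp add: h_def)
      qed (use hi in auto)
    qed
    have dec: "k - i < j - i" "j - k < j - i" using k(1,2) by linarith+
    obtain t1 where t1: "interval_triangulation i k t1" "regular_triangulation V \<omega> t1"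
      using less.hyps[OF dec(1), of h] k(1,2) ij haff hi hk hge by auto
    obtain t2 where t2: "interval_triangulation k j t2" "regular_triangulation V \<omega> t2"
      using less.hyps[OF dec(2), of h] k(1,2) ij haff hi hk hge by auto
    have ext: "{x. x extreme_point_of (convex hull {p i, p k, p j})} = {p i, p k, p j}"
      using orient_pos[of i k j] k ij by (intro extreme_points_triangle) auto
    have "regular_triangulation V \<omega> {convex hull {p i, p k, p j}}"
      unfolding regular_triangulation_def
    proof (intro ballI exI[of _ h] conjI allI impI haff)
      fix \<sigma> v assume "\<sigma> \<in> {convex hull {p i, p k, p j}}" "v extreme_point_of \<sigma>"
      then have "v \<in> {p i, p k, p j}" using ext by blast
      then show "h v = \<omega> v" using hi hk by auto
    next
      fix v assume "v \<in> V"
      then show "\<omega> v \<le> h v" using hge V_eq by auto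
    qed
    then have "regular_triangulation V \<omega> ({convex hull {p i, p k, p j}} \<union> t1 \<union> t2)"
      using t1(2) t2(2) unfolding regular_triangulation_def by blast
    then show ?thesis using interval_triangulation_glue[OF _ k(1,2) _ t1(1) t2(1)] ij by blast
  qed
qed

lemma polygon_triangulation_of_interval:
  assumes "interval_triangulation 1 N t" "N \<ge> 3"
  shows "polygon_triangulation (convex hull V) t"
proof -
  have tri: "2 simplex \<sigma> \<and> {v. v extreme_point_of \<sigma>} \<subseteq> V" if "\<sigma> \<in> t" for \<sigma>
  proof -
    have "\<exists>a b c. 1 \<le> a \<and> a < b \<and> b < c \<and> c \<le> N \<and> \<sigma> = convex hull {p a, p b, p c}"
      using assms(1) that unfolding interval_triangulation_def by simp
    then obtain a b c where abc: "1 \<le> a" "a < b" "b < c" "c \<le> N" "\<sigma> = convex hull {p a, p b, p c}"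
      by blast
    have o: "orientation (p a) (p b) (p c) \<noteq> 0" using orient_pos[OF abc(1-4)] by simp
    have "{v. v extreme_point_of \<sigma>} = {p a, p b, p c}" unfolding abc(5) by (rule extreme_points_triangle[OF o])
    moreover have "2 simplex \<sigma>" using o abc(5) two_simplex_iff by blast
    ultimately show ?thesis using p_in_V abc(1-4) by auto
  qed
  have "\<Union>t \<union> closed_segment (p 1) (p N) = convex hull V" "closed_segment (p 1) (p N) \<subseteq> \<Union>t"
    using assms unfolding interval_triangulation_def V_eq by simp_all
  then have "\<Union>t = convex hull V" by blast
  moreover have "triangulation t"
    using assms(1) tri unfolding interval_triangulation_def triangulation_def by blast
  ultimately show ?thesis using tri extreme unfolding polygon_triangulation_def by blast
qed

lemma regular_polygon_triangulation_exists:
  assumes "N \<ge> 3"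
  shows "\<exists>t. polygon_triangulation (convex hull V) t \<and> regular_triangulation V \<omega> t"
proof -
  have "orientation (p 1) (p N) (p 2) \<noteq> 0" using orient_inside[of 1 2 N] assms by simp
  then obtain g where g: "affine_functional g" "g (p 1) = \<omega> (p 1)" "g (p N) = \<omega> (p N)"
    using affine_interpolation by metis
  define d where "d x = - orientation (p 1) (p N) x" for x
  have dpos: "d (p m) > 0" if "1 < m" "m < N" for m
    using orient_inside[of 1 m N] that by (simp add: d_def)
  \<comment> \<open>A plane through the lifted edge from vertex 1 to vertex \<open>N\<close> that is steep enough to lie above all lifted vertices.\<close>
  define s where "s = Max ((\<lambda>m. (\<omega> (p m) - g (p m)) / d (p m)) ` {1..N})"
  define h0 where "h0 x = g x + s * d x" for x
  have "affine_functional h0"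
    unfolding h0_def d_def
    by (intro affine_functional_add affine_functional_cmul affine_functional_uminus
        affine_functional_orientation g)
  moreover have h1: "h0 (p 1) = \<omega> (p 1)" "h0 (p N) = \<omega> (p N)" using g by (simp_all add: h0_def d_def)
  moreover have "\<omega> (p m) \<le> h0 (p m)" if m: "1 \<le> m" "m \<le> N" for m
  proof (cases "m = 1 \<or> m = N")
    case False
    then have m': "1 < m" "m < N" using m by auto
    have "(\<omega> (p m) - g (p m)) / d (p m) \<le> s" unfolding s_def using m by (intro Max_ge) auto
    then show ?thesis using dpos[OF m'] by (simp add: h0_def pos_divide_le_eq algebra_simps)
  qed (use h1 in auto)
  ultimately obtain t where "interval_triangulation 1 N t" "regular_triangulation V \<omega> t"
    using regular_interval_triangulation[of 1 N h0 \<omega>] assms by auto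
  then show ?thesis using polygon_triangulation_of_interval assms by blast
qed

end

section \<open>Regular triangulations maximise the height\<close>

lemma continuous_on_Min_family:
  fixes F :: "('a::topological_space \<Rightarrow> real) set"
  assumes "finite F" "F \<noteq> {}" "\<And>f. f \<in> F \<Longrightarrow> continuous_on S f"
  shows "continuous_on S (\<lambda>x. Min ((\<lambda>f. f x) ` F))"
  using assms
proof (induction F rule: finite_ne_induct)
  case (insert f F)
  have "(\<lambda>x. Min ((\<lambda>f. f x) ` insert f F)) = (\<lambda>x. min (f x) (Min ((\<lambda>f. f x) ` F)))"
    using insert.hyps by (intro ext) simp
  then show ?case using insert by (simp add: continuous_on_min)
qed simp

lemma point_towards_in_open:
  fixes x y :: "'a::real_normed_vector"
  assumes "open U" "x \<in> U"
  obtains s where "0 < s" "s < 1" "(1 - s) *\<^sub>R x + s *\<^sub>R y \<in> U"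
proof -
  obtain e where e: "e > 0" "ball x e \<subseteq> U" using assms openE by blast
  define s where "s = min (1/2) (e / (2 * (norm (y - x) + 1)))"
  have n: "norm (y - x) + 1 > 0" using norm_ge_zero[of "y - x"] by linarith
  have s: "0 < s" "s < 1" using e n by (auto simp: s_def)
  have "s * norm (y - x) \<le> s * (norm (y - x) + 1)" using s by simp
  also have "\<dots> \<le> (e / (2 * (norm (y - x) + 1))) * (norm (y - x) + 1)"
    using n by (intro mult_right_mono) (auto simp: s_def)
  also have "\<dots> = e / 2" using n by (simp add: field_simps)
  finally have "s * norm (y - x) < e" using e(1) by simp
  moreover have "x - ((1 - s) *\<^sub>R x + s *\<^sub>R y) = s *\<^sub>R (x - y)" by (simp add: algebra_simps)
  then have "dist x ((1 - s) *\<^sub>R x + s *\<^sub>R y) = s * norm (y - x)"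
    using s by (simp add: dist_norm norm_minus_commute)
  ultimately have "(1 - s) *\<^sub>R x + s *\<^sub>R y \<in> U" using e(2) by auto
  with s show thesis by (rule that)
qed

lemma gkz_pairing_uminus: "gkz_pairing (\<lambda>v. - \<omega> v) t = - gkz_pairing \<omega> t"
  by (simp add: gkz_pairing_def sum_negf)

lemma gkz_pairing_lincomb:
  "gkz_pairing (\<lambda>v. a * \<omega> v + b * \<psi> v) t = a * gkz_pairing \<omega> t + b * gkz_pairing \<psi> t"
  by (simp add: gkz_pairing_def sum.distrib distrib_left mult.left_commute flip: sum_distrib_left)

lemma triangulation_simplex:
  assumes "polygon_triangulation Q t" "\<sigma> \<in> t"
  obtains u v w where "orientation u v w \<noteq> 0" "\<sigma> = convex hull {u, v, w}"
    "{x. x extreme_point_of \<sigma>} = {u, v, w}" "u extreme_point_of Q" "v extreme_point_of Q" "w extreme_point_of Q"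
proof -
  have s: "2 simplex \<sigma>" "{v. v extreme_point_of \<sigma>} \<subseteq> {v. v extreme_point_of Q}"
    using assms unfolding polygon_triangulation_def by blast+
  then obtain u v w where uvw: "orientation u v w \<noteq> 0" "\<sigma> = convex hull {u, v, w}"
    using two_simplex_iff by blast
  then have "{x. x extreme_point_of \<sigma>} = {u, v, w}" using extreme_points_triangle by blast
  then show thesis using that uvw s(2) by blast
qed

lemma triangulation_interpolant:
  assumes "polygon_triangulation Q t"
  obtains h where "\<And>\<sigma>. \<sigma> \<in> t \<Longrightarrow> affine_functional (h \<sigma>)"
    "\<And>\<sigma> v. \<sigma> \<in> t \<Longrightarrow> v extreme_point_of \<sigma> \<Longrightarrow> h \<sigma> v = \<omega> v"
proof -
  have "\<forall>\<sigma>\<in>t. \<exists>h. affine_functional h \<and> (\<forall>v. v extreme_point_of \<sigma> \<longrightarrow> h v = \<omega> v)"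
  proof
    fix \<sigma> assume "\<sigma> \<in> t"
    with assms obtain u v w where o: "orientation u v w \<noteq> 0" and e: "{x. x extreme_point_of \<sigma>} = {u, v, w}"
      by (rule triangulation_simplex)
    obtain h where h: "affine_functional h" "h u = \<omega> u" "h v = \<omega> v" "h w = \<omega> w"
      using affine_interpolation[OF o] by metis
    have "h x = \<omega> x" if "x extreme_point_of \<sigma>" for x
    proof -
      have "x \<in> {u, v, w}" using e that by blast
      then show ?thesis using h by auto
    qed
    then show "\<exists>h. affine_functional h \<and> (\<forall>v. v extreme_point_of \<sigma> \<longrightarrow> h v = \<omega> v)"
      using h(1) by blast
  qed
  then show thesis using that bchoice[of t] by metis
qed

lemma simplex_nonneg:
  assumes "polygon_triangulation Q t" "\<sigma> \<in> t" "affine_functional h"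
    "\<And>v. v extreme_point_of \<sigma> \<Longrightarrow> h v \<ge> 0" "x \<in> \<sigma>"
  shows "h x \<ge> 0"
proof -
  obtain u v w where s: "\<sigma> = convex hull {u, v, w}" "{x. x extreme_point_of \<sigma>} = {u, v, w}"
    using triangulation_simplex[OF assms(1,2)] by metis
  show ?thesis
  proof (rule affine_functional_nonneg_hull[OF assms(3)])
    show "h y \<ge> 0" if "y \<in> {u, v, w}" for y using assms(4) s(2) that by blast
    show "x \<in> convex hull {u, v, w}" using assms(5) s(1) by simp
  qed
qed

lemma triangulation_finite: "polygon_triangulation Q t \<Longrightarrow> finite t"
  unfolding polygon_triangulation_def triangulation_def by blast

lemma triangulation_compact: "polygon_triangulation Q t \<Longrightarrow> \<sigma> \<in> t \<Longrightarrow> compact \<sigma>"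
  unfolding polygon_triangulation_def using two_simplex_compact by blast

lemma integrable_on_cell:
  assumes "polygon_triangulation Q t" "\<sigma> \<in> t" "continuous_on UNIV (k :: real^2 \<Rightarrow> real)"
  shows "k integrable_on \<sigma>"
  using continuous_compact_integrable triangulation_compact[OF assms(1,2)] assms(3)
    continuous_on_subset by blast

lemma gkz_pairing_ge:
  assumes t: "polygon_triangulation Q t" and k: "continuous_on UNIV k"
    and h: "\<And>\<sigma>. \<sigma> \<in> t \<Longrightarrow> affine_functional (h \<sigma>)"
      "\<And>\<sigma> v. \<sigma> \<in> t \<Longrightarrow> v extreme_point_of \<sigma> \<Longrightarrow> h \<sigma> v = \<omega> v"
    and ge: "\<And>\<sigma> x. \<sigma> \<in> t \<Longrightarrow> x \<in> \<sigma> \<Longrightarrow> k x \<le> h \<sigma> x"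
  shows "3 * integral Q k \<le> gkz_pairing \<omega> t"
proof -
  have "integral Q k = (\<Sum>\<sigma>\<in>t. integral \<sigma> k)"
    using integral_triangulation[OF t] k continuous_on_subset by blast
  also have "\<dots> \<le> (\<Sum>\<sigma>\<in>t. integral \<sigma> (h \<sigma>))"
    by (intro sum_mono integral_le integrable_on_cell[OF t] k ge continuous_on_affine_functional h)
  finally show ?thesis using gkz_pairing_integral[OF t h] by simp
qed

lemma gkz_pairing_le:
  assumes t: "polygon_triangulation Q t" and k: "continuous_on UNIV k"
    and h: "\<And>\<sigma>. \<sigma> \<in> t \<Longrightarrow> affine_functional (h \<sigma>)"
      "\<And>\<sigma> v. \<sigma> \<in> t \<Longrightarrow> v extreme_point_of \<sigma> \<Longrightarrow> h \<sigma> v = \<omega> v"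
    and le: "\<And>\<sigma> x. \<sigma> \<in> t \<Longrightarrow> x \<in> \<sigma> \<Longrightarrow> h \<sigma> x \<le> k x"
  shows "gkz_pairing \<omega> t \<le> 3 * integral Q k"
proof -
  have "(\<Sum>\<sigma>\<in>t. integral \<sigma> (h \<sigma>)) \<le> (\<Sum>\<sigma>\<in>t. integral \<sigma> k)"
    by (intro sum_mono integral_le integrable_on_cell[OF t] k le continuous_on_affine_functional h)
  also have "\<dots> = integral Q k"
    using integral_triangulation[OF t] k continuous_on_subset[OF k subset_UNIV] by simp
  finally show ?thesis using gkz_pairing_integral[OF t h] by simp
qed

text \<open>
  The integral of the nonnegative difference of \<open>k\<close> and the interpolation vanishes, hence so does the
  difference.
\<close>

lemma gkz_pairing_eq_interior:
  assumes t: "polygon_triangulation Q t" and k: "continuous_on UNIV k"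
    and h: "\<And>\<sigma>. \<sigma> \<in> t \<Longrightarrow> affine_functional (h \<sigma>)"
      "\<And>\<sigma> v. \<sigma> \<in> t \<Longrightarrow> v extreme_point_of \<sigma> \<Longrightarrow> h \<sigma> v = \<omega> v"
    and le: "\<And>\<sigma> x. \<sigma> \<in> t \<Longrightarrow> x \<in> \<sigma> \<Longrightarrow> h \<sigma> x \<le> k x"
    and eq: "3 * integral Q k \<le> gkz_pairing \<omega> t"
    and s: "\<sigma> \<in> t" "x \<in> interior \<sigma>"
  shows "k x = h \<sigma> x"
proof -
  have ik: "k integrable_on \<tau>" and ih: "h \<tau> integrable_on \<tau>" if "\<tau> \<in> t" for \<tau>
    using integrable_on_cell[OF t that] k continuous_on_affine_functional[OF h(1)[OF that]] by blast+
  have "integral Q k = (\<Sum>\<sigma>\<in>t. integral \<sigma> k)"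
    using integral_triangulation[OF t] k continuous_on_subset by blast
  then have "(\<Sum>\<tau>\<in>t. integral \<tau> k) \<le> (\<Sum>\<tau>\<in>t. integral \<tau> (h \<tau>))"
    using eq gkz_pairing_integral[OF t h] by simp
  then have "(\<Sum>\<tau>\<in>t. integral \<tau> k - integral \<tau> (h \<tau>)) \<le> 0" by (simp add: sum_subtractf)
  moreover have nn: "integral \<tau> k - integral \<tau> (h \<tau>) \<ge> 0" if "\<tau> \<in> t" for \<tau>
    using integral_le[OF ih[OF that] ik[OF that]] le[OF that] by simp
  ultimately have "(\<Sum>\<tau>\<in>t. integral \<tau> k - integral \<tau> (h \<tau>)) = 0"
    by (meson order_antisym sum_nonneg)
  then have "integral \<sigma> k - integral \<sigma> (h \<sigma>) = 0"
    using sum_nonneg_eq_0_iff[OF triangulation_finite[OF t], of "\<lambda>\<tau>. integral \<tau> k - integral \<tau> (h \<tau>)"]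
      nn s(1) by blast
  then have z: "integral \<sigma> (\<lambda>x. k x - h \<sigma> x) = 0"
    using integral_diff[OF ik[OF s(1)] ih[OF s(1)]] by simp
  have "continuous_on \<sigma> (\<lambda>x. k x - h \<sigma> x)"
    by (intro continuous_on_diff continuous_on_subset[OF k] continuous_on_affine_functional h(1) s) simp
  from nonneg_integral_zero_interior[OF triangulation_compact[OF t s(1)] this _ z s(2)]
  show ?thesis using le[OF s(1)] by simp
qed

locale convex_vertex_set =
  fixes V :: "(real^2) set"
  assumes finite_V: "finite V" and card_V: "3 \<le> card V"
    and extreme_V: "\<And>v. v \<in> V \<Longrightarrow> v extreme_point_of (convex hull V)"
begin

abbreviation triangulates :: "(real^2) set set \<Rightarrow> bool" where
  "triangulates t \<equiv> polygon_triangulation (convex hull V) t"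

lemma labelling:
  assumes "v \<in> V"
  obtains p where "cyclic_polygon (card V) p V" "p 1 = v"
  using cyclic_labelling_exists[OF finite_V extreme_V assms] extreme_V
  unfolding cyclic_polygon_def by metis

lemma V_nonempty: "V \<noteq> {}"
  using card_V by auto

lemma regular_exists: obtains t where "triangulates t" "regular_triangulation V \<omega> t"
proof -
  obtain v where "v \<in> V" using V_nonempty by blast
  then obtain p where "cyclic_polygon (card V) p V" using labelling by blast
  from cyclic_polygon.regular_polygon_triangulation_exists[OF this card_V] show thesis using that by blast
qed

lemma cell_vertices_in_V:
  assumes "triangulates t" "\<sigma> \<in> t" "v extreme_point_of \<sigma>"
  shows "v \<in> V"
proof -
  have "v extreme_point_of (convex hull V)"
    using assms unfolding polygon_triangulation_def by blast
  then show ?thesis by (rule extreme_point_of_convex_hull)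
qed

lemma cell_exists:
  assumes "triangulates t"
  obtains \<sigma> where "\<sigma> \<in> t"
proof -
  have "convex hull V \<noteq> {}" using V_nonempty by simp
  then have "\<Union>t \<noteq> {}" using assms unfolding polygon_triangulation_def by simp
  then show thesis using that by blast
qed

text \<open>
  The minimum \<open>k\<close> of the affine pieces is concave and is the interpolation of \<open>\<omega>\<close> over \<open>t\<close>: on a triangle of \<open>t\<close>
  the piece belonging to it is below all others since it is so at the vertices. For the same reason
  \<open>k\<close> bounds from above the interpolation over every other triangulation.
\<close>

lemma regular_upper_envelope:
  assumes t: "triangulates t" and reg: "regular_triangulation V \<omega> t"
  obtains k where "continuous_on UNIV k" "concave_on UNIV k" "\<forall>v\<in>V. \<omega> v \<le> k v"
    "gkz_pairing \<omega> t = 3 * integral (convex hull V) k"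
    "\<forall>t' \<sigma> h. triangulates t' \<and> \<sigma> \<in> t' \<and> affine_functional h \<and>
       (\<forall>v. v extreme_point_of \<sigma> \<longrightarrow> h v = \<omega> v) \<longrightarrow> (\<forall>x\<in>\<sigma>. h x \<le> k x)"
proof -
  obtain g where g: "\<forall>\<sigma>\<in>t. affine_functional (g \<sigma>) \<and> (\<forall>v. v extreme_point_of \<sigma> \<longrightarrow> g \<sigma> v = \<omega> v) \<and> (\<forall>v\<in>V. \<omega> v \<le> g \<sigma> v)"
    using reg unfolding regular_triangulation_def by (metis (mono_tags, lifting) bchoice)
  define F where "F = g ` t"
  define k where "k x = Min ((\<lambda>f. f x) ` F)" for x
  have F: "finite F" "F \<noteq> {}" using triangulation_finite[OF t] cell_exists[OF t] by (auto simp: F_def)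
  have Faff: "affine_functional f" and Fge: "v \<in> V \<Longrightarrow> \<omega> v \<le> f v" if "f \<in> F" for f v
    using g that by (auto simp: F_def)
  have kle: "k x \<le> f x" if "f \<in> F" for f x
    unfolding k_def using F that by (intro Min_le) auto
  have kin: "\<exists>f\<in>F. k x = f x" for x
  proof -
    have "k x \<in> (\<lambda>f. f x) ` F" unfolding k_def by (rule Min_in) (use F in auto)
    then show ?thesis by blast
  qed
  have cont: "continuous_on UNIV k"
    unfolding k_def[abs_def] by (intro continuous_on_Min_family F continuous_on_affine_functional Faff)
  have conc: "a * k x + b * k y \<le> k (a *\<^sub>R x + b *\<^sub>R y)" if ab: "a \<ge> 0" "b \<ge> 0" "a + b = 1" for x y a b
  proof -
    obtain f where f: "f \<in> F" "k (a *\<^sub>R x + b *\<^sub>R y) = f (a *\<^sub>R x + b *\<^sub>R y)" using kin by blast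
    have "a * k x + b * k y \<le> a * f x + b * f y"
      using kle[OF f(1)] ab by (intro add_mono mult_left_mono) auto
    then show ?thesis using f affine_functional_comb[OF Faff[OF f(1)] ab(3)] by simp
  qed
  have kV: "\<omega> v \<le> k v" if "v \<in> V" for v
    using kin[of v] Fge[OF _ that] by metis
  have below: "h x \<le> k x"
    if t': "triangulates t'" "\<sigma> \<in> t'" and h: "affine_functional h" "\<And>v. v extreme_point_of \<sigma> \<Longrightarrow> h v = \<omega> v"
      and x: "x \<in> \<sigma>" for t' \<sigma> h x
  proof -
    obtain f where f: "f \<in> F" "k x = f x" using kin by blast
    have "f x - h x \<ge> 0"
    proof (rule simplex_nonneg[OF t' affine_functional_diff[OF Faff[OF f(1)] h(1)] _ x])
      show "f v - h v \<ge> 0" if "v extreme_point_of \<sigma>" for v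
        using h(2)[OF that] Fge[OF f(1) cell_vertices_in_V[OF t' that]] by simp
    qed
    then show ?thesis using f by simp
  qed
  have "gkz_pairing \<omega> t = 3 * integral (convex hull V) k"
  proof (rule order_antisym)
    show "gkz_pairing \<omega> t \<le> 3 * integral (convex hull V) k"
      by (rule gkz_pairing_le[OF t cont, where h = g]) (use g below[OF t] in auto)
    show "3 * integral (convex hull V) k \<le> gkz_pairing \<omega> t"
      by (rule gkz_pairing_ge[OF t cont, where h = g]) (use g kle F_def in auto)
  qed
  moreover have "concave_on UNIV k" unfolding concave_on_iff using conc by simp
  ultimately show thesis using that cont kV below by blast
qed

lemma regular_imp_maximal:
  assumes "triangulates t" "regular_triangulation V \<omega> t" "triangulates t'"
  shows "gkz_pairing \<omega> t' \<le> gkz_pairing \<omega> t"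
proof -
  obtain k where k: "continuous_on UNIV k" "gkz_pairing \<omega> t = 3 * integral (convex hull V) k"
    and below: "\<forall>t' \<sigma> h. triangulates t' \<and> \<sigma> \<in> t' \<and> affine_functional h \<and>
       (\<forall>v. v extreme_point_of \<sigma> \<longrightarrow> h v = \<omega> v) \<longrightarrow> (\<forall>x\<in>\<sigma>. h x \<le> k x)"
    using regular_upper_envelope[OF assms(1,2)] by metis
  obtain h where h: "\<And>\<sigma>. \<sigma> \<in> t' \<Longrightarrow> affine_functional (h \<sigma>)"
    "\<And>\<sigma> v. \<sigma> \<in> t' \<Longrightarrow> v extreme_point_of \<sigma> \<Longrightarrow> h \<sigma> v = \<omega> v"
    by (rule triangulation_interpolant[OF assms(3), of \<omega>], rule that)
  have le: "h \<sigma> x \<le> k x" if "\<sigma> \<in> t'" "x \<in> \<sigma>" for \<sigma> x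
    using below assms(3) h that by blast
  show ?thesis unfolding k(2)
    by (rule gkz_pairing_le[OF assms(3) k(1), where h = h]) (use h le in auto)
qed

text \<open>
  Compare with the concave interpolation \<open>k\<close> over a regular triangulation. The interpolation over \<open>t\<close> is
  below \<open>k\<close> and has the same integral, so both agree inside every triangle. If an affine piece were below \<open>\<omega>\<close>
  at some vertex \<open>y\<close>, concavity would make \<open>k\<close> exceed it at points of the triangle close to the start of a
  segment towards \<open>y\<close>.
\<close>

lemma maximal_imp_regular:
  assumes t: "triangulates t" and max: "\<And>t'. triangulates t' \<Longrightarrow> gkz_pairing \<omega> t' \<le> gkz_pairing \<omega> t"
  shows "regular_triangulation V \<omega> t"
proof -
  obtain t0 where t0: "triangulates t0" "regular_triangulation V \<omega> t0" by (rule regular_exists)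
  obtain k where k: "continuous_on UNIV k" "gkz_pairing \<omega> t0 = 3 * integral (convex hull V) k"
    and conc: "concave_on UNIV k" and kV: "\<forall>v\<in>V. \<omega> v \<le> k v"
    and below: "\<forall>t' \<sigma> h. triangulates t' \<and> \<sigma> \<in> t' \<and> affine_functional h \<and>
       (\<forall>v. v extreme_point_of \<sigma> \<longrightarrow> h v = \<omega> v) \<longrightarrow> (\<forall>x\<in>\<sigma>. h x \<le> k x)"
    using regular_upper_envelope[OF t0] by metis
  obtain h where h: "\<And>\<sigma>. \<sigma> \<in> t \<Longrightarrow> affine_functional (h \<sigma>)"
    "\<And>\<sigma> v. \<sigma> \<in> t \<Longrightarrow> v extreme_point_of \<sigma> \<Longrightarrow> h \<sigma> v = \<omega> v"
    by (rule triangulation_interpolant[OF t, of \<omega>], rule that)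
  have le: "h \<sigma> x \<le> k x" if "\<sigma> \<in> t" "x \<in> \<sigma>" for \<sigma> x
    using below t h that by blast
  have eq: "k x = h \<sigma> x" if "\<sigma> \<in> t" "x \<in> interior \<sigma>" for \<sigma> x
  proof (rule gkz_pairing_eq_interior[OF t k(1), where h = h and \<omega> = \<omega>])
    show "3 * integral (convex hull V) k \<le> gkz_pairing \<omega> t" using max[OF t0(1)] k(2) by simp
  qed (use h le that in auto)
  have "\<omega> y \<le> h \<sigma> y" if s: "\<sigma> \<in> t" and y: "y \<in> V" for \<sigma> y
  proof (rule ccontr)
    assume n: "\<not> ?thesis"
    have "2 simplex \<sigma>" using t s unfolding polygon_triangulation_def by blast
    then obtain x where x: "x \<in> interior \<sigma>" using two_simplex_interior by blast
    obtain r where r: "0 < r" "r < 1" "(1 - r) *\<^sub>R x + r *\<^sub>R y \<in> interior \<sigma>"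
      by (rule point_towards_in_open[OF open_interior x])
    have "(1 - r) * h \<sigma> x + r * h \<sigma> y < (1 - r) * k x + r * k y"
      using eq[OF s x] n bspec[OF kV y] r(1) by simp
    also have "\<dots> \<le> k ((1 - r) *\<^sub>R x + r *\<^sub>R y)" using conc r unfolding concave_on_iff by simp
    also have "\<dots> = h \<sigma> ((1 - r) *\<^sub>R x + r *\<^sub>R y)" by (rule eq[OF s r(3)])
    also have "\<dots> = (1 - r) * h \<sigma> x + r * h \<sigma> y" by (rule affine_functional_comb[OF h(1)[OF s]]) simp
    finally show False by simp
  qed
  then show ?thesis unfolding regular_triangulation_def using h by blast
qed

text \<open>
  Every triangulation is then maximal, hence regular, for \<open>\<omega>\<close> and for \<open>- \<omega>\<close>, so the affine
  interpolation over one triangle is both above and below \<open>\<omega>\<close> at all vertices.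
\<close>

lemma gkz_pairing_constant_imp_affine:
  assumes "\<And>t. triangulates t \<Longrightarrow> gkz_pairing \<omega> t = c"
  obtains h where "affine_functional h" "\<And>v. v \<in> V \<Longrightarrow> \<omega> v = h v"
proof -
  obtain t where t: "triangulates t" using regular_exists by blast
  have r1: "regular_triangulation V \<omega> t" by (rule maximal_imp_regular[OF t]) (simp add: assms t)
  have r2: "regular_triangulation V (\<lambda>v. - \<omega> v) t"
    by (rule maximal_imp_regular[OF t]) (simp add: gkz_pairing_uminus assms t)
  obtain \<sigma> where s: "\<sigma> \<in> t" by (rule cell_exists[OF t])
  obtain h1 where h1: "affine_functional h1" "\<And>v. v extreme_point_of \<sigma> \<Longrightarrow> h1 v = \<omega> v" "\<And>v. v \<in> V \<Longrightarrow> \<omega> v \<le> h1 v"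
    using r1 s unfolding regular_triangulation_def by meson
  obtain h2 where h2: "affine_functional h2" "\<And>v. v extreme_point_of \<sigma> \<Longrightarrow> h2 v = - \<omega> v" "\<And>v. v \<in> V \<Longrightarrow> - \<omega> v \<le> h2 v"
    using r2 s unfolding regular_triangulation_def by meson
  obtain a b c where o: "orientation a b c \<noteq> 0" "{x. x extreme_point_of \<sigma>} = {a, b, c}"
    using triangulation_simplex[OF t s] by metis
  have "h1 v = - h2 v" if "v extreme_point_of \<sigma>" for v using h1(2) h2(2) that by simp
  then have "h1 x = - h2 x" for x
    using affine_functional_eq[OF h1(1) affine_functional_uminus[OF h2(1)] o(1), of x] o(2) by blast
  then have "\<omega> v = h1 v" if "v \<in> V" for v using h1(3)[OF that] h2(3)[OF that] by simp
  then show thesis using that h1(1) by blast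
qed

lemma affine_imp_gkz_pairing_constant:
  assumes "affine_functional h" "\<And>v. v \<in> V \<Longrightarrow> \<omega> v = h v" "triangulates t" "triangulates t'"
  shows "gkz_pairing \<omega> t = gkz_pairing \<omega> t'"
proof -
  have reg: "regular_triangulation V \<omega> t" if "triangulates t" for t
    unfolding regular_triangulation_def using assms(1,2) cell_vertices_in_V[OF that] by fastforce
  show ?thesis by (intro order_antisym regular_imp_maximal assms(3,4) reg)
qed

end

section \<open>Diagonals and folding functions\<close>

text \<open>
  The function that is zero on one side of the line through \<open>u\<close> and \<open>w\<close> and affine on the other side,
  so that its graph is folded along this line; \<open>s\<close> is a sign that selects the side.
\<close>

definition fold_height :: "real \<Rightarrow> real^2 \<Rightarrow> real^2 \<Rightarrow> real^2 \<Rightarrow> real" where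
  "fold_height s u w x = max 0 (s * orientation u w x)"

lemma fold_height_nonneg: "fold_height s u w x \<ge> 0"
  by (simp add: fold_height_def)

lemma continuous_on_fold_height: "continuous_on S (fold_height s u w)"
  unfolding fold_height_def[abs_def]
  by (intro continuous_on_max continuous_on_const continuous_on_affine_functional
      affine_functional_cmul affine_functional_orientation)

context convex_vertex_set
begin

text \<open>
  The last clause says that no triangle of a triangulation regular for \<open>\<omega>\<close> has vertices strictly on
  both sides of the diagonal. The diagonals used by the subdivision that \<open>\<omega>\<close> induces have this property.
\<close>

definition coarse_diagonal :: "(real^2 \<Rightarrow> real) \<Rightarrow> real^2 \<Rightarrow> real^2 \<Rightarrow> bool" where
  "coarse_diagonal \<omega> u w \<longleftrightarrow> u \<in> V \<and> w \<in> V \<and> u \<noteq> w \<and>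
     (\<exists>y\<in>V. orientation u w y > 0) \<and> (\<exists>y\<in>V. orientation u w y < 0) \<and>
     (\<forall>t \<tau> y z. triangulates t \<and> regular_triangulation V \<omega> t \<and> \<tau> \<in> t \<and>
        y extreme_point_of \<tau> \<and> z extreme_point_of \<tau> \<and> orientation u w y > 0 \<longrightarrow>
        orientation u w z \<ge> 0)"

text \<open>
  Let \<open>h\<close> be the affine piece of a triangle in a regular triangulation, and let \<open>y\<close> be a vertex at which \<open>\<omega>\<close>
  differs from it. In a cyclic labelling that starts at \<open>y\<close>, the first and the last of the vertices where \<open>\<omega>\<close>
  equals \<open>h\<close> span a diagonal that separates \<open>y\<close> from the other ones of them. A triangle with vertices \<open>v\<close>
  and \<open>z\<close> strictly on the two sides, on the side of \<open>y\<close> and on the opposite one, would meet the diagonal in a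
  point \<open>x\<close> of the segment from \<open>v\<close> to \<open>z\<close>; comparing at \<open>x\<close> the affine piece of this triangle with \<open>h\<close> shows that \<open>\<omega>\<close>
  equals \<open>h\<close> at \<open>v\<close>, although \<open>v\<close> is on the side of \<open>y\<close>.
\<close>

lemma coarse_diagonal_exists:
  assumes nonaff: "\<And>h. affine_functional h \<Longrightarrow> \<exists>v\<in>V. \<omega> v \<noteq> h v"
  obtains u w where "coarse_diagonal \<omega> u w"
proof -
  obtain t where t: "triangulates t" "regular_triangulation V \<omega> t" by (rule regular_exists)
  obtain \<sigma> where s: "\<sigma> \<in> t" by (rule cell_exists[OF t(1)])
  obtain h where h: "affine_functional h" "\<And>v. v extreme_point_of \<sigma> \<Longrightarrow> h v = \<omega> v" "\<And>v. v \<in> V \<Longrightarrow> \<omega> v \<le> h v"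
    using t(2) s unfolding regular_triangulation_def by meson
  obtain a b c where abc: "orientation a b c \<noteq> 0" "{x. x extreme_point_of \<sigma>} = {a, b, c}"
    using triangulation_simplex[OF t(1) s] by metis
  have abcV: "a \<in> V" "b \<in> V" "c \<in> V" and eq: "h a = \<omega> a" "h b = \<omega> b" "h c = \<omega> c"
    using abc(2) cell_vertices_in_V[OF t(1) s] h(2) by blast+
  have dist: "a \<noteq> b" "b \<noteq> c" "a \<noteq> c" using orientation_nonzero_distinct[OF abc(1)] by auto
  obtain y where y: "y \<in> V" "\<omega> y \<noteq> h y" using nonaff[OF h(1)] by blast
  obtain p where p: "cyclic_polygon (card V) p V" and p1: "p 1 = y" by (rule labelling[OF y(1)])
  interpret cp: cyclic_polygon "card V" p V by (rule p)
  let ?N = "card V"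
  define I where "I = {m \<in> {1..?N}. \<omega> (p m) = h (p m)}"
  have finI: "finite I" by (simp add: I_def)
  have inI: "\<exists>m\<in>I. v = p m" if "v \<in> V" "h v = \<omega> v" for v
    using that cp.V_eq by (force simp: I_def)
  obtain ia ib ic where i: "ia \<in> I" "a = p ia" "ib \<in> I" "b = p ib" "ic \<in> I" "c = p ic"
    using inI[OF abcV(1) eq(1)] inI[OF abcV(2) eq(2)] inI[OF abcV(3) eq(3)] by blast
  define k l where "k = Min I" and "l = Max I"
  have kl: "k \<in> I" "l \<in> I" using finI i(1) Min_in Max_in by (auto simp: k_def l_def)
  have between: "k \<le> m \<and> m \<le> l" if "m \<in> I" for m using finI that by (simp add: k_def l_def)
  have not1: "1 \<notin> I" using y(2) p1 by (auto simp: I_def)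
  have k1: "1 < k" using kl(1) not1 by (metis I_def atLeastAtMost_iff le_neq_implies_less mem_Collect_eq)
  have lN: "l \<le> ?N" using kl(2) by (simp add: I_def)
  have "ia \<noteq> ib" "ib \<noteq> ic" "ia \<noteq> ic" using dist i by auto
  then obtain m where m: "m \<in> I" "m \<noteq> k" "m \<noteq> l" using i by metis
  then have kml: "k < m" "m < l" using between[OF m(1)] by auto
  let ?o = "orientation (p k) (p l)"
  have oy: "?o y > 0" using cp.orient_outside[of k l 1] k1 kml lN p1 by simp
  have om: "?o (p m) < 0" using cp.orient_inside[of k m l] k1 kml lN by simp
  have oS: "?o v \<le> 0" if "v \<in> V" "h v = \<omega> v" for v
  proof -
    obtain j where j: "j \<in> I" "v = p j" using inI[OF \<open>v \<in> V\<close> \<open>h v = \<omega> v\<close>] by blast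
    have "j = k \<or> j = l \<or> (k < j \<and> j < l)" using between[OF j(1)] by auto
    then show ?thesis using cp.orient_inside[of k j l] k1 lN j(2) by auto
  qed
  have hkl: "h (p k) = \<omega> (p k)" "h (p l) = \<omega> (p l)" using kl by (auto simp: I_def)
  have pV: "p k \<in> V" "p l \<in> V" "p m \<in> V" using cp.p_in_V k1 kml lN by auto
  have "coarse_diagonal \<omega> (p k) (p l)"
    unfolding coarse_diagonal_def
  proof (intro conjI allI impI)
    show "p k \<in> V" "p l \<in> V" by (rule pV)+
    show "p k \<noteq> p l" using cp.p_inj[of k l] k1 kml lN by simp
    show "\<exists>y\<in>V. ?o y > 0" using oy y(1) by blast
    show "\<exists>y\<in>V. ?o y < 0" using om pV(3) by blast
    fix t' \<tau> v z
    assume "triangulates t' \<and> regular_triangulation V \<omega> t' \<and> \<tau> \<in> t' \<and>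
        v extreme_point_of \<tau> \<and> z extreme_point_of \<tau> \<and> ?o v > 0"
    then have t': "triangulates t'" "regular_triangulation V \<omega> t'" "\<tau> \<in> t'"
      and vz: "v extreme_point_of \<tau>" "z extreme_point_of \<tau>" "?o v > 0" by auto
    show "?o z \<ge> 0"
    proof (rule ccontr)
      assume "\<not> ?thesis"
      then have oz: "?o z < 0" by simp
      have vzV: "v \<in> V" "z \<in> V" using cell_vertices_in_V[OF t'(1,3)] vz by auto
      obtain g where g: "affine_functional g" "\<And>v. v extreme_point_of \<tau> \<Longrightarrow> g v = \<omega> v" "\<And>v. v \<in> V \<Longrightarrow> \<omega> v \<le> g v"
        using t'(2,3) unfolding regular_triangulation_def by meson
      define s where "s = ?o v / (?o v - ?o z)"
      have s: "0 < s" "s < 1" using vz(3) oz by (auto simp: s_def)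
      define x where "x = (1 - s) *\<^sub>R v + s *\<^sub>R z"
      have "?o x = (1 - s) * ?o v + s * ?o z" by (simp add: x_def orientation_convex_comb)
      also have "\<dots> = ?o v - s * (?o v - ?o z)" by (simp add: algebra_simps)
      also have "\<dots> = 0" using vz(3) oz by (simp add: s_def)
      finally have ox: "?o x = 0" .
      have "x \<in> convex hull V"
        unfolding x_def using vzV s hull_inc[of _ V convex]
        by (intro convexD[OF convex_convex_hull]) auto
      then have "x \<in> closed_segment (p k) (p l)"
        using cp.chord_segment[of k l x] ox k1 kml lN by simp
      then obtain r where r: "0 \<le> r" "r \<le> 1" "x = (1 - r) *\<^sub>R p k + r *\<^sub>R p l"
        unfolding in_segment by blast
      have gx: "g x = (1 - s) * \<omega> v + s * \<omega> z"
        unfolding x_def using affine_functional_comb[OF g(1), of "1 - s" s v z] g(2)[OF vz(1)] g(2)[OF vz(2)] by simp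
      have hx: "h x = (1 - r) * \<omega> (p k) + r * \<omega> (p l)"
        unfolding r(3) using affine_functional_comb[OF h(1), of "1 - r" r "p k" "p l"] hkl by simp
      have "h x \<le> g x"
      proof -
        have "g x = (1 - r) * g (p k) + r * g (p l)"
          unfolding r(3) using affine_functional_comb[OF g(1), of "1 - r" r "p k" "p l"] by simp
        moreover have "(1 - r) * \<omega> (p k) \<le> (1 - r) * g (p k)" "r * \<omega> (p l) \<le> r * g (p l)"
          using r g(3)[OF pV(1)] g(3)[OF pV(2)] by (auto intro: mult_left_mono)
        ultimately show ?thesis using hx by linarith
      qed
      moreover have "h x = (1 - s) * h v + s * h z"
        unfolding x_def using affine_functional_comb[OF h(1), of "1 - s" s v z] by simp
      moreover have "s * \<omega> z \<le> s * h z" using s h(3)[OF vzV(2)] by simp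
      ultimately have "(1 - s) * h v \<le> (1 - s) * \<omega> v" using gx by linarith
      then have "h v \<le> \<omega> v" using s by simp
      then have "h v = \<omega> v" using h(3)[OF vzV(1)] by simp
      then show False using oS[OF vzV(1)] vz(3) by simp
    qed
  qed
  then show thesis by (rule that)
qed

text \<open>
  A convex function is below all its piecewise linear interpolations.
\<close>

lemma fold_height_lower_bound:
  assumes t: "triangulates t"
  shows "3 * integral (convex hull V) (fold_height s u w) \<le> gkz_pairing (fold_height s u w) t"
proof -
  obtain h where h: "\<And>\<sigma>. \<sigma> \<in> t \<Longrightarrow> affine_functional (h \<sigma>)"
    "\<And>\<sigma> v. \<sigma> \<in> t \<Longrightarrow> v extreme_point_of \<sigma> \<Longrightarrow> h \<sigma> v = fold_height s u w v"
    by (rule triangulation_interpolant[OF t, of "fold_height s u w"], rule that)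
  have ge: "fold_height s u w x \<le> h \<sigma> x" if \<sigma>: "\<sigma> \<in> t" and x: "x \<in> \<sigma>" for \<sigma> x
  proof -
    have "h \<sigma> x \<ge> 0"
      using simplex_nonneg[OF t \<sigma> h(1)[OF \<sigma>] _ x] h(2)[OF \<sigma>] fold_height_nonneg by simp
    moreover have "h \<sigma> x - s * orientation u w x \<ge> 0"
    proof (rule simplex_nonneg[OF t \<sigma> _ _ x])
      show "affine_functional (\<lambda>x. h \<sigma> x - s * orientation u w x)"
        by (intro affine_functional_diff h(1) \<sigma> affine_functional_cmul affine_functional_orientation)
      show "h \<sigma> v - s * orientation u w v \<ge> 0" if "v extreme_point_of \<sigma>" for v
        using h(2)[OF \<sigma> that] by (simp add: fold_height_def)
    qed
    ultimately show ?thesis by (simp add: fold_height_def)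
  qed
  show ?thesis
    by (rule gkz_pairing_ge[OF t continuous_on_fold_height, where h = h]) (use h ge in auto)
qed

text \<open>
  Every triangle of \<open>t\<close> lies on one side of the diagonal, where the folding function is affine.
\<close>

lemma fold_height_attained:
  assumes d: "coarse_diagonal \<omega> u w" and t: "triangulates t" "regular_triangulation V \<omega> t"
    and s: "s = 1 \<or> s = -1"
  shows "gkz_pairing (fold_height s u w) t = 3 * integral (convex hull V) (fold_height s u w)"
proof -
  let ?l = "\<lambda>x. s * orientation u w x"
  define h where "h \<sigma> = (if \<forall>v. v extreme_point_of \<sigma> \<longrightarrow> ?l v \<ge> 0 then ?l else (\<lambda>x. 0))" for \<sigma>
  have sides: "(\<forall>v. v extreme_point_of \<sigma> \<longrightarrow> ?l v \<ge> 0) \<or> (\<forall>v. v extreme_point_of \<sigma> \<longrightarrow> ?l v \<le> 0)"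
    if \<sigma>: "\<sigma> \<in> t" for \<sigma>
  proof -
    have "orientation u w z \<ge> 0" if "y extreme_point_of \<sigma>" "z extreme_point_of \<sigma>" "orientation u w y > 0" for y z
      using d t \<sigma> that unfolding coarse_diagonal_def by blast
    then have "(\<forall>z. z extreme_point_of \<sigma> \<longrightarrow> orientation u w z \<ge> 0) \<or> (\<forall>z. z extreme_point_of \<sigma> \<longrightarrow> orientation u w z \<le> 0)"
      using not_less by blast
    then show ?thesis using s by auto
  qed
  have aff: "affine_functional (h \<sigma>)" for \<sigma>
    unfolding h_def by (simp add: affine_functional_cmul affine_functional_orientation affine_functional_const)
  have vert: "h \<sigma> v = fold_height s u w v" if "\<sigma> \<in> t" "v extreme_point_of \<sigma>" for \<sigma> v
    using sides[OF that(1)] that(2) unfolding h_def fold_height_def by (auto simp: max_def)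
  have le: "h \<sigma> x \<le> fold_height s u w x" for \<sigma> x
    unfolding h_def fold_height_def by simp
  have "gkz_pairing (fold_height s u w) t \<le> 3 * integral (convex hull V) (fold_height s u w)"
    by (rule gkz_pairing_le[OF t(1) continuous_on_fold_height, where h = h]) (use aff vert le in auto)
  then show ?thesis using fold_height_lower_bound[OF t(1)] by (simp add: order_antisym)
qed

lemma fold_height_not_constant:
  assumes d: "coarse_diagonal \<omega> u w" and s: "s = 1 \<or> s = -1"
  shows "\<not> (\<forall>t. triangulates t \<longrightarrow> gkz_pairing (fold_height s u w) t = c)"
proof
  assume "\<forall>t. triangulates t \<longrightarrow> gkz_pairing (fold_height s u w) t = c"
  then obtain h where h: "affine_functional h" "\<And>v. v \<in> V \<Longrightarrow> fold_height s u w v = h v"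
    using gkz_pairing_constant_imp_affine by blast
  have uw: "u \<in> V" "w \<in> V" using d unfolding coarse_diagonal_def by auto
  have "\<exists>y\<in>V. \<exists>z\<in>V. s * orientation u w y > 0 \<and> s * orientation u w z < 0"
    using d s unfolding coarse_diagonal_def by auto
  then obtain y z where yz: "y \<in> V" "z \<in> V" "s * orientation u w y > 0" "s * orientation u w z < 0" by blast
  have "h u = 0" "h w = 0" "h z = 0"
    using h(2)[OF uw(1)] h(2)[OF uw(2)] h(2)[OF yz(2)] yz(4) by (simp_all add: fold_height_def)
  moreover have "orientation u w z \<noteq> 0" using yz(4) by auto
  ultimately have "h y = 0"
    using affine_functional_eq[OF h(1) affine_functional_const[of 0], of u w z y] by simp
  moreover have "h y > 0" using h(2)[OF yz(1)] yz(3) unfolding fold_height_def by linarith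
  ultimately show False by simp
qed

text \<open>
  The condition \<open>facet_functional\<close> for the secondary polytope, expressed by triangulations.
\<close>

definition facet_direction :: "(real^2 \<Rightarrow> real) \<Rightarrow> bool" where
  "facet_direction \<omega> \<longleftrightarrow>
     (\<forall>\<psi> c. (\<forall>t. triangulates t \<and> regular_triangulation V \<omega> t \<longrightarrow> gkz_pairing \<psi> t = c) \<longrightarrow>
        (\<exists>r b. \<forall>t. triangulates t \<longrightarrow> gkz_pairing \<psi> t = r * gkz_pairing \<omega> t + b))"

text \<open>
  The folding function is constant on the triangulations that are maximal for \<open>\<omega>\<close>, so the facet
  condition makes it an affine function of \<open>\<omega>\<close>. The factor is not positive since the folding
  function is minimal there, and not zero since the folding function is not affine.
\<close>

lemma facet_functional_is_fold:
  assumes nc: "triangulates t1" "triangulates t2" "gkz_pairing \<omega> t1 \<noteq> gkz_pairing \<omega> t2"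
    and facet: "facet_direction \<omega>"
  shows "\<exists>u w. coarse_diagonal \<omega> u w \<and> (\<forall>s. s = 1 \<or> s = -1 \<longrightarrow> (\<exists>r b. r < 0 \<and>
       (\<forall>t. triangulates t \<longrightarrow> gkz_pairing (fold_height s u w) t = r * gkz_pairing \<omega> t + b)))"
proof -
  have "\<exists>v\<in>V. \<omega> v \<noteq> h v" if "affine_functional h" for h
    using affine_imp_gkz_pairing_constant[OF that _ nc(1,2)] nc(3) by blast
  then obtain u w where d: "coarse_diagonal \<omega> u w" using coarse_diagonal_exists by blast
  have "\<exists>r b. r < 0 \<and> (\<forall>t. triangulates t \<longrightarrow> gkz_pairing (fold_height s u w) t = r * gkz_pairing \<omega> t + b)"
    if s: "s = 1 \<or> s = -1" for s
  proof -
    let ?\<psi> = "fold_height s u w"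
    have "\<forall>t. triangulates t \<and> regular_triangulation V \<omega> t \<longrightarrow>
        gkz_pairing ?\<psi> t = 3 * integral (convex hull V) ?\<psi>"
      using fold_height_attained[OF d _ _ s] by blast
    then obtain r b where rb: "\<And>t. triangulates t \<Longrightarrow> gkz_pairing ?\<psi> t = r * gkz_pairing \<omega> t + b"
      using facet unfolding facet_direction_def by meson
    obtain t0 where t0: "triangulates t0" "regular_triangulation V \<omega> t0" by (rule regular_exists)
    have "gkz_pairing \<omega> t1 < gkz_pairing \<omega> t0 \<or> gkz_pairing \<omega> t2 < gkz_pairing \<omega> t0"
      using regular_imp_maximal[OF t0 nc(1)] regular_imp_maximal[OF t0 nc(2)] nc(3) by linarith
    then obtain t' where t': "triangulates t'" "gkz_pairing \<omega> t' < gkz_pairing \<omega> t0" using nc by blast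
    have "gkz_pairing ?\<psi> t0 \<le> gkz_pairing ?\<psi> t'"
      using fold_height_lower_bound[OF t'(1)] fold_height_attained[OF d t0 s] by simp
    then have "r * gkz_pairing \<omega> t0 \<le> r * gkz_pairing \<omega> t'" using rb[OF t0(1)] rb[OF t'(1)] by simp
    then have "r \<le> 0" using t'(2) by (metis mult_less_cancel_left_pos not_le)
    moreover have "r \<noteq> 0" using fold_height_not_constant[OF d s, of b] rb by auto
    ultimately show ?thesis using rb by (intro exI[of _ r] exI[of _ b]) auto
  qed
  then show ?thesis using d by blast
qed

text \<open>
  Each vertex lies in at least one of the four closed quadrants, and in a further one for each of the two lines
  that it is on. Each line contains two vertices, so the quadrants together contain at
  least \<open>5 + 2 + 2 > 4 * 2\<close> vertices, counted with multiplicity.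
\<close>

lemma three_points_in_quadrant:
  assumes N: "5 \<le> card V" and uw: "u \<in> V" "w \<in> V" "u \<noteq> w" and uw': "u' \<in> V" "w' \<in> V" "u' \<noteq> w'"
  obtains s s' where "s = 1 \<or> s = -1" "s' = 1 \<or> s' = -1"
    "3 \<le> card {v \<in> V. s * orientation u w v \<le> 0 \<and> s' * orientation u' w' v \<le> 0}"
proof -
  let ?l = "orientation u w" and ?l' = "orientation u' w'"
  define Z where "Z s s' = {v \<in> V. s * ?l v \<le> 0 \<and> s' * ?l' v \<le> 0}" for s s' :: real
  have cZ: "card (Z s s') = (\<Sum>v\<in>V. if s * ?l v \<le> 0 \<and> s' * ?l' v \<le> 0 then 1 else 0)" for s s'
    unfolding Z_def using finite_V by (simp add: sum.If_cases Int_def)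
  have two: "2 \<le> (\<Sum>v\<in>V. if orientation a b v = 0 then 1 else 0 :: nat)" if "a \<in> V" "b \<in> V" "a \<noteq> b" for a b
  proof -
    have "card {a, b} \<le> card {v \<in> V. orientation a b v = 0}"
      using that finite_V by (intro card_mono) auto
    then show ?thesis using that finite_V by (simp add: sum.If_cases Int_def)
  qed
  have "(\<Sum>v\<in>V. 1 + (if ?l v = 0 then 1 else 0) + (if ?l' v = 0 then 1 else 0))
      \<le> card (Z 1 1) + card (Z 1 (-1)) + card (Z (-1) 1) + card (Z (-1) (-1))"
    unfolding cZ sum.distrib[symmetric] by (intro sum_mono) auto
  then have "9 \<le> card (Z 1 1) + card (Z 1 (-1)) + card (Z (-1) 1) + card (Z (-1) (-1))"
    using N two[OF uw] two[OF uw'] unfolding sum.distrib by simp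
  then have "3 \<le> card (Z 1 1) \<or> 3 \<le> card (Z 1 (-1)) \<or> 3 \<le> card (Z (-1) 1) \<or> 3 \<le> card (Z (-1) (-1))"
    by linarith
  then show thesis
    using that[of 1 1] that[of 1 "-1"] that[of "-1" 1] that[of "-1" "-1"] unfolding Z_def by blast
qed

lemma no_opposite_facets:
  assumes N: "5 \<le> card V"
    and nc: "triangulates t1" "triangulates t2" "gkz_pairing \<omega> t1 \<noteq> gkz_pairing \<omega> t2"
    and top: "facet_direction \<omega>" and bot: "facet_direction (\<lambda>v. - \<omega> v)"
  shows False
proof -
  obtain u w where d: "coarse_diagonal \<omega> u w"
    and fold: "\<forall>s. s = 1 \<or> s = -1 \<longrightarrow> (\<exists>r b. r < 0 \<and>
       (\<forall>t. triangulates t \<longrightarrow> gkz_pairing (fold_height s u w) t = r * gkz_pairing \<omega> t + b))"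
    using facet_functional_is_fold[OF nc top] by blast
  have nc': "gkz_pairing (\<lambda>v. - \<omega> v) t1 \<noteq> gkz_pairing (\<lambda>v. - \<omega> v) t2"
    using nc(3) by (simp add: gkz_pairing_uminus)
  obtain u' w' where d': "coarse_diagonal (\<lambda>v. - \<omega> v) u' w'"
    and fold': "\<forall>s. s = 1 \<or> s = -1 \<longrightarrow> (\<exists>r b. r < 0 \<and>
       (\<forall>t. triangulates t \<longrightarrow> gkz_pairing (fold_height s u' w') t = r * gkz_pairing (\<lambda>v. - \<omega> v) t + b))"
    using facet_functional_is_fold[OF nc(1,2) nc' bot] by blast
  have uw: "u \<in> V" "w \<in> V" "u \<noteq> w" "u' \<in> V" "w' \<in> V" "u' \<noteq> w'"
    using d d' unfolding coarse_diagonal_def by auto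
  obtain s s' where s: "s = 1 \<or> s = -1" and s': "s' = 1 \<or> s' = -1"
    and Z: "3 \<le> card {v \<in> V. s * orientation u w v \<le> 0 \<and> s' * orientation u' w' v \<le> 0}"
    using three_points_in_quadrant[OF N uw] by blast
  obtain r b where r: "r < 0" "\<And>t. triangulates t \<Longrightarrow> gkz_pairing (fold_height s u w) t = r * gkz_pairing \<omega> t + b"
    using mp[OF spec[OF fold] s] by blast
  obtain r' b' where r': "r' < 0" "\<And>t. triangulates t \<Longrightarrow> gkz_pairing (fold_height s' u' w') t = - r' * gkz_pairing \<omega> t + b'"
  proof -
    obtain r b where "r < 0" "\<forall>t. triangulates t \<longrightarrow>
        gkz_pairing (fold_height s' u' w') t = r * gkz_pairing (\<lambda>v. - \<omega> v) t + b"
      using mp[OF spec[OF fold'] s'] by blast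
    then show thesis by (intro that[of r b]) (auto simp: gkz_pairing_uminus)
  qed
  define \<psi> where "\<psi> v = (- r') * fold_height s u w v + (- r) * fold_height s' u' w' v" for v
  have "gkz_pairing \<psi> t = - r' * b - r * b'" if "triangulates t" for t
    unfolding \<psi>_def[abs_def] gkz_pairing_lincomb r(2)[OF that] r'(2)[OF that] by (simp add: algebra_simps)
  then obtain h where h: "affine_functional h" "\<And>v. v \<in> V \<Longrightarrow> \<psi> v = h v"
    using gkz_pairing_constant_imp_affine by blast
  let ?Z = "{v \<in> V. s * orientation u w v \<le> 0 \<and> s' * orientation u' w' v \<le> 0}"
  obtain T where T: "T \<subseteq> ?Z" "card T = 3" by (rule obtain_subset_with_card_n[OF Z])
  obtain x y z where xyz: "T = {x, y, z}" "x \<noteq> y" "y \<noteq> z" "x \<noteq> z"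
    using T(2) unfolding card_3_iff by blast
  have inZ: "x \<in> ?Z" "y \<in> ?Z" "z \<in> ?Z" using T xyz by auto
  have zero: "h v = 0" if "v \<in> ?Z" for v
    using h(2)[of v] that by (simp add: \<psi>_def fold_height_def)
  have "orientation x y z \<noteq> 0"
    using extreme_points_not_collinear[of x "convex hull V" y z] extreme_V inZ xyz by auto
  then have hz: "h v = 0" for v
    using affine_functional_eq[OF h(1) affine_functional_const[of 0], of x y z v] zero[OF inZ(1)] zero[OF inZ(2)] zero[OF inZ(3)] by simp
  have "\<exists>y\<in>V. s * orientation u w y > 0" using d s unfolding coarse_diagonal_def by auto
  then obtain q where q: "q \<in> V" "s * orientation u w q > 0" by blast
  then have "(- r') * fold_height s u w q > 0" using r'(1) by (simp add: fold_height_def mult_neg_pos)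
  moreover have "(- r) * fold_height s' u' w' q \<ge> 0"
    using r(1) fold_height_nonneg[of s' u' w' q] by (simp add: mult_nonpos_nonneg)
  ultimately have "\<psi> q > 0" unfolding \<psi>_def by linarith
  then show False using h(2)[OF q(1)] hz by simp
qed

end

section \<open>The secondary polytope has no parallel facets\<close>

lemma standard_basis_inner:
  assumes "standard_basis N e" "i \<in> {1..N}" "j \<in> {1..N}"
  shows "e i \<bullet> e j = (if i = j then 1 else 0)"
proof -
  have b: "bij_betw e {1..N} Basis" using assms unfolding standard_basis_def by blast
  have "e i \<in> Basis" "e j \<in> Basis" using bij_betw_apply[OF b] assms by auto
  moreover have "e i = e j \<longleftrightarrow> i = j" using inj_on_eq_iff[OF bij_betw_imp_inj_on[OF b]] assms by blast
  ultimately show ?thesis by (simp add: inner_Basis)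
qed

lemma standard_basis_coefficient:
  assumes "standard_basis N e" "j \<in> {1..N}"
  shows "(\<Sum>i=1..N. a i *\<^sub>R e i) \<bullet> e j = a j"
proof -
  have "(\<Sum>i=1..N. a i *\<^sub>R e i) \<bullet> e j = (\<Sum>i=1..N. if i = j then a i else 0)"
    unfolding inner_sum_left using standard_basis_inner[OF assms(1) _ assms(2)]
    by (intro sum.cong) auto
  then show ?thesis using assms(2) by simp
qed

lemma GKZ_vector_inner:
  assumes q: "bij_betw q {1..N} {v. v extreme_point_of Q}" and t: "polygon_triangulation Q t"
    and \<omega>: "\<And>i. i \<in> {1..N} \<Longrightarrow> \<omega> (q i) = c \<bullet> e i"
  shows "c \<bullet> GKZ_vector N q e t = gkz_pairing \<omega> t"
proof -
  have fin: "finite t" using t by (rule triangulation_finite)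
  have "c \<bullet> GKZ_vector N q e t =
      (\<Sum>i=1..N. \<Sum>\<sigma> | \<sigma> \<in> t \<and> q i extreme_point_of \<sigma>. measure lborel \<sigma> * \<omega> (q i))"
    unfolding GKZ_vector_def inner_sum_right using \<omega> by (intro sum.cong) auto
  also have "\<dots> = (\<Sum>i=1..N. \<Sum>\<sigma>\<in>t. if q i extreme_point_of \<sigma> then measure lborel \<sigma> * \<omega> (q i) else 0)"
    by (intro sum.cong refl sum.inter_filter[OF fin])
  also have "\<dots> = (\<Sum>\<sigma>\<in>t. \<Sum>i=1..N. if q i extreme_point_of \<sigma> then measure lborel \<sigma> * \<omega> (q i) else 0)"
    by (rule sum.swap)
  also have "\<dots> = gkz_pairing \<omega> t"
    unfolding gkz_pairing_def
  proof (rule sum.cong[OF refl])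
    fix \<sigma> assume \<sigma>: "\<sigma> \<in> t"
    let ?V = "{v. v extreme_point_of Q}"
    have finV: "finite ?V" using bij_betw_finite[OF q] by simp
    have sub: "{v. v extreme_point_of \<sigma>} \<subseteq> ?V" using t \<sigma> unfolding polygon_triangulation_def by blast
    have "(\<Sum>i=1..N. if q i extreme_point_of \<sigma> then measure lborel \<sigma> * \<omega> (q i) else 0) =
        (\<Sum>v\<in>?V. if v extreme_point_of \<sigma> then measure lborel \<sigma> * \<omega> v else 0)"
      by (rule sum.reindex_bij_betw[OF q, of "\<lambda>v. if v extreme_point_of \<sigma> then measure lborel \<sigma> * \<omega> v else 0"])
    also have "\<dots> = (\<Sum>v | v \<in> ?V \<and> v extreme_point_of \<sigma>. measure lborel \<sigma> * \<omega> v)"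
      by (rule sum.inter_filter[OF finV, symmetric])
    also have "{v. v \<in> ?V \<and> v extreme_point_of \<sigma>} = {v. v extreme_point_of \<sigma>}" using sub by blast
    finally show "(\<Sum>i=1..N. if q i extreme_point_of \<sigma> then measure lborel \<sigma> * \<omega> (q i) else 0) =
        measure lborel \<sigma> * (\<Sum>v | v extreme_point_of \<sigma>. \<omega> v)"
      by (simp add: sum_distrib_left)
  qed
  finally show ?thesis .
qed

lemma (in convex_vertex_set) finite_triangulations: "finite {t. triangulates t}"
proof (rule finite_subset)
  show "{t. triangulates t} \<subseteq> Pow ((\<lambda>A. convex hull A) ` Pow V)"
  proof
    fix t assume t: "t \<in> {t. triangulates t}"
    have "\<sigma> \<in> (\<lambda>A. convex hull A) ` Pow V" if \<sigma>: "\<sigma> \<in> t" for \<sigma>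
    proof -
      obtain u v w where s: "\<sigma> = convex hull {u, v, w}" "{x. x extreme_point_of \<sigma>} = {u, v, w}"
        using triangulation_simplex[of "convex hull V" t \<sigma>] t \<sigma> by (metis mem_Collect_eq)
      have "{u, v, w} \<subseteq> V" unfolding s(2)[symmetric] using cell_vertices_in_V[OF _ \<sigma>] t by blast
      then show ?thesis using s(1) by blast
    qed
    then show "t \<in> Pow ((\<lambda>A. convex hull A) ` Pow V)" by blast
  qed
  show "finite (Pow ((\<lambda>A. convex hull A) ` Pow V))" using finite_V by simp
qed

text \<open>
  A functional \<open>c\<close> on the secondary polytope is the height function \<open>weight c\<close>, and conversely every height
  function \<open>\<psi>\<close> comes from a functional \<open>d\<close>. The face on which \<open>c\<close> is maximal is spanned by the GKZ vectors
  of the triangulations that are regular for \<open>weight c\<close>.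
\<close>

lemma Ass_I_no_opposite_facets:
  fixes f :: "nat \<Rightarrow> 'b::euclidean_space"
  assumes n: "n \<ge> 2" and f: "standard_basis (n + 3) f" and Q: "convex_polygon (n + 3) q Q"
  shows "\<not> has_opposite_facets (Ass_I n q Q f)"
proof
  define N where "N = n + 3"
  define V where "V = {v. v extreme_point_of Q}"
  have poly: "polytope Q" and q: "bij_betw q {1..N} V"
    using Q unfolding convex_polygon_def N_def V_def by auto
  have cardV: "card V = N" using bij_betw_same_card[OF q] by simp
  have finV: "finite V" using bij_betw_finite[OF q] by simp
  have hullV: "Q = convex hull V"
    unfolding V_def by (rule Krein_Milman_Minkowski) (simp_all add: poly polytope_imp_compact polytope_imp_convex)
  interpret convex_vertex_set V
  proof
    show "finite V" by (rule finV)
    show "3 \<le> card V" using cardV by (simp add: N_def)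
    show "v extreme_point_of (convex hull V)" if "v \<in> V" for v
      using that unfolding hullV[symmetric] by (simp add: V_def)
  qed
  define G where "G = GKZ_vector N q f ` {t. triangulates t}"
  have Ass: "Ass_I n q Q f = convex hull G"
    unfolding Ass_I_def G_def N_def hullV[symmetric] by (intro arg_cong[where f = "\<lambda>X. convex hull X"]) blast
  have finG: "finite G" unfolding G_def by (intro finite_imageI finite_triangulations)
  have in_hull: "GKZ_vector N q f t \<in> convex hull G" if "triangulates t" for t
    by (rule hull_inc) (simp add: G_def that)
  define weight where "weight c v = c \<bullet> f (inv_into {1..N} q v)" for c :: 'b and v
  have weight: "weight c (q i) = c \<bullet> f i" if "i \<in> {1..N}" for c i
    unfolding weight_def using bij_betw_inv_into_left[OF q that] by simp
  have q': "bij_betw q {1..N} {v. v extreme_point_of Q}" using q unfolding V_def .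
  have pair: "c \<bullet> GKZ_vector N q f t = gkz_pairing \<omega> t"
    if "triangulates t" "\<And>i. i \<in> {1..N} \<Longrightarrow> \<omega> (q i) = c \<bullet> f i" for c \<omega> t
    using GKZ_vector_inner[OF q', of t \<omega> c f] that hullV by simp
  have dir: "facet_direction (weight c)" if facet: "facet_functional (convex hull G) c" for c
    unfolding facet_direction_def
  proof (intro allI impI)
    fix \<psi> k
    assume k: "\<forall>t. triangulates t \<and> regular_triangulation V (weight c) t \<longrightarrow> gkz_pairing \<psi> t = k"
    define d where "d = (\<Sum>i=1..N. \<psi> (q i) *\<^sub>R f i)"
    have d: "\<psi> (q i) = d \<bullet> f i" if "i \<in> {1..N}" for i
      using standard_basis_coefficient[OF f] that unfolding d_def N_def by simp
    have dk: "d \<bullet> x = k" if x: "x \<in> convex hull G" "\<forall>y\<in>convex hull G. c \<bullet> y \<le> c \<bullet> x" for x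
    proof -
      have "affine_functional (\<lambda>y. c \<bullet> y - c \<bullet> x)"
        unfolding affine_functional_def by (rule exI[of _ c], rule exI[of _ "- (c \<bullet> x)"]) simp
      then have xM: "x \<in> convex hull {g \<in> G. c \<bullet> g - c \<bullet> x = 0}"
        using convex_hull_zero_set[OF finG, of "\<lambda>y. c \<bullet> y - c \<bullet> x" x] x hull_inc[of _ G convex] by simp
      have G0: "d \<bullet> g - k = 0" if g: "g \<in> {g \<in> G. c \<bullet> g - c \<bullet> x = 0}" for g
      proof -
        obtain t where t: "triangulates t" "g = GKZ_vector N q f t" using g unfolding G_def by blast
        have "regular_triangulation V (weight c) t"
        proof (rule maximal_imp_regular[OF t(1)])
          fix t' assume t': "triangulates t'"
          have "c \<bullet> GKZ_vector N q f t' \<le> c \<bullet> GKZ_vector N q f t" 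
            using bspec[OF x(2) in_hull[OF t']] g t(2) by simp
          then show "gkz_pairing (weight c) t' \<le> gkz_pairing (weight c) t"
            using pair[OF t(1) weight] pair[OF t' weight] by simp
        qed
        then have "gkz_pairing \<psi> t = k" using k t(1) by blast
        then show ?thesis using pair[OF t(1) d] t(2) by simp
      qed
      have aff: "affine_functional (\<lambda>y. d \<bullet> y - k)"
        unfolding affine_functional_def by (rule exI[of _ d], rule exI[of _ "- k"]) simp
      show ?thesis using affine_functional_zero_hull[OF aff G0 xM] by simp
    qed
    have "\<forall>x\<in>convex hull G. (\<forall>y\<in>convex hull G. c \<bullet> y \<le> c \<bullet> x) \<longrightarrow> d \<bullet> x = k"
      by (rule ballI, rule impI, rule dk)
    from mp[OF spec[OF spec[OF facet[unfolded facet_functional_def], of d], of k] this]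
    obtain r b where rb: "\<forall>x\<in>convex hull G. d \<bullet> x = r * (c \<bullet> x) + b" by blast
    have "gkz_pairing \<psi> t = r * gkz_pairing (weight c) t + b" if t: "triangulates t" for t
    proof -
      show ?thesis using bspec[OF rb in_hull[OF t]] pair[OF t d] pair[OF t weight] by simp
    qed
    then show "\<exists>r b. \<forall>t. triangulates t \<longrightarrow> gkz_pairing \<psi> t = r * gkz_pairing (weight c) t + b" by blast
  qed
  assume "has_opposite_facets (Ass_I n q Q f)"
  then obtain c x y where xy: "x \<in> convex hull G" "y \<in> convex hull G" "c \<bullet> x \<noteq> c \<bullet> y"
    and c: "facet_functional (convex hull G) c" "facet_functional (convex hull G) (- c)"
    unfolding has_opposite_facets_def Ass by blast
  obtain t0 where t0: "triangulates t0" using regular_exists by blast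
  define k0 where "k0 = gkz_pairing (weight c) t0"
  have "\<not> (\<forall>t. triangulates t \<longrightarrow> gkz_pairing (weight c) t = k0)"
  proof
    assume const: "\<forall>t. triangulates t \<longrightarrow> gkz_pairing (weight c) t = k0"
    have aff: "affine_functional (\<lambda>y. c \<bullet> y - k0)"
      unfolding affine_functional_def by (rule exI[of _ c], rule exI[of _ "- k0"]) simp
    have G0: "c \<bullet> g - k0 = 0" if g: "g \<in> G" for g
    proof -
      from g[unfolded G_def] obtain t where t': "g = GKZ_vector N q f t" "t \<in> {t. triangulates t}"
        by (rule imageE)
      then have t: "triangulates t" "g = GKZ_vector N q f t" by auto
      have "gkz_pairing (weight c) t = k0" using const t(1) by simp
      then show ?thesis using pair[OF t(1) weight] t(2) by simp
    qed
    have "c \<bullet> x - k0 = 0" "c \<bullet> y - k0 = 0"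
      using affine_functional_zero_hull[OF aff G0] xy(1,2) by blast+
    then show False using xy(3) by simp
  qed
  then obtain t1 where t1: "triangulates t1" "gkz_pairing (weight c) t1 \<noteq> k0" by blast
  have "weight (- c) = (\<lambda>v. - weight c v)" by (simp add: weight_def fun_eq_iff)
  then have "facet_direction (\<lambda>v. - weight c v)" using dir[OF c(2)] by simp
  moreover have "5 \<le> card V" using n cardV by (simp add: N_def)
  ultimately show False using no_opposite_facets[OF _ t1(1) t0 t1(2)[unfolded k0_def] dir[OF c(1)]] by blast
qed

section \<open>Parallel facets of the Minkowski sum of simplices\<close>

lemma Ass_III_altdef:
  fixes e :: "nat \<Rightarrow> 'a::euclidean_space"
  assumes J_def: "J = {(i, j). 1 \<le> i \<and> i \<le> j \<and> j \<le> n + 1}"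
  shows "finite J" "Ass_III n e a =
     {\<Sum>ij\<in>J. a (fst ij) (snd ij) *\<^sub>R y ij | y. \<forall>ij\<in>J. y ij \<in> convex hull (e ` {fst ij..snd ij})}"
proof -
  show fin: "finite J"
    by (rule finite_subset[of _ "{1..n+1} \<times> {1..n+1}"]) (auto simp: J_def)
  let ?S = "\<lambda>ij. (\<lambda>x. a (fst ij) (snd ij) *\<^sub>R x) ` (convex hull (e ` {fst ij..snd ij}))"
  have "Ass_III n e a = sum ?S J"
    unfolding Ass_III_def J_def by (simp add: case_prod_unfold)
  also have "\<dots> = {sum s J | s. \<forall>ij\<in>J. s ij \<in> ?S ij}" by (rule set_sum_alt[OF fin])
  also have "\<dots> = {\<Sum>ij\<in>J. a (fst ij) (snd ij) *\<^sub>R y ij | y. \<forall>ij\<in>J. y ij \<in> convex hull (e ` {fst ij..snd ij})}"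
    (is "?L = ?R")
  proof
    show "?L \<subseteq> ?R"
    proof
      fix x assume "x \<in> ?L"
      then obtain s where s: "x = sum s J" "\<forall>ij\<in>J. s ij \<in> ?S ij" by blast
      then have "\<forall>ij\<in>J. \<exists>z. z \<in> convex hull (e ` {fst ij..snd ij}) \<and> s ij = a (fst ij) (snd ij) *\<^sub>R z" by blast
      then obtain y where "\<forall>ij\<in>J. y ij \<in> convex hull (e ` {fst ij..snd ij}) \<and> s ij = a (fst ij) (snd ij) *\<^sub>R y ij"
        by (auto dest!: bchoice)
      then show "x \<in> ?R" using s(1) by (intro CollectI exI[of _ y]) auto
    qed
    show "?R \<subseteq> ?L" by blast
  qed
  finally show "Ass_III n e a =
     {\<Sum>ij\<in>J. a (fst ij) (snd ij) *\<^sub>R y ij | y. \<forall>ij\<in>J. y ij \<in> convex hull (e ` {fst ij..snd ij})}" .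
qed

text \<open>
  Choosing the vertex \<open>e i\<close>, respectively \<open>e j\<close>, in each summand \<open>\<Delta>\<^bsub>[i,\<dots>,j]\<^esub>\<close> yields a point of the
  Minkowski sum with maximal, respectively minimal, first coordinate. In the summand with \<open>i = 2\<close>
  and \<open>j = n + 1\<close> every vertex may be chosen instead. So a functional that is constant on one of these two
  faces has the same value at \<open>e 2, \<dots>, e (n + 1)\<close>, and since the coordinate sum is constant on the
  polytope, it is an affine function of the first coordinate.
\<close>

lemma Ass_III_has_opposite_facets:
  fixes e :: "nat \<Rightarrow> 'a::euclidean_space"
  assumes n: "n \<ge> 1" and e: "standard_basis (n + 1) e"
    and pos: "\<And>i j. 1 \<le> i \<Longrightarrow> i \<le> j \<Longrightarrow> j \<le> n + 1 \<Longrightarrow> a i j > 0"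
  shows "has_opposite_facets (Ass_III n e a)"
proof -
  define J where "J = {(i, j). 1 \<le> i \<and> i \<le> j \<and> j \<le> n + 1}"
  define A where "A ij = a (fst ij) (snd ij)" for ij
  let ?P = "Ass_III n e a"
  have fin: "finite J" by (rule Ass_III_altdef(1)[OF J_def])
  have P: "?P = {\<Sum>ij\<in>J. A ij *\<^sub>R y ij | y. \<forall>ij\<in>J. y ij \<in> convex hull (e ` {fst ij..snd ij})}"
    unfolding A_def by (rule Ass_III_altdef(2)[OF J_def])
  have J: "1 \<le> fst ij" "fst ij \<le> snd ij" "snd ij \<le> n + 1" if "ij \<in> J" for ij
    using that by (auto simp: J_def)
  have A: "A ij > 0" if "ij \<in> J" for ij unfolding A_def by (rule pos[OF J[OF that]])
  define vertex where "vertex \<phi> = (\<Sum>ij\<in>J. A ij *\<^sub>R e (\<phi> ij))" for \<phi>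
  have vertex: "vertex \<phi> \<in> ?P" if "\<And>ij. ij \<in> J \<Longrightarrow> \<phi> ij \<in> {fst ij..snd ij}" for \<phi>
    unfolding P vertex_def using that by (intro CollectI exI[of _ "\<lambda>ij. e (\<phi> ij)"]) (auto intro: hull_inc)
  have ee: "e 1 \<bullet> e k = (if k = 1 then 1 else 0)" if "1 \<le> k" "k \<le> n + 1" for k
    using standard_basis_inner[OF e, of 1 k] that n by auto
  have hull_ge: "l y \<ge> 0" if "affine_functional l" "\<And>k. i \<le> k \<Longrightarrow> k \<le> j \<Longrightarrow> l (e k) \<ge> 0" "y \<in> convex hull (e ` {i..j})" for l y i j
    by (rule affine_functional_nonneg_hull[OF that(1) _ that(3)]) (use that(2) in auto)
  have aff: "affine_functional (\<lambda>y. c \<bullet> y + k)" for c :: 'a and k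
    unfolding affine_functional_def by blast
  have upper: "e 1 \<bullet> y \<le> e 1 \<bullet> e (fst ij)" and lower: "e 1 \<bullet> y \<ge> e 1 \<bullet> e (snd ij)"
    if ij: "ij \<in> J" and y: "y \<in> convex hull (e ` {fst ij..snd ij})" for ij y
  proof -
    have "(- e 1) \<bullet> y + e 1 \<bullet> e (fst ij) \<ge> 0"
      by (rule hull_ge[OF aff _ y]) (use ee J[OF ij] in auto)
    then show "e 1 \<bullet> y \<le> e 1 \<bullet> e (fst ij)" by simp
    have "e 1 \<bullet> y + - (e 1 \<bullet> e (snd ij)) \<ge> 0"
      by (rule hull_ge[OF aff _ y]) (use ee J[OF ij] in auto)
    then show "e 1 \<bullet> y \<ge> e 1 \<bullet> e (snd ij)" by simp
  qed
  have inner_vertex: "c \<bullet> vertex \<phi> = (\<Sum>ij\<in>J. A ij * (c \<bullet> e (\<phi> ij)))" for c \<phi>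
    by (simp add: vertex_def inner_sum_right)
  have maximal: "e 1 \<bullet> x \<le> e 1 \<bullet> vertex fst" and minimal: "e 1 \<bullet> vertex snd \<le> e 1 \<bullet> x" if "x \<in> ?P" for x
  proof -
    from that obtain y where y: "x = (\<Sum>ij\<in>J. A ij *\<^sub>R y ij)"
        "\<And>ij. ij \<in> J \<Longrightarrow> y ij \<in> convex hull (e ` {fst ij..snd ij})"
      unfolding P by blast
    have x: "e 1 \<bullet> x = (\<Sum>ij\<in>J. A ij * (e 1 \<bullet> y ij))" by (simp add: y(1) inner_sum_right)
    show "e 1 \<bullet> x \<le> e 1 \<bullet> vertex fst" unfolding x inner_vertex
      using upper y(2) A by (intro sum_mono mult_left_mono) (auto simp: less_imp_le)
    show "e 1 \<bullet> vertex snd \<le> e 1 \<bullet> x" unfolding x inner_vertex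
      using lower y(2) A by (intro sum_mono mult_left_mono) (auto simp: less_imp_le)
  qed
  have top: "(2, n + 1) \<in> J" "(1, 2) \<in> J" using n by (auto simp: J_def)
  have moved: "c \<bullet> vertex (\<phi>((2, n + 1) := k)) - c \<bullet> vertex \<phi> = A (2, n + 1) * (c \<bullet> e k - c \<bullet> e (\<phi> (2, n + 1)))" for c \<phi> k
    unfolding inner_vertex sum.remove[OF fin top(1)] by (simp add: right_diff_distrib)
  have facet: "facet_functional ?P c"
    if c: "c = e 1 \<or> c = - e 1"
      and \<phi>: "\<And>ij. ij \<in> J \<Longrightarrow> \<phi> ij \<in> {fst ij..snd ij}" and max: "\<And>x. x \<in> ?P \<Longrightarrow> c \<bullet> x \<le> c \<bullet> vertex \<phi>" for c \<phi>
    unfolding facet_functional_def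
  proof (intro allI impI)
    fix d k assume d: "\<forall>x\<in>?P. (\<forall>y\<in>?P. c \<bullet> y \<le> c \<bullet> x) \<longrightarrow> d \<bullet> x = k"
    have eq: "d \<bullet> e m = d \<bullet> e (\<phi> (2, n + 1))" if m: "2 \<le> m" "m \<le> n + 1" for m
    proof -
      let ?x = "vertex (\<phi>((2, n + 1) := m))"
      have "c \<bullet> e m = 0" "c \<bullet> e (\<phi> (2, n + 1)) = 0" using c ee m \<phi>[OF top(1)] by auto
      then have cx: "c \<bullet> ?x = c \<bullet> vertex \<phi>" using moved[of c \<phi> m] by simp
      have xP: "?x \<in> ?P" using \<phi> m by (intro vertex) auto
      have "d \<bullet> ?x = k" using d xP max cx by auto
      moreover have "d \<bullet> vertex \<phi> = k" using d vertex[OF \<phi>] max by auto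
      ultimately show ?thesis using moved[of d \<phi> m] A[OF top(1)] by simp
    qed
    define \<delta> where "\<delta> = d \<bullet> e (\<phi> (2, n + 1))"
    define r where "r = d \<bullet> e 1 - \<delta>"
    have on_simplex: "d \<bullet> y = \<delta> + r * (e 1 \<bullet> y)"
      if ij: "ij \<in> J" and y: "y \<in> convex hull (e ` {fst ij..snd ij})" for ij y
    proof -
      have "(d - r *\<^sub>R e 1) \<bullet> y + (- \<delta>) = 0"
      proof (rule affine_functional_zero_hull[OF aff _ y])
        fix z assume "z \<in> e ` {fst ij..snd ij}"
        then obtain m where m: "z = e m" "1 \<le> m" "m \<le> n + 1" using J[OF ij] by auto
        show "(d - r *\<^sub>R e 1) \<bullet> z + (- \<delta>) = 0"
        proof (cases "m = 1")
          case True
          then show ?thesis using m ee[of 1] n by (simp add: inner_diff_left r_def)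
        next
          case False
          then show ?thesis using m ee[of m] eq[of m] by (simp add: inner_diff_left \<delta>_def)
        qed
      qed
      then show ?thesis by (simp add: inner_diff_left)
    qed
    have "d \<bullet> x = r * (e 1 \<bullet> x) + \<delta> * sum A J" if x: "x \<in> ?P" for x
    proof -
      obtain y where y: "x = (\<Sum>ij\<in>J. A ij *\<^sub>R y ij)" "\<And>ij. ij \<in> J \<Longrightarrow> y ij \<in> convex hull (e ` {fst ij..snd ij})"
        using x unfolding P by blast
      have "d \<bullet> x = (\<Sum>ij\<in>J. A ij * (\<delta> + r * (e 1 \<bullet> y ij)))"
        unfolding y(1) inner_sum_right using on_simplex y(2) by (intro sum.cong) auto
      also have "\<dots> = r * (e 1 \<bullet> x) + \<delta> * sum A J"
        unfolding y(1) inner_sum_right sum_distrib_left sum.distrib[symmetric]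
        by (intro sum.cong) (auto simp: algebra_simps)
      finally show ?thesis .
    qed
    then show "\<exists>r b. \<forall>x\<in>?P. d \<bullet> x = r * (c \<bullet> x) + b"
    proof -
      assume *: "\<And>x. x \<in> ?P \<Longrightarrow> d \<bullet> x = r * (e 1 \<bullet> x) + \<delta> * sum A J"
      from c show ?thesis
      proof
        assume "c = e 1"
        then show ?thesis using * by blast
      next
        assume "c = - e 1"
        then show ?thesis using * by (intro exI[of _ "- r"] exI[of _ "\<delta> * sum A J"]) simp
      qed
    qed
  qed
  have inJ: "fst ij \<in> {fst ij..snd ij}" "snd ij \<in> {fst ij..snd ij}" if "ij \<in> J" for ij
    using J[OF that] by auto
  have f1: "facet_functional ?P (e 1)"
    by (rule facet[where \<phi> = fst]) (use inJ maximal in auto)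
  have f2: "facet_functional ?P (- e 1)"
    by (rule facet[where \<phi> = snd]) (use inJ minimal in auto)
  have "e 1 \<bullet> vertex snd < e 1 \<bullet> vertex fst"
    unfolding inner_vertex
  proof (rule sum_strict_mono_ex1[OF fin])
    show "\<forall>ij\<in>J. A ij * (e 1 \<bullet> e (snd ij)) \<le> A ij * (e 1 \<bullet> e (fst ij))"
      using upper[OF _ hull_inc] inJ A by (auto intro!: mult_left_mono simp: less_imp_le)
    show "\<exists>ij\<in>J. A ij * (e 1 \<bullet> e (snd ij)) < A ij * (e 1 \<bullet> e (fst ij))"
      using top(2) A[OF top(2)] ee[of 1] ee[of 2] n by (intro bexI[of _ "(1, 2)"]) auto
  qed
  then have "\<exists>x\<in>?P. \<exists>y\<in>?P. e 1 \<bullet> x \<noteq> e 1 \<bullet> y"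
    using vertex[of fst] vertex[of snd] inJ by (intro bexI[of _ "vertex fst"] bexI[of _ "vertex snd"]) auto
  then show ?thesis using f1 f2 unfolding has_opposite_facets_def by blast
qed

section \<open>Parallel facets of the cluster fan\<close>

text \<open>
  The vertices \<open>n + 3, 1, n + 2, 2, n + 1, \<dots>\<close> of the polygon in the order in which the snake passes
  them, extended by a polygon edge at both ends. In this order the \<open>k\<close>-th snake diagonal
  joins the positions \<open>k\<close> and \<open>k + 1\<close> and separates the positions before it from those after it.
\<close>

definition zigzag :: "nat \<Rightarrow> nat \<Rightarrow> nat" where
  "zigzag n k = (if even k then n + 3 - k div 2 else (k + 1) div 2)"

lemma zigzag_bij: "bij_betw (zigzag n) {0..n + 2} {1..n + 3}"
proof -
  have inj: "inj_on (zigzag n) {0..n + 2}"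
  proof (rule inj_onI)
    fix x y assume xy: "x \<in> {0..n + 2}" "y \<in> {0..n + 2}" "zigzag n x = zigzag n y"
    then show "x = y"
      by (cases "even x"; cases "even y") (auto simp: zigzag_def elim!: evenE oddE)
  qed
  moreover have sub: "zigzag n ` {0..n + 2} \<subseteq> {1..n + 3}"
    by (auto simp: zigzag_def elim!: evenE oddE)
  moreover have "zigzag n ` {0..n + 2} = {1..n + 3}"
    by (rule card_subset_eq) (use sub card_image[OF inj] in auto)
  ultimately show ?thesis unfolding bij_betw_def by blast
qed

lemma zigzag_range: "k \<le> n + 2 \<Longrightarrow> 1 \<le> zigzag n k \<and> zigzag n k \<le> n + 3"
  using bij_betw_apply[OF zigzag_bij, of k n] by auto

lemma zigzag_eq_iff: "x \<le> n + 2 \<Longrightarrow> y \<le> n + 2 \<Longrightarrow> zigzag n x = zigzag n y \<longleftrightarrow> x = y"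
  using inj_on_eq_iff[OF bij_betw_imp_inj_on[OF zigzag_bij]] by simp

lemma snake_diagonal_zigzag:
  assumes "1 \<le> k"
  shows "snake_diagonal n k = {zigzag n k, zigzag n (k + 1)}"
  using assms by (auto simp: snake_diagonal_def zigzag_def elim!: evenE oddE)

lemma crossing_sym: "crossing D D' \<longleftrightarrow> crossing D' D"
  unfolding crossing_def by blast

lemma crossing_separates:
  assumes "x \<noteq> y" "lo < hi"
  shows "crossing {x, y} {lo, hi} \<longleftrightarrow>
    (lo < x \<and> x < hi \<and> (y < lo \<or> hi < y)) \<or> (lo < y \<and> y < hi \<and> (x < lo \<or> hi < x))"
    (is "_ \<longleftrightarrow> ?R")
proof
  assume "crossing {x, y} {lo, hi}"
  then show ?R using assms(2) unfolding crossing_def doubleton_eq_iff by auto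
next
  assume ?R
  then consider "lo < x" "x < hi" "hi < y" | "y < lo" "lo < x" "x < hi"
    | "lo < y" "y < hi" "hi < x" | "x < lo" "lo < y" "y < hi" by blast
  then show "crossing {x, y} {lo, hi}"
  proof cases
    case 1
    show ?thesis unfolding crossing_def
      by (rule exI[of _ lo], rule exI[of _ x], rule exI[of _ hi], rule exI[of _ y]) (use 1 in auto)
  next
    case 2
    show ?thesis unfolding crossing_def
      by (rule exI[of _ y], rule exI[of _ lo], rule exI[of _ x], rule exI[of _ hi]) (use 2 in auto)
  next
    case 3
    show ?thesis unfolding crossing_def
      by (rule exI[of _ lo], rule exI[of _ y], rule exI[of _ hi], rule exI[of _ x]) (use 3 in auto)
  next
    case 4
    show ?thesis unfolding crossing_def
      by (rule exI[of _ x], rule exI[of _ lo], rule exI[of _ y], rule exI[of _ hi]) (use 4 in auto)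
  qed
qed

lemma crossing_imp_diagonal:
  assumes "{x, y} \<subseteq> {1..N}" "D \<subseteq> {1..N}" "crossing {x, y} D"
  shows "{x, y} \<in> diagonals N"
proof -
  obtain a b c d where "a < b" "b < c" "c < d"
    and "({x, y} = {a, c} \<and> D = {b, d}) \<or> ({x, y} = {b, d} \<and> D = {a, c})"
    using assms(3) unfolding crossing_def by blast
  then have "\<exists>k l. {x, y} = {k, l} \<and> k + 2 \<le> l \<and> \<not> (k = 1 \<and> l = N) \<and> 1 \<le> k \<and> l \<le> N"
  proof (elim disjE)
    assume h: "{x, y} = {a, c} \<and> D = {b, d}"
    then have "1 \<le> a" "d \<le> N" using assms by auto
    with h \<open>a < b\<close> \<open>b < c\<close> \<open>c < d\<close> show ?thesis by (intro exI[of _ a] exI[of _ c]) auto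
  next
    assume h: "{x, y} = {b, d} \<and> D = {a, c}"
    then have "1 \<le> a" "d \<le> N" using assms by auto
    with h \<open>a < b\<close> \<open>b < c\<close> \<open>c < d\<close> show ?thesis by (intro exI[of _ b] exI[of _ d]) auto
  qed
  then obtain k l where "{x, y} = {k, l}" "1 \<le> k" "k + 2 \<le> l" "l \<le> N" "\<not> (k = 1 \<and> l = N)"
    by auto
  then show ?thesis unfolding diagonals_def by (intro CollectI exI conjI)
qed

lemma zigzag_position:
  assumes k: "1 \<le> k" "k \<le> n" and m: "m \<le> n + 2"
  defines "lo \<equiv> min (zigzag n k) (zigzag n (k + 1))" and "hi \<equiv> max (zigzag n k) (zigzag n (k + 1))"
  shows "lo < zigzag n m \<and> zigzag n m < hi \<longleftrightarrow> k + 1 < m"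
    and "zigzag n m < lo \<or> hi < zigzag n m \<longleftrightarrow> m < k"
proof -
  have pos: "k + 1 < m \<Longrightarrow> lo < zigzag n m \<and> zigzag n m < hi"
    "m < k \<Longrightarrow> zigzag n m < lo \<or> hi < zigzag n m"
    using k m unfolding lo_def hi_def zigzag_def
    by (cases "even k"; cases "even m"; auto simp: min_def max_def elim!: evenE oddE)+
  have eq: "m = k \<or> m = k + 1 \<Longrightarrow> zigzag n m = lo \<or> zigzag n m = hi"
    unfolding lo_def hi_def by (auto simp: min_def max_def)
  have lh: "lo \<le> hi" unfolding lo_def hi_def by simp
  consider "k + 1 < m" | "m < k" | "m = k \<or> m = k + 1" by linarith
  then have "(lo < zigzag n m \<and> zigzag n m < hi \<longleftrightarrow> k + 1 < m) \<and>
    (zigzag n m < lo \<or> hi < zigzag n m \<longleftrightarrow> m < k)"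
  proof cases
    case 1
    then show ?thesis using pos(1) by auto
  next
    case 2
    then show ?thesis using pos(2) by auto
  next
    case 3
    then show ?thesis using eq lh by auto
  qed
  then show "lo < zigzag n m \<and> zigzag n m < hi \<longleftrightarrow> k + 1 < m"
    and "zigzag n m < lo \<or> hi < zigzag n m \<longleftrightarrow> m < k" by blast+
qed

lemma crossing_snake_iff:
  assumes ab: "a < b" "b \<le> n + 2" and k: "1 \<le> k" "k \<le> n"
  shows "crossing {zigzag n a, zigzag n b} (snake_diagonal n k) \<longleftrightarrow> a < k \<and> k + 1 < b"
proof -
  define lo where "lo = min (zigzag n k) (zigzag n (k + 1))"
  define hi where "hi = max (zigzag n k) (zigzag n (k + 1))"
  have ne: "zigzag n k \<noteq> zigzag n (k + 1)" "zigzag n a \<noteq> zigzag n b"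
    using zigzag_eq_iff[of k n "k + 1"] zigzag_eq_iff[of a n b] ab k by auto
  have s: "snake_diagonal n k = {lo, hi}" "lo < hi"
    using snake_diagonal_zigzag[OF k(1), of n] ne(1) by (auto simp: lo_def hi_def min_def max_def)
  have "a \<le> n + 2" using ab by simp
  note A = zigzag_position[OF k this, folded lo_def hi_def]
  note B = zigzag_position[OF k ab(2), folded lo_def hi_def]
  show ?thesis unfolding s(1) crossing_separates[OF ne(2) s(2)]
    using A B ab by (smt (verit) less_trans not_less_iff_gr_or_eq less_add_one add_lessD1)
qed

lemma snakes_do_not_cross:
  assumes "1 \<le> j" "j \<le> n" "1 \<le> k" "k \<le> n"
  shows "\<not> crossing (snake_diagonal n j) (snake_diagonal n k)"
  using crossing_snake_iff[of j "j + 1" n k] assms snake_diagonal_zigzag[of j n] by simp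

lemma snake_subset: "1 \<le> k \<Longrightarrow> k \<le> n \<Longrightarrow> snake_diagonal n k \<subseteq> {1..n + 3}"
  using zigzag_range[of k n] zigzag_range[of "k + 1" n] by (simp add: snake_diagonal_zigzag)

lemma snake_in_diagonals:
  assumes "1 \<le> k" "k \<le> n"
  shows "snake_diagonal n k \<in> diagonals (n + 3)"
proof -
  have "crossing {zigzag n (k - 1), zigzag n (k + 2)} (snake_diagonal n k)"
    using crossing_snake_iff[of "k - 1" "k + 2" n k] assms by simp
  then have "crossing {zigzag n k, zigzag n (k + 1)} {zigzag n (k - 1), zigzag n (k + 2)}"
    using crossing_sym snake_diagonal_zigzag[OF assms(1), of n] by metis
  moreover have "{zigzag n k, zigzag n (k + 1)} \<subseteq> {1..n + 3}" "{zigzag n (k - 1), zigzag n (k + 2)} \<subseteq> {1..n + 3}"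
    using zigzag_range[of k n] zigzag_range[of "k + 1" n] zigzag_range[of "k - 1" n] zigzag_range[of "k + 2" n] assms
    by auto
  ultimately have "{zigzag n k, zigzag n (k + 1)} \<in> diagonals (n + 3)" using crossing_imp_diagonal by blast
  then show ?thesis using snake_diagonal_zigzag[OF assms(1), of n] by simp
qed

lemma crossing_set_zigzag:
  assumes "a < b" "b \<le> n + 2"
  shows "{k \<in> {1..n}. crossing {zigzag n a, zigzag n b} (snake_diagonal n k)} = {a + 1..<b - 1}"
  using crossing_snake_iff[OF assms] assms by auto

text \<open>
  The diagonal between the positions \<open>a < b\<close> of the snake crosses exactly the snake diagonals \<open>a + 1, \<dots>, b - 2\<close>.
\<close>

lemma interval_diagonal_unique:
  assumes ij: "1 \<le> i" "i \<le> j" "j \<le> n"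
  shows "D \<in> diagonals (n + 3) \<and> {k \<in> {1..n}. crossing D (snake_diagonal n k)} = {i..j} \<longleftrightarrow>
    D = {zigzag n (i - 1), zigzag n (j + 2)}"
proof
  assume D: "D = {zigzag n (i - 1), zigzag n (j + 2)}"
  have "{k \<in> {1..n}. crossing D (snake_diagonal n k)} = {i - 1 + 1..<j + 2 - 1}"
    unfolding D using ij by (intro crossing_set_zigzag) auto
  also have "\<dots> = {i..j}" using ij by auto
  finally have c: "{k \<in> {1..n}. crossing D (snake_diagonal n k)} = {i..j}" .
  then have "i \<in> {k \<in> {1..n}. crossing D (snake_diagonal n k)}" using ij by simp
  then have "crossing D (snake_diagonal n i)" by simp
  moreover have "D \<subseteq> {1..n + 3}"
    unfolding D using zigzag_range[of "i - 1" n] zigzag_range[of "j + 2" n] ij by auto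
  ultimately have "D \<in> diagonals (n + 3)"
    unfolding D using crossing_imp_diagonal[OF _ snake_subset[of i n]] ij by auto
  then show "D \<in> diagonals (n + 3) \<and> {k \<in> {1..n}. crossing D (snake_diagonal n k)} = {i..j}" using c by blast
next
  assume D: "D \<in> diagonals (n + 3) \<and> {k \<in> {1..n}. crossing D (snake_diagonal n k)} = {i..j}"
  then obtain x y where xy: "D = {x, y}" "x \<in> {1..n + 3}" "y \<in> {1..n + 3}" "x \<noteq> y"
    unfolding diagonals_def by force
  have img: "zigzag n ` {0..n + 2} = {1..n + 3}" using zigzag_bij unfolding bij_betw_def by blast
  obtain a b where "a \<le> n + 2" "b \<le> n + 2" "x = zigzag n a" "y = zigzag n b"
    using xy(2,3) unfolding img[symmetric] by auto
  then have "\<exists>a b. a < b \<and> b \<le> n + 2 \<and> D = {zigzag n a, zigzag n b}"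
    using xy(1,4) by (metis insert_commute linorder_neqE_nat)
  then obtain a b where ab: "a < b" "b \<le> n + 2" "D = {zigzag n a, zigzag n b}" by blast
  have "{a + 1..<b - 1} = {i..j}" using D crossing_set_zigzag[OF ab(1,2)] unfolding ab(3) by simp
  then have "{a + 1..<b - 1} = {i..<j + 1}" by (simp add: atLeastLessThanSuc_atLeastAtMost)
  then have "a + 1 = i" "b - 1 = j + 1"
    using ij atLeastLessThan_eq_iff[of i "j + 1" "a + 1" "b - 1"] atLeastLessThan_empty_iff[of "a + 1" "b - 1"]
    by (metis atLeastLessThan_eq_iff atLeastLessThan_empty_iff2 le_imp_less_Suc Suc_eq_plus1 atLeastLessThan_empty_iff)+
  then have "a = i - 1" "b = j + 2" using ab by auto
  then show "D = {zigzag n (i - 1), zigzag n (j + 2)}" using ab(3) by simp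
qed

lemma positive_root_eq: "i \<le> j \<Longrightarrow> positive_root e i j = e i - e (Suc j)"
  unfolding positive_root_def simple_root_def
  by (induction j rule: dec_induct) simp_all

locale type_A_roots =
  fixes n :: nat and e :: "nat \<Rightarrow> 'a::euclidean_space"
  assumes basis: "standard_basis (n + 1) e"
begin

lemma e_inner: "1 \<le> i \<Longrightarrow> i \<le> n + 1 \<Longrightarrow> 1 \<le> j \<Longrightarrow> j \<le> n + 1 \<Longrightarrow> e i \<bullet> e j = (if i = j then 1 else 0)"
  using standard_basis_inner[OF basis] by simp

lemma root_difference_inj:
  assumes "i \<noteq> j" "i' \<noteq> j'" "{i, j, i', j'} \<subseteq> {1..n + 1}" "e i - e j = e i' - e j'"
  shows "i = i' \<and> j = j'"
proof -
  have r: "1 \<le> i" "i \<le> n + 1" "1 \<le> j" "j \<le> n + 1" "1 \<le> i'" "i' \<le> n + 1" "1 \<le> j'" "j' \<le> n + 1"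
    using assms(3) by auto
  have "(e i - e j) \<bullet> e i = (e i' - e j') \<bullet> e i" "(e i - e j) \<bullet> e j = (e i' - e j') \<bullet> e j"
    using assms(4) by simp_all
  then show ?thesis using assms(1,2) r by (auto simp: inner_diff_left e_inner split: if_splits)
qed

lemma positive_root_inj:
  assumes "1 \<le> i" "i \<le> j" "j \<le> n" "1 \<le> i'" "i' \<le> j'" "j' \<le> n"
  shows "positive_root e i j = positive_root e i' j' \<longleftrightarrow> i = i' \<and> j = j'"
  using root_difference_inj[of i "Suc j" i' "Suc j'"] assms by (auto simp: positive_root_eq)

lemma simple_root_inj:
  assumes "1 \<le> i" "i \<le> n" "1 \<le> j" "j \<le> n"
  shows "simple_root e i = simple_root e j \<longleftrightarrow> i = j"
  using root_difference_inj[of i "Suc i" j "Suc j"] assms by (auto simp: simple_root_def)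

lemma negative_not_positive:
  assumes "1 \<le> k" "k \<le> n" "1 \<le> i" "i \<le> j" "j \<le> n"
  shows "- simple_root e k \<noteq> positive_root e i j"
  using root_difference_inj[of "Suc k" k i "Suc j"] assms by (auto simp: positive_root_eq simple_root_def)

lemma root_diagonal_negative:
  assumes "1 \<le> k" "k \<le> n"
  shows "root_diagonal n e (- simple_root e k) = snake_diagonal n k"
  unfolding root_diagonal_def
proof (rule the_equality)
  show "snake_diagonal n k \<in> diagonals (n + 3) \<and>
    ((\<exists>i\<in>{1..n}. - simple_root e k = - simple_root e i \<and> snake_diagonal n k = snake_diagonal n i) \<or>
     (\<exists>i j. 1 \<le> i \<and> i \<le> j \<and> j \<le> n \<and> - simple_root e k = positive_root e i j \<and>
         {ka \<in> {1..n}. crossing (snake_diagonal n k) (snake_diagonal n ka)} = {i..j}))"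
    using snake_in_diagonals[OF assms] assms by auto
next
  fix D assume "D \<in> diagonals (n + 3) \<and>
    ((\<exists>i\<in>{1..n}. - simple_root e k = - simple_root e i \<and> D = snake_diagonal n i) \<or>
     (\<exists>i j. 1 \<le> i \<and> i \<le> j \<and> j \<le> n \<and> - simple_root e k = positive_root e i j \<and>
         {k \<in> {1..n}. crossing D (snake_diagonal n k)} = {i..j}))"
  then show "D = snake_diagonal n k"
    using negative_not_positive[OF assms] simple_root_inj[OF assms] by fastforce
qed

lemma root_diagonal_positive:
  assumes ij: "1 \<le> i" "i \<le> j" "j \<le> n"
  shows "root_diagonal n e (positive_root e i j) = {zigzag n (i - 1), zigzag n (j + 2)}"
  unfolding root_diagonal_def
proof (rule the_equality)
  show "{zigzag n (i - 1), zigzag n (j + 2)} \<in> diagonals (n + 3) \<and>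
    ((\<exists>k\<in>{1..n}. positive_root e i j = - simple_root e k \<and> {zigzag n (i - 1), zigzag n (j + 2)} = snake_diagonal n k) \<or>
     (\<exists>i' j'. 1 \<le> i' \<and> i' \<le> j' \<and> j' \<le> n \<and> positive_root e i j = positive_root e i' j' \<and>
         {k \<in> {1..n}. crossing {zigzag n (i - 1), zigzag n (j + 2)} (snake_diagonal n k)} = {i'..j'}))"
    using interval_diagonal_unique[OF ij, of "{zigzag n (i - 1), zigzag n (j + 2)}"] ij by blast
next
  fix D assume D: "D \<in> diagonals (n + 3) \<and>
    ((\<exists>k\<in>{1..n}. positive_root e i j = - simple_root e k \<and> D = snake_diagonal n k) \<or>
     (\<exists>i' j'. 1 \<le> i' \<and> i' \<le> j' \<and> j' \<le> n \<and> positive_root e i j = positive_root e i' j' \<and>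
         {k \<in> {1..n}. crossing D (snake_diagonal n k)} = {i'..j'}))"
  have "positive_root e i j \<noteq> - simple_root e k" if "k \<in> {1..n}" for k
    using negative_not_positive[of k i j] that ij by auto
  then obtain i' j' where "1 \<le> i'" "i' \<le> j'" "j' \<le> n" "positive_root e i j = positive_root e i' j'"
    "{k \<in> {1..n}. crossing D (snake_diagonal n k)} = {i'..j'}" using D by blast
  then have "{k \<in> {1..n}. crossing D (snake_diagonal n k)} = {i..j}"
    using positive_root_inj[OF ij, of i' j'] by simp
  then show "D = {zigzag n (i - 1), zigzag n (j + 2)}" using interval_diagonal_unique[OF ij, of D] D by blast
qed

lemma positive_crosses_negative:
  assumes "1 \<le> i" "i \<le> j" "j \<le> n" "1 \<le> k" "k \<le> n"
  shows "crossing (root_diagonal n e (positive_root e i j)) (root_diagonal n e (- simple_root e k)) \<longleftrightarrow>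
    i \<le> k \<and> k \<le> j"
  using crossing_snake_iff[of "i - 1" "j + 2" n k] assms
  by (auto simp: root_diagonal_positive root_diagonal_negative)

text \<open>
  For \<open>\<theta> = - \<alpha>\<^sub>1\<close> this is the cluster of all negative simple roots, and for \<open>\<theta> = \<alpha>\<^sub>1\<close> the
  cluster obtained from it by exchanging one root.
\<close>

definition tail_cluster :: "'a \<Rightarrow> 'a set" where
  "tail_cluster \<theta> = insert \<theta> {- simple_root e k | k. 2 \<le> k \<and> k \<le> n}"

lemma positive_root_simple: "positive_root e k k = simple_root e k"
  by (simp add: positive_root_def)

lemma almost_positive_cases:
  assumes "\<beta> \<in> almost_positive_roots n e"
  obtains k where "1 \<le> k" "k \<le> n" "\<beta> = - simple_root e k"
  | i j where "1 \<le> i" "i \<le> j" "j \<le> n" "\<beta> = positive_root e i j"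
  using assms unfolding almost_positive_roots_def by blast

text \<open>
  The root \<open>\<alpha>\<^sub>1\<close> is compatible with all negative simple roots but \<open>- \<alpha>\<^sub>1\<close>, and every other positive
  root is incompatible with some \<open>- \<alpha>\<^sub>k\<close> where \<open>k \<ge> 2\<close>.
\<close>

lemma tail_cluster_in_clusters:
  assumes n: "1 \<le> n" and \<theta>: "\<theta> = simple_root e 1 \<or> \<theta> = - simple_root e 1"
  shows "tail_cluster \<theta> \<in> clusters n e"
proof -
  let ?rd = "root_diagonal n e"
  have cross1: "crossing (?rd (simple_root e 1)) (?rd (- simple_root e k)) \<longleftrightarrow> k = 1" if "1 \<le> k" "k \<le> n" for k
    using positive_crosses_negative[of 1 1 k] that n by (simp add: positive_root_simple)
  have neg: "\<not> crossing (?rd (- simple_root e j)) (?rd (- simple_root e k))" if "1 \<le> j" "j \<le> n" "1 \<le> k" "k \<le> n" for j k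
    using snakes_do_not_cross[OF that] that by (simp add: root_diagonal_negative)
  have sub: "tail_cluster \<theta> \<subseteq> almost_positive_roots n e"
  proof
    fix \<beta> assume "\<beta> \<in> tail_cluster \<theta>"
    then have "\<beta> = \<theta> \<or> (\<exists>k. 2 \<le> k \<and> k \<le> n \<and> \<beta> = - simple_root e k)"
      unfolding tail_cluster_def by blast
    then have "\<beta> = positive_root e 1 1 \<or> (\<exists>k. 1 \<le> k \<and> k \<le> n \<and> \<beta> = - simple_root e k)"
    proof
      assume "\<beta> = \<theta>"
      then show ?thesis using \<theta> n positive_root_simple[of 1] by auto
    next
      assume "\<exists>k. 2 \<le> k \<and> k \<le> n \<and> \<beta> = - simple_root e k"
      then obtain k where "2 \<le> k" "k \<le> n" "\<beta> = - simple_root e k" by blast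
      then show ?thesis by (intro disjI2 exI[of _ k]) auto
    qed
    then consider "\<beta> = positive_root e 1 1" | k where "1 \<le> k" "k \<le> n" "\<beta> = - simple_root e k"
      by blast
    then show "\<beta> \<in> almost_positive_roots n e"
      using n unfolding almost_positive_roots_def by cases blast+
  qed
  have tail: "\<not> crossing (?rd \<theta>) (?rd (- simple_root e k))" if "2 \<le> k" "k \<le> n" for k
    using \<theta> cross1[of k] neg[of 1 k] that n by auto
  have comp: "compatible n e x y" if xy: "x \<in> tail_cluster \<theta>" "y \<in> tail_cluster \<theta>" "x \<noteq> y" for x y
  proof -
    consider "x = \<theta>" "\<exists>k. 2 \<le> k \<and> k \<le> n \<and> y = - simple_root e k"
      | "y = \<theta>" "\<exists>k. 2 \<le> k \<and> k \<le> n \<and> x = - simple_root e k"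
      | "\<exists>k. 2 \<le> k \<and> k \<le> n \<and> x = - simple_root e k" "\<exists>k. 2 \<le> k \<and> k \<le> n \<and> y = - simple_root e k"
      using xy unfolding tail_cluster_def by blast
    then show ?thesis unfolding compatible_def
    proof cases
      case 1
      then show "\<not> crossing (?rd x) (?rd y)" using tail by blast
    next
      case 2
      then show "\<not> crossing (?rd x) (?rd y)" using tail crossing_sym by blast
    next
      case 3
      then obtain j k where "2 \<le> j" "j \<le> n" "x = - simple_root e j" "2 \<le> k" "k \<le> n" "y = - simple_root e k"
        by blast
      then show "\<not> crossing (?rd x) (?rd y)" using neg[of j k] by auto
    qed
  qed
  have max: "C' = tail_cluster \<theta>"
    if C': "tail_cluster \<theta> \<subseteq> C'" "C' \<subseteq> almost_positive_roots n e" "pairwise (compatible n e) C'" for C'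
  proof
    show "C' \<subseteq> tail_cluster \<theta>"
    proof (rule subsetI, rule ccontr)
      fix \<beta> assume \<beta>: "\<beta> \<in> C'" "\<beta> \<notin> tail_cluster \<theta>"
      have nc: "\<not> crossing (?rd \<beta>) (?rd \<gamma>)" if "\<gamma> \<in> tail_cluster \<theta>" for \<gamma>
      proof -
        have "\<gamma> \<in> C'" "\<beta> \<noteq> \<gamma>" using C'(1) \<beta>(2) that by auto
        from pairwiseD[OF C'(3) \<beta>(1) this] show ?thesis by (simp add: compatible_def)
      qed
      have "\<beta> \<in> almost_positive_roots n e" using \<beta> C' by blast
      then show False
      proof (cases rule: almost_positive_cases)
        case (1 k)
        then have "k = 1" using \<beta>(2) unfolding tail_cluster_def by force
        then have "\<theta> = simple_root e 1" using 1 \<beta>(2) \<theta> unfolding tail_cluster_def by auto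
        then show False using nc[of \<theta>] cross1[of 1] n 1 \<open>k = 1\<close> crossing_sym
          unfolding tail_cluster_def by (metis insertI1 order_refl)
      next
        case (2 i j)
        show False
        proof (cases "2 \<le> j")
          case True
          then have "- simple_root e j \<in> tail_cluster \<theta>" using 2 unfolding tail_cluster_def by blast
          then show False using nc[of "- simple_root e j"] positive_crosses_negative[of i j j] 2 by auto
        next
          case False
          then have "i = 1" "j = 1" using 2 by auto
          then have b: "\<beta> = simple_root e 1" using 2 by (simp add: positive_root_simple)
          then have "\<theta> = - simple_root e 1" using \<beta>(2) \<theta> unfolding tail_cluster_def by auto
          then show False using nc[of \<theta>] cross1[of 1] n b unfolding tail_cluster_def by auto
        qed
      qed
    qed
  qed (rule C')
  show ?thesis unfolding clusters_def using sub comp max by (simp add: pairwise_def)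
qed

text \<open>
  The vector with coordinates \<open>2, 2, 3, 4, \<dots>\<close> is orthogonal to \<open>\<alpha>\<^sub>1\<close> and has positive inner products
  with \<open>- \<alpha>\<^sub>2, \<dots>, - \<alpha>\<^sub>n\<close>, so it exposes the ray as a face of the cone over the cluster.
\<close>

lemma tail_ray_in_cluster_fan:
  assumes n: "1 \<le> n" and \<theta>: "\<theta> = simple_root e 1 \<or> \<theta> = - simple_root e 1"
  shows "{r *\<^sub>R \<theta> | r. 0 \<le> r} \<in> cluster_fan n e"
proof -
  define B where "B = {- simple_root e k | k. 2 \<le> k \<and> k \<le> n}"
  define w where "w = (\<Sum>k=1..n + 1. real (max k 2) *\<^sub>R e k)"
  have w: "w \<bullet> e k = real (max k 2)" if "1 \<le> k" "k \<le> n + 1" for k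
    unfolding w_def using standard_basis_coefficient[OF basis, of k "\<lambda>k. real (max k 2)"] that by simp
  have w\<theta>: "w \<bullet> \<theta> = 0"
    using \<theta> w[of 1] w[of "Suc 1"] n by (auto simp: simple_root_def inner_diff_right)
  have wB: "w \<bullet> b > 0" if "b \<in> B" for b
    using that w by (auto simp: B_def simple_root_def inner_diff_right)
  have ray: "convex_cone hull {\<theta>} = {r *\<^sub>R \<theta> | r. 0 \<le> r}"
    by (auto simp: convex_cone_hull_convex_hull_nonempty)
  have "convex_cone ({y. w \<bullet> y > 0} \<union> {0})"
    unfolding convex_cone_iff by (auto simp: inner_add_right zero_less_mult_iff)
  then have tail: "convex_cone hull B \<subseteq> {y. w \<bullet> y > 0} \<union> {0}"
    using wB by (intro hull_minimal) auto
  have T: "tail_cluster \<theta> = {\<theta>} \<union> B" unfolding tail_cluster_def B_def by simp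
  let ?K = "convex_cone hull (tail_cluster \<theta>)"
  have K: "?K = (\<Union>x\<in>{r *\<^sub>R \<theta> | r. 0 \<le> r}. \<Union>y\<in>convex_cone hull B. {x + y})"
    unfolding T convex_cone_hull_Un ray ..
  have "?K \<inter> {y. w \<bullet> y = 0} face_of ?K"
  proof (rule face_of_Int_supporting_hyperplane_ge)
    show "convex ?K" by (rule convex_convex_cone_hull)
    show "w \<bullet> y \<ge> 0" if "y \<in> ?K" for y
      using that tail w\<theta> unfolding K by (fastforce simp: inner_add_right)
  qed
  also have "?K \<inter> {y. w \<bullet> y = 0} = {r *\<^sub>R \<theta> | r. 0 \<le> r}"
  proof
    show "?K \<inter> {y. w \<bullet> y = 0} \<subseteq> {r *\<^sub>R \<theta> | r. 0 \<le> r}"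
      using tail w\<theta> unfolding K by (fastforce simp: inner_add_right)
    show "{r *\<^sub>R \<theta> | r. 0 \<le> r} \<subseteq> ?K \<inter> {y. w \<bullet> y = 0}"
      using w\<theta> unfolding ray[symmetric] T using hull_mono[of "{\<theta>}" "{\<theta>} \<union> B" convex_cone]
      by (auto simp: ray)
  qed
  finally have "{r *\<^sub>R \<theta> | r. 0 \<le> r} face_of ?K" .
  moreover have "{r *\<^sub>R \<theta> | r. 0 \<le> r} \<noteq> {}" by auto
  ultimately show ?thesis
    unfolding cluster_fan_def using tail_cluster_in_clusters[OF n \<theta>] by blast
qed

lemma simple_root_sum_zero:
  assumes "1 \<le> k" "k \<le> n"
  shows "simple_root e k \<in> sum_zero_space n e"
proof -
  have "(\<Sum>i=1..n + 1. simple_root e k \<bullet> e i) =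
      (\<Sum>i=1..n + 1. (if i = k then 1 else 0) - (if i = Suc k then 1 else 0))"
    using assms by (intro sum.cong) (auto simp: simple_root_def inner_diff_left e_inner)
  also have "\<dots> = 0" using assms by (simp add: sum_subtractf)
  finally show ?thesis unfolding sum_zero_space_def by blast
qed

text \<open>
  Functionals may be replaced by vectors of the space \<open>V\<close>, in which the fans live.
\<close>

lemma sum_zero_projection:
  obtains c' where "c' \<in> sum_zero_space n e" "\<And>z. z \<in> sum_zero_space n e \<Longrightarrow> c' \<bullet> z = c \<bullet> z"
proof -
  define one where "one = (\<Sum>i=1..n + 1. e i)"
  define m where "m = (\<Sum>i=1..n + 1. c \<bullet> e i) / real (n + 1)"
  have one_e: "one \<bullet> e i = 1" if "i \<in> {1..n + 1}" for i
    using standard_basis_coefficient[OF basis that, of "\<lambda>_. 1"] by (simp add: one_def)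
  have "(\<Sum>i=1..n + 1. (c - m *\<^sub>R one) \<bullet> e i) = (\<Sum>i=1..n + 1. c \<bullet> e i - m)"
    using one_e by (intro sum.cong) (auto simp: inner_diff_left)
  also have "\<dots> = 0" by (simp add: sum_subtractf m_def)
  finally have "c - m *\<^sub>R one \<in> sum_zero_space n e" unfolding sum_zero_space_def by blast
  moreover have "(c - m *\<^sub>R one) \<bullet> z = c \<bullet> z" if "z \<in> sum_zero_space n e" for z
  proof -
    have "one \<bullet> z = (\<Sum>i=1..n + 1. z \<bullet> e i)"
      unfolding one_def inner_sum_left by (intro sum.cong refl inner_commute)
    also have "\<dots> = 0" using that unfolding sum_zero_space_def by blast
    finally have "one \<bullet> z = 0" .
    then show ?thesis by (simp add: inner_diff_left)
  qed
  ultimately show thesis by (rule that)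
qed

end

lemma small_perturbation:
  fixes A B :: "'a \<Rightarrow> real"
  assumes "finite W" "\<And>w. w \<in> W \<Longrightarrow> A w > 0 \<or> A w = 0 \<and> B w = 0"
  shows "\<exists>\<epsilon>>0. \<forall>w\<in>W. \<epsilon> * B w \<le> A w"
  using assms
proof (induction W rule: finite_induct)
  case empty
  show ?case by (intro exI[of _ 1]) simp
next
  case (insert x W)
  then obtain \<epsilon> where \<epsilon>: "\<epsilon> > 0" "\<And>w. w \<in> W \<Longrightarrow> \<epsilon> * B w \<le> A w" by auto
  define \<delta> where "\<delta> = (if B x > 0 then min \<epsilon> (A x / B x) else \<epsilon>)"
  have Ax: "A x > 0 \<or> A x = 0 \<and> B x = 0" using insert.prems by simp
  have \<delta>: "\<delta> > 0" "\<delta> \<le> \<epsilon>" using \<epsilon>(1) Ax by (auto simp: \<delta>_def)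
  have "\<delta> * B x \<le> A x"
  proof (cases "B x > 0")
    case True
    then have "\<delta> \<le> A x / B x" by (simp add: \<delta>_def)
    then show ?thesis using True by (simp add: pos_le_divide_eq)
  next
    case False
    then have "\<delta> * B x \<le> 0" using \<delta>(1) by (simp add: mult_nonneg_nonpos)
    then show ?thesis using Ax by linarith
  qed
  moreover have "\<delta> * B w \<le> A w" if w: "w \<in> W" for w
  proof (cases "B w > 0")
    case True
    then have "\<delta> * B w \<le> \<epsilon> * B w" using \<delta>(2) by (simp add: mult_right_mono)
    then show ?thesis using \<epsilon>(2)[OF w] by linarith
  next
    case False
    then have "\<delta> * B w \<le> 0" using \<delta>(1) by (simp add: mult_nonneg_nonpos)
    moreover have "A w \<ge> 0" using insert.prems w by fastforce
    ultimately show ?thesis by linarith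
  qed
  ultimately show ?case using \<delta>(1) by (intro exI[of _ \<delta>]) auto
qed

text \<open>
  Let \<open>c\<close> expose the face \<open>F\<close>. If \<open>d\<close> is constant on \<open>F\<close>, then \<open>c + \<epsilon> d\<close> is still maximal on \<open>F\<close> for small
  \<open>\<epsilon> > 0\<close>. Both vectors then lie on the ray, and so \<open>d\<close> is on its line.
\<close>

lemma normal_ray_functionals:
  fixes P :: "'a::euclidean_space set"
  assumes P: "polytope P" and F: "F face_of P" "F \<noteq> {}"
    and V: "\<And>c. \<exists>c'\<in>V. \<forall>x\<in>P. \<forall>y\<in>P. c' \<bullet> (x - y) = c \<bullet> (x - y)" and "subspace V"
    and ray: "normal_cone V P F = {r *\<^sub>R \<theta> | r. 0 \<le> r}"
    and d: "d \<in> V" "\<And>x. x \<in> F \<Longrightarrow> d \<bullet> x = k"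
  shows "\<exists>r. d = r *\<^sub>R \<theta>"
proof -
  obtain W where W: "finite W" "P = convex hull W" using P unfolding polytope_def by blast
  have "F exposed_face_of P" using exposed_face_of_polyhedron[OF polytope_imp_polyhedron[OF P]] F by blast
  then obtain a b where a: "P \<subseteq> {x. a \<bullet> x \<le> b}" "F = P \<inter> {x. a \<bullet> x = b}"
    unfolding exposed_face_of_def by blast
  obtain c where c: "c \<in> V" "\<And>x y. x \<in> P \<Longrightarrow> y \<in> P \<Longrightarrow> c \<bullet> (x - y) = a \<bullet> (x - y)"
    using V[of a] by blast
  obtain x0 where x0: "x0 \<in> F" using F by blast
  have x0P: "x0 \<in> P" "a \<bullet> x0 = b" using a(2) x0 by auto
  have cF: "c \<bullet> x = c \<bullet> x0" if "x \<in> F" for x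
    using c(2)[of x x0] that x0P a(2) by (simp add: inner_diff_right)
  have cP: "c \<bullet> y \<le> c \<bullet> x0" if "y \<in> P" for y
    using c(2)[OF that x0P(1)] a(1) that x0P(2) by (auto simp: inner_diff_right)
  have inF: "y \<in> F" if "y \<in> P" "c \<bullet> y = c \<bullet> x0" for y
    using c(2)[OF that(1) x0P(1)] that x0P(2) a(2) by (auto simp: inner_diff_right)
  have c_ray: "c \<in> normal_cone V P F"
    unfolding normal_cone_def using c(1) cF cP by auto
  have "c \<bullet> x0 - c \<bullet> y > 0 \<or> c \<bullet> x0 - c \<bullet> y = 0 \<and> d \<bullet> y - k = 0" if "y \<in> W" for y
  proof -
    have "y \<in> P" using that W(2) by (simp add: hull_inc)
    then show ?thesis using cP[of y] inF[of y] d(2)[of y] by fastforce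
  qed
  from small_perturbation[OF W(1), of "\<lambda>y. c \<bullet> x0 - c \<bullet> y" "\<lambda>y. d \<bullet> y - k", OF this]
  obtain \<epsilon> where \<epsilon>: "\<epsilon> > 0"
    "\<And>y. y \<in> W \<Longrightarrow> \<epsilon> * (d \<bullet> y - k) \<le> c \<bullet> x0 - c \<bullet> y" by blast
  define l where "l y = (- (c + \<epsilon> *\<^sub>R d)) \<bullet> y + (c \<bullet> x0 + \<epsilon> * k)" for y
  have "affine_functional l" unfolding affine_functional_def l_def by blast
  have lP: "l y \<ge> 0" if "y \<in> P" for y
  proof (rule affine_functional_nonneg_hull[OF \<open>affine_functional l\<close>])
    show "y \<in> convex hull W" using that W(2) by simp
    show "l z \<ge> 0" if "z \<in> W" for z
      using \<epsilon>(2)[OF that] by (simp add: l_def inner_add_left inner_diff_left algebra_simps)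
  qed
  have "(c + \<epsilon> *\<^sub>R d) \<bullet> y \<le> (c + \<epsilon> *\<^sub>R d) \<bullet> x" if "x \<in> F" "y \<in> P" for x y
    using lP[OF that(2)] cF[OF that(1)] d(2)[OF that(1)] by (simp add: l_def inner_add_left inner_diff_left)
  moreover have "c + \<epsilon> *\<^sub>R d \<in> V" using c(1) d(1) \<open>subspace V\<close> by (simp add: subspace_add subspace_mul)
  ultimately have "c + \<epsilon> *\<^sub>R d \<in> normal_cone V P F" unfolding normal_cone_def by blast
  then obtain r1 r2 where r: "c = r1 *\<^sub>R \<theta>" "c + \<epsilon> *\<^sub>R d = r2 *\<^sub>R \<theta>" using c_ray unfolding ray by blast
  have "d = (1 / \<epsilon>) *\<^sub>R ((c + \<epsilon> *\<^sub>R d) - c)" using \<epsilon>(1) by simp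
  also have "\<dots> = ((r2 - r1) / \<epsilon>) *\<^sub>R \<theta>"
    unfolding r(2) unfolding r(1) scaleR_left_diff_distrib[symmetric] by simp
  finally show ?thesis by blast
qed

lemma subspace_sum_zero: "subspace (sum_zero_space n e)"
  unfolding sum_zero_space_def
  by (rule subspaceI) (simp_all add: inner_add_left sum.distrib sum_distrib_left[symmetric] del: sum.cl_ivl_Suc)

text \<open>
  If \<open>\<alpha>\<^sub>1\<close> were constant on the polytope, the normal cone of every face would contain with
  \<open>\<alpha>\<^sub>1\<close> also \<open>- \<alpha>\<^sub>1\<close>, and would not be a ray.
\<close>

lemma Ass_II_has_opposite_facets:
  fixes e :: "nat \<Rightarrow> 'a::euclidean_space"
  assumes n: "1 \<le> n" and e: "standard_basis (n + 1) e" and P: "is_Ass_II n e P"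
  shows "has_opposite_facets P"
proof -
  interpret type_A_roots n e by unfold_locales (rule e)
  let ?V = "sum_zero_space n e"
  have poly: "polytope P" and diff: "\<And>x y. x \<in> P \<Longrightarrow> y \<in> P \<Longrightarrow> x - y \<in> ?V"
    and fan: "normal_fan ?V P = cluster_fan n e"
    using P unfolding is_Ass_II_def by auto
  have V: "\<exists>c'\<in>?V. \<forall>x\<in>P. \<forall>y\<in>P. c' \<bullet> (x - y) = c \<bullet> (x - y)" for c
    using sum_zero_projection[of c] diff by metis
  define \<alpha> where "\<alpha> = simple_root e 1"
  have \<alpha>V: "\<alpha> \<in> ?V" unfolding \<alpha>_def by (rule simple_root_sum_zero) (use n in auto)
  have \<alpha>0: "\<alpha> \<noteq> 0"
  proof -
    have "\<alpha> \<bullet> e 1 = 1" using e_inner[of 1 1] e_inner[of "Suc 1" 1] n by (simp add: \<alpha>_def simple_root_def inner_diff_left)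
    then show ?thesis by auto
  qed
  have face: "\<exists>F. F face_of P \<and> F \<noteq> {} \<and> normal_cone ?V P F = {r *\<^sub>R \<theta> | r. 0 \<le> r}"
    if "\<theta> = \<alpha> \<or> \<theta> = - \<alpha>" for \<theta>
  proof -
    have "{r *\<^sub>R \<theta> | r. 0 \<le> r} \<in> normal_fan ?V P"
      using tail_ray_in_cluster_fan[OF n, of \<theta>] that unfolding fan \<alpha>_def by blast
    then show ?thesis unfolding normal_fan_def by blast
  qed
  have facet: "facet_functional P \<theta>" if \<theta>: "\<theta> = \<alpha> \<or> \<theta> = - \<alpha>" for \<theta>
    unfolding facet_functional_def
  proof (intro allI impI)
    fix d k assume dk: "\<forall>x\<in>P. (\<forall>y\<in>P. \<theta> \<bullet> y \<le> \<theta> \<bullet> x) \<longrightarrow> d \<bullet> x = k"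
    obtain F where F: "F face_of P" "F \<noteq> {}" "normal_cone ?V P F = {r *\<^sub>R \<theta> | r. 0 \<le> r}"
      using face[OF \<theta>] by blast
    obtain d' where d': "d' \<in> ?V" "\<And>x y. x \<in> P \<Longrightarrow> y \<in> P \<Longrightarrow> d' \<bullet> (x - y) = d \<bullet> (x - y)"
      using V[of d] by blast
    obtain x0 where x0: "x0 \<in> F" using F(2) by blast
    have FP: "F \<subseteq> P" using F(1) by (rule face_of_imp_subset)
    have "\<theta> = 1 *\<^sub>R \<theta>" by simp
    then have "\<theta> \<in> normal_cone ?V P F" unfolding F(3) by (metis (mono_tags, lifting) mem_Collect_eq zero_le_one)
    then have max: "\<theta> \<bullet> y \<le> \<theta> \<bullet> x" if "x \<in> F" "y \<in> P" for x y
      using that unfolding normal_cone_def by blast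
    have dF: "d \<bullet> x = k" if "x \<in> F" for x using dk max that FP by blast
    have "d' \<bullet> x = d' \<bullet> x0" if "x \<in> F" for x
      using d'(2)[of x x0] that x0 FP dF[of x] dF[of x0] by (auto simp: inner_diff_right)
    from normal_ray_functionals[OF poly F(1,2) V subspace_sum_zero F(3) d'(1) this]
    obtain r where r: "d' = r *\<^sub>R \<theta>" by blast
    have "d \<bullet> x = r * (\<theta> \<bullet> x) + (d \<bullet> x0 - r * (\<theta> \<bullet> x0))" if "x \<in> P" for x
      using d'(2)[OF that, of x0] x0 FP unfolding r by (auto simp: inner_diff_right algebra_simps)
    then show "\<exists>r b. \<forall>x\<in>P. d \<bullet> x = r * (\<theta> \<bullet> x) + b" by blast
  qed
  have "\<exists>x\<in>P. \<exists>y\<in>P. \<alpha> \<bullet> x \<noteq> \<alpha> \<bullet> y"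
  proof (rule ccontr)
    assume n: "\<not> ?thesis"
    obtain F where F: "F face_of P" "normal_cone ?V P F = {r *\<^sub>R \<alpha> | r. 0 \<le> r}"
      using face[OF disjI1[OF refl]] by blast
    have const: "\<alpha> \<bullet> x = \<alpha> \<bullet> y" if "x \<in> P" "y \<in> P" for x y using n that by blast
    have "(- \<alpha>) \<bullet> y \<le> (- \<alpha>) \<bullet> x" if "x \<in> F" "y \<in> P" for x y
      using const[of x y] that face_of_imp_subset[OF F(1)] by auto
    moreover have "- \<alpha> \<in> ?V" using \<alpha>V subspace_sum_zero subspace_neg by blast
    ultimately have "- \<alpha> \<in> normal_cone ?V P F" unfolding normal_cone_def by blast
    then obtain r where r: "- \<alpha> = r *\<^sub>R \<alpha>" "0 \<le> r" unfolding F(2) by blast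
    then have "(1 + r) *\<^sub>R \<alpha> = 0" by (simp add: scaleR_left_distrib flip: r(1))
    then show False using r(2) \<alpha>0 by simp
  qed
  then show ?thesis using facet[of \<alpha>] facet[of "- \<alpha>"] unfolding has_opposite_facets_def by blast
qed

section \<open>Inequivalence of the realizations\<close>

theorem theorem3p1:
  fixes n :: nat
    and e :: "nat \<Rightarrow> 'a::euclidean_space"
    and f :: "nat \<Rightarrow> 'b::euclidean_space"
    and q :: "nat \<Rightarrow> real^2" and Q :: "(real^2) set"
  assumes "n \<ge> 2"
    and "standard_basis (n + 1) e"
    and "standard_basis (n + 3) f"
    and "convex_polygon (n + 3) q Q"
  shows "(\<forall>P :: 'a set. is_Ass_II n e P \<longrightarrow> \<not> affinely_equivalent (Ass_I n q Q f) P) \<and>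
         (\<forall>a :: nat \<Rightarrow> nat \<Rightarrow> real.
            (\<forall>i j. 1 \<le> i \<and> i \<le> j \<and> j \<le> n + 1 \<longrightarrow> a i j > 0) \<longrightarrow>
            \<not> affinely_equivalent (Ass_I n q Q f) (Ass_III n e a))"
proof (intro conjI allI impI)
  have I: "\<not> has_opposite_facets (Ass_I n q Q f)"
    by (rule Ass_I_no_opposite_facets[OF assms(1,3,4)])
  have n: "1 \<le> n" using assms(1) by simp
  show "\<not> affinely_equivalent (Ass_I n q Q f) P" if "is_Ass_II n e P" for P :: "'a set"
    using has_opposite_facets_affinely_equivalent Ass_II_has_opposite_facets[OF n assms(2) that] I by blast
  show "\<not> affinely_equivalent (Ass_I n q Q f) (Ass_III n e a)"
    if "\<forall>i j. 1 \<le> i \<and> i \<le> j \<and> j \<le> n + 1 \<longrightarrow> a i j > 0" for a :: "nat \<Rightarrow> nat \<Rightarrow> real"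
    using has_opposite_facets_affinely_equivalent Ass_III_has_opposite_facets[OF n assms(2)] that I by blast
qed

end
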